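(* Let $\beta>0$. Then, as $n\to\infty$, with $t_{\mathrm{ent}}=\log n/\mathrm{H}$, $$\min_{x\in[n]}\big\|P^{(1-\beta)t_{\mathrm{ent}}}(x,\cdot)-\pi\big\|_{\mathrm{TV}}\longrightarrow 1\quad\text{in }\mathbb{P}\text{-probability}$$ (where in this first limit $\beta\le 1$, so that the time is nonnegative), and $$\max_{x\in[n]}\big\|P^{(1+\beta)t_{\mathrm{ent}}}(x,\cdot)-\pi\big\|_{\mathrm{TV}}\longrightarrow 0\quad\text{in }\mathbb{P}\text{-probability}.$$
   Context: Model. For each integer $n\ge 2$ let $[n]=\{1,\dots,n\}$ and let $(w_x^+)_{x\in[n]}$, $(w_x^-)_{x\in[n]}$ be positive weights (allowed to depend on $n$) with $\sum_{x}w_x^+=\sum_x w_x^-=:\boldsymbol{w}$. The Chung–Lu digraph $G$ on $[n]$ has each oriented edge $x\to y$, $x\ne y$, present independently with probability $p_{xy}=\big(w_x^+w_y^-\frac{\log n}{n}\big)\wedge 1$ (no self-loops). Its law is $\mathbb{P}$ with expectation $\mathbb{E}$. Assumptions on the weights: there are constants $M_0,M_1>1$, $M_2>0$, $0<\eta<1$, independent of $n$, such that for every $n$: $M_0\le w_x^+\le M_1$ for all $x\in[n]$, and $\sum_{x\in[n]}(w_x^-)^{2+\eta}\le M_2 n$. $D_x^+$ denotes the out-degree of $x$. The simple random walk has transition matrix $P(x,y)=1/D_x^+$ if $x\to y$ and $P(x,y)=0$ otherwise; $P^t$ is the $t$-step kernel. Non-integer times are replaced by their integer parts. Let $\mu_{\mathrm{in}}(x):=w_x^-/\boldsymbol{w}$,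 and let $V$ have law $\mu_{\mathrm{in}}$, independent of $G$. The entropy is $\mathrm{H}:=(\mathbb{E}\times\mu_{\mathrm{in}})[\log(D_V^+\vee 1)]=\sum_x\mu_{\mathrm{in}}(x)\,\mathbb{E}[\log(D_x^+\vee 1)]$. $\pi$ is the unique invariant probability measure of $P$ ($\pi P=\pi$), which exists and is unique with $\mathbb{P}$-probability tending to $1$; on the complementary event $\pi$ is taken to be an arbitrary probability measure. $\|\mu-\nu\|_{\mathrm{TV}}=\frac12\sum_x|\mu(x)-\nu(x)|$. *)

theory Defs
  imports "HOL-Probability.Probability"
begin

text \<open>A digraph on \<open>{1..n}\<close> is encoded by its adjacency predicate: \<open>G (x, y)\<close> holds iff
  \<open>x \<rightarrow> y\<close> is an edge. The weights \<open>wp\<close> and \<open>wm\<close> are the out- and in-weights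
  \<open>w\<^sup>+\<close> and \<open>w\<^sup>-\<close> for one fixed value of \<open>n\<close>.\<close>

type_synonym digraph = "nat \<times> nat \<Rightarrow> bool"

definition arc_pairs :: "nat \<Rightarrow> (nat \<times> nat) set" where
  "arc_pairs n = {(x, y). x \<in> {1..n} \<and> y \<in> {1..n} \<and> x \<noteq> y}"

definition edge_prob :: "nat \<Rightarrow> (nat \<Rightarrow> real) \<Rightarrow> (nat \<Rightarrow> real) \<Rightarrow> nat \<Rightarrow> nat \<Rightarrow> real" where
  "edge_prob n wp wm x y = min (wp x * wm y * (ln (real n) / real n)) 1"

text \<open>Pairs outside \<open>arc_pairs n\<close>, in particular loops, are almost surely not edges.\<close>

definition chung_lu :: "nat \<Rightarrow> (nat \<Rightarrow> real) \<Rightarrow> (nat \<Rightarrow> real) \<Rightarrow> digraph pmf" where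
  "chung_lu n wp wm =
     Pi_pmf (arc_pairs n) False (\<lambda>(x, y). bernoulli_pmf (edge_prob n wp wm x y))"

definition outdeg :: "nat \<Rightarrow> digraph \<Rightarrow> nat \<Rightarrow> nat" where
  "outdeg n G x = card {y \<in> {1..n}. G (x, y)}"

text \<open>A vertex without out-neighbours has a zero row, so the matrix is only substochastic
  in general.\<close>

definition trans_mat :: "nat \<Rightarrow> digraph \<Rightarrow> nat \<Rightarrow> nat \<Rightarrow> real" where
  "trans_mat n G x y = (if G (x, y) then 1 / real (outdeg n G x) else 0)"

fun trans_pow :: "nat \<Rightarrow> digraph \<Rightarrow> nat \<Rightarrow> nat \<Rightarrow> nat \<Rightarrow> real" where
  "trans_pow n G 0 x y = (if x = y then 1 else 0)"
| "trans_pow n G (Suc t) x y = (\<Sum>z\<in>{1..n}. trans_mat n G x z * trans_pow n G t z y)"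

definition invariant_prob :: "nat \<Rightarrow> digraph \<Rightarrow> nat pmf \<Rightarrow> bool" where
  "invariant_prob n G \<nu> \<longleftrightarrow>
     set_pmf \<nu> \<subseteq> {1..n} \<and>
     (\<forall>y\<in>{1..n}. (\<Sum>x\<in>{1..n}. pmf \<nu> x * trans_mat n G x y) = pmf \<nu> y)"

definition tv_dist :: "nat \<Rightarrow> (nat \<Rightarrow> real) \<Rightarrow> (nat \<Rightarrow> real) \<Rightarrow> real" where
  "tv_dist n \<mu> \<nu> = (1 / 2) * (\<Sum>x\<in>{1..n}. \<bar>\<mu> x - \<nu> x\<bar>)"

definition mu_in :: "nat \<Rightarrow> (nat \<Rightarrow> real) \<Rightarrow> nat \<Rightarrow> real" where
  "mu_in n wm x = wm x / (\<Sum>y\<in>{1..n}. wm y)"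

definition entropy_H :: "nat \<Rightarrow> (nat \<Rightarrow> real) \<Rightarrow> (nat \<Rightarrow> real) \<Rightarrow> real" where
  "entropy_H n wp wm =
     (\<Sum>x\<in>{1..n}. mu_in n wm x *
        measure_pmf.expectation (chung_lu n wp wm) (\<lambda>G. ln (real (max (outdeg n G x) 1))))"

definition t_ent :: "nat \<Rightarrow> (nat \<Rightarrow> real) \<Rightarrow> (nat \<Rightarrow> real) \<Rightarrow> real" where
  "t_ent n wp wm = ln (real n) / entropy_H n wp wm"

text \<open>Convergence in probability to a constant, the probability space varying with \<open>n\<close>.\<close>

definition tendsto_in_prob :: "(nat \<Rightarrow> 'a pmf) \<Rightarrow> (nat \<Rightarrow> 'a \<Rightarrow> real) \<Rightarrow> real \<Rightarrow> bool" where
  "tendsto_in_prob p X c \<longleftrightarrow>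
     (\<forall>\<epsilon>>0. (\<lambda>n. measure_pmf.prob (p n) {\<omega>. \<bar>X n \<omega> - c\<bar> > \<epsilon>}) \<longlonglongrightarrow> 0)"

end

theory Submission
  imports Defs "HOL-Real_Asymp.Real_Asymp"
begin

text \<open>All out-degrees are of order \<open>ln n\<close>, so every path of length \<open>t\<close> has weight
  \<open>(ln n) powr (- t)\<close> up to a factor \<open>exp (O t)\<close>, and \<open>H = ln (ln n) + O 1\<close>; no law of large
  numbers for the path weights is needed. The rows of the transition matrix are independent with
  mean row close to \<open>\<mu> = mu_in\<close>, and as the degrees diverge, \<open>\<pi>\<close> itself is close to \<open>\<mu>\<close>.

  Upper bound. Let \<open>T z y\<close> be the weight of the simple paths of length \<open>t\<close> from \<open>z\<close> to \<open>y\<close>. Expanding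
  over pairs of simple paths \<open>v\<close>, \<open>u\<close>, row independence turns the expected weight of the pair into the
  \<open>\<mu>\<close>-weight of \<open>v\<close> times the weight of \<open>u\<close> for the kernel \<open>\<mu> + \<theta> * (edges of v)\<close> with
  \<open>\<theta> = 2 / ln n\<close>. Summation gives a chi-square distance of order \<open>n * \<theta> ^ t + o 1\<close>, which tends to
  \<open>0\<close> for \<open>t\<close> slightly below \<open>(1 + \<beta>) * t_ent\<close>; hence \<open>T z\<close> is close to \<open>\<mu>\<close> for \<open>\<mu>\<close>-most \<open>z\<close>. To reach all
  starting points \<open>x\<close>, take one more step: discarding the paths through \<open>x\<close> changes little uniformly in \<open>x\<close>,
  and what remains is independent of row \<open>x\<close>. As \<open>x\<close> has order \<open>ln n\<close> out-neighbours, a Chernoff bound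
  shows with error \<open>o (1 / n)\<close> that few of them are bad.

  Lower bound. A walk of length \<open>(1 - \<beta>) * t_ent\<close> reaches at most \<open>n powr (1 - \<beta> + o 1)\<close> vertices, and
  by Cauchy-Schwarz such a set has vanishing mass under \<open>\<mu>\<close>, hence under \<open>\<pi>\<close>.\<close>


section \<open>Sums of independent bits\<close>

lemma finite_set_Pi_pmf:
  assumes "finite A" "\<And>x. x \<in> A \<Longrightarrow> finite (set_pmf (p x))"
  shows "finite (set_pmf (Pi_pmf A d p))"
  using assms by (auto simp: set_Pi_pmf)

lemma finite_set_bits [simp]:
  "finite B \<Longrightarrow> finite (set_pmf (Pi_pmf B False (\<lambda>y. bernoulli_pmf (p y))))"
  by (rule finite_set_Pi_pmf) auto

lemma integrable_bits [simp]:
  fixes f :: "_ \<Rightarrow> real"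
  shows "finite B \<Longrightarrow> integrable (measure_pmf (Pi_pmf B False (\<lambda>y. bernoulli_pmf (p y)))) f"
  by (rule integrable_measure_pmf_finite) simp

lemma expectation_mono_finite:
  fixes f g :: "_ \<Rightarrow> real"
  assumes "finite (set_pmf M)" "\<And>x. x \<in> set_pmf M \<Longrightarrow> f x \<le> g x"
  shows "measure_pmf.expectation M f \<le> measure_pmf.expectation M g"
  using assms by (intro integral_mono_AE integrable_measure_pmf_finite) (auto simp: AE_measure_pmf_iff)

lemma expectation_bits_insert:
  fixes g :: "_ \<Rightarrow> real"
  assumes B: "finite B" "i \<notin> B" and p: "0 \<le> p i" "p i \<le> 1"
  shows "measure_pmf.expectation (Pi_pmf (insert i B) False (\<lambda>y. bernoulli_pmf (p y))) g =
     p i * measure_pmf.expectation (Pi_pmf B False (\<lambda>y. bernoulli_pmf (p y))) (\<lambda>r. g (r(i := True)))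
     + (1 - p i) * measure_pmf.expectation (Pi_pmf B False (\<lambda>y. bernoulli_pmf (p y))) (\<lambda>r. g (r(i := False)))"
proof -
  let ?M = "Pi_pmf B False (\<lambda>y. bernoulli_pmf (p y))"
  have "measure_pmf.expectation (Pi_pmf (insert i B) False (\<lambda>y. bernoulli_pmf (p y))) g
    = measure_pmf.expectation (bernoulli_pmf (p i) \<bind> (\<lambda>y. map_pmf (\<lambda>f. f(i := y)) ?M)) g"
    using B by (subst Pi_pmf_insert') (auto simp: map_pmf_def)
  also have "\<dots> = (\<Sum>a\<in>UNIV. pmf (bernoulli_pmf (p i)) a *\<^sub>R
      measure_pmf.expectation (map_pmf (\<lambda>f. f(i := a)) ?M) g)"
    using B by (intro pmf_expectation_bind) auto
  finally show ?thesis using p by (simp add: UNIV_bool)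
qed

definition num_true :: "'a set \<Rightarrow> ('a \<Rightarrow> bool) \<Rightarrow> nat" where
  "num_true B r = card {y \<in> B. r y}"

lemma num_true_upd [simp]:
  assumes "finite B" "i \<notin> B"
  shows "num_true (insert i B) (r(i := True)) = Suc (num_true B r)"
    and "num_true (insert i B) (r(i := False)) = num_true B r"
    and "num_true B (r(i := b)) = num_true B r"
proof -
  have 1: "{y \<in> insert i B. (r(i := True)) y} = insert i {y \<in> B. r y}"
    "{y \<in> insert i B. (r(i := False)) y} = {y \<in> B. r y}"
    "{y \<in> B. (r(i := b)) y} = {y \<in> B. r y}" using assms by auto
  show "num_true (insert i B) (r(i := True)) = Suc (num_true B r)"
    using assms unfolding num_true_def 1 by (subst card_insert_disjoint) auto
  show "num_true (insert i B) (r(i := False)) = num_true B r" "num_true B (r(i := b)) = num_true B r"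
    unfolding num_true_def 1 by auto
qed

lemma num_true_sum: "finite B \<Longrightarrow> real (num_true B r) = (\<Sum>y\<in>B. of_bool (r y))"
  by (simp add: num_true_def sum.If_cases of_bool_def Int_def)

context
  fixes p :: "'a \<Rightarrow> real"
  assumes p01: "\<And>y. 0 \<le> p y \<and> p y \<le> 1"
begin

definition expect_bits :: "'a set \<Rightarrow> (('a \<Rightarrow> bool) \<Rightarrow> real) \<Rightarrow> real" where
  "expect_bits B g = measure_pmf.expectation (Pi_pmf B False (\<lambda>y. bernoulli_pmf (p y))) g"

lemma expect_bits_insert: "finite B \<Longrightarrow> i \<notin> B \<Longrightarrow>
  expect_bits (insert i B) g = p i * expect_bits B (\<lambda>r. g (r(i := True))) + (1 - p i) * expect_bits B (\<lambda>r. g (r(i := False)))"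
  unfolding expect_bits_def using p01 by (intro expectation_bits_insert) auto

lemma expect_bits_mono: "finite B \<Longrightarrow> (\<And>r. f r \<le> g r) \<Longrightarrow> expect_bits B f \<le> expect_bits B g"
  unfolding expect_bits_def by (intro expectation_mono_finite) auto

lemma expect_bits_cmult: "expect_bits B (\<lambda>r. c * f r) = c * expect_bits B f"
  unfolding expect_bits_def by simp

lemma expect_bits_add: "finite B \<Longrightarrow> expect_bits B (\<lambda>r. f r + g r) = expect_bits B f + expect_bits B g"
  unfolding expect_bits_def by simp

lemma expect_bits_sum: "finite B \<Longrightarrow> expect_bits B (\<lambda>r. \<Sum>i\<in>I. f i r) = (\<Sum>i\<in>I. expect_bits B (f i))"
  unfolding expect_bits_def by (intro Bochner_Integration.integral_sum) auto

lemma expect_bits_const: "expect_bits B (\<lambda>r. c) = c"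
  unfolding expect_bits_def by simp

lemma expect_bits_nonneg: "(\<And>r. 0 \<le> f r) \<Longrightarrow> 0 \<le> expect_bits B f"
  unfolding expect_bits_def by (rule Bochner_Integration.integral_nonneg) auto

lemma expect_bits_single:
  assumes "finite B" "i \<in> B"
  shows "expect_bits B (\<lambda>r. of_bool (r i) * f (num_true B r)) = p i * expect_bits (B - {i}) (\<lambda>r. f (Suc (num_true (B - {i}) r)))"
proof -
  obtain C where C: "B = insert i C" "i \<notin> C" using assms(2) by (meson mk_disjoint_insert)
  then have "finite C" using assms by auto
  with C show ?thesis by (simp add: expect_bits_insert expect_bits_const)
qed

lemma expect_bits_pair:
  assumes "finite B" "i \<in> B" "j \<in> B" "i \<noteq> j"
  shows "expect_bits B (\<lambda>r. of_bool (r i) * of_bool (r j) * f (num_true B r)) =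
    p i * p j * expect_bits (B - {i,j}) (\<lambda>r. f (Suc (Suc (num_true (B - {i,j}) r))))"
proof -
  define C where "C = B - {i, j}"
  have C: "finite C" "i \<notin> insert j C" "j \<notin> C" "B = insert i (insert j C)"
    using assms by (auto simp: C_def)
  have "expect_bits B (\<lambda>r. of_bool (r i) * of_bool (r j) * f (num_true B r))
      = p i * expect_bits (insert j C) (\<lambda>r. of_bool (r j) * f (Suc (num_true (insert j C) r)))"
    using C assms by (simp add: expect_bits_insert expect_bits_const)
  also have "\<dots> = p i * p j * expect_bits C (\<lambda>r. f (Suc (Suc (num_true C r))))"
    using C by (simp add: expect_bits_insert expect_bits_const)
  finally show ?thesis by (simp add: C_def)
qed

lemma expect_bits_antimono_set:
  assumes "finite B" "antimono f"
  shows "expect_bits B (\<lambda>r. f (num_true B r)) \<le> expect_bits (B - {i}) (\<lambda>r. f (num_true (B - {i}) r))"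
proof (cases "i \<in> B")
  case True
  define C where "C = B - {i}"
  have C: "finite C" "i \<notin> C" "B = insert i C" using True assms by (auto simp: C_def)
  have "expect_bits B (\<lambda>r. f (num_true B r)) = p i * expect_bits (B - {i}) (\<lambda>r. f (Suc (num_true (B - {i}) r)))
     + (1 - p i) * expect_bits (B - {i}) (\<lambda>r. f (num_true (B - {i}) r))"
    using C by (simp add: expect_bits_insert flip: C_def)
  also have "\<dots> \<le> p i * expect_bits (B - {i}) (\<lambda>r. f (num_true (B - {i}) r))
     + (1 - p i) * expect_bits (B - {i}) (\<lambda>r. f (num_true (B - {i}) r))"
    using assms p01 by (intro add_mono mult_left_mono expect_bits_mono) (auto intro: antimonoD)
  finally show ?thesis by (simp add: algebra_simps)
qed simp

text \<open>Counting the sum over \<open>i\<close> of \<open>E [r i * f N]\<close> in two ways trades a factor \<open>N\<close> for the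
  mean \<open>sum p B\<close>.\<close>

lemma expect_bits_size_bias:
  assumes "finite B" "antimono f"
  shows "sum p B * expect_bits B (\<lambda>r. f (Suc (num_true B r))) \<le> expect_bits B (\<lambda>r. real (num_true B r) * f (num_true B r))"
proof -
  have "antimono (\<lambda>n. f (Suc n))" using assms(2) by (auto simp: antimono_def)
  then have "sum p B * expect_bits B (\<lambda>r. f (Suc (num_true B r)))
     \<le> (\<Sum>i\<in>B. p i * expect_bits (B - {i}) (\<lambda>r. f (Suc (num_true (B - {i}) r))))"
    unfolding sum_distrib_right using p01 assms(1)
    by (intro sum_mono mult_left_mono expect_bits_antimono_set[where f = "\<lambda>n. f (Suc n)"]) auto
  also have "\<dots> = (\<Sum>i\<in>B. expect_bits B (\<lambda>r. of_bool (r i) * f (num_true B r)))"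
    using assms by (intro sum.cong) (auto simp: expect_bits_single)
  also have "\<dots> = expect_bits B (\<lambda>r. real (num_true B r) * f (num_true B r))"
    using assms by (simp add: expect_bits_sum[symmetric] num_true_sum sum_distrib_right)
  finally show ?thesis .
qed

lemma expect_bits_inverse_Suc:
  assumes "finite B" "0 < sum p B"
  shows "expect_bits B (\<lambda>r. 1 / (1 + real (num_true B r))) \<le> 1 / sum p B"
proof -
  let ?f = "\<lambda>n::nat. 1 / max 1 (real n)"
  have a: "antimono ?f" by (auto simp: antimono_def intro!: divide_left_mono)
  have "sum p B * expect_bits B (\<lambda>r. 1 / (1 + real (num_true B r))) = sum p B * expect_bits B (\<lambda>r. ?f (Suc (num_true B r)))"
    by (simp add: max_def algebra_simps)
  also have "\<dots> \<le> expect_bits B (\<lambda>r. real (num_true B r) * ?f (num_true B r))"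
    by (rule expect_bits_size_bias[OF assms(1) a])
  also have "\<dots> \<le> expect_bits B (\<lambda>r. 1)"
    by (rule expect_bits_mono) (auto simp: assms max_def)
  finally show ?thesis using assms by (simp add: expect_bits_const field_simps)
qed

lemma expect_bits_inverse_Suc_Suc:
  assumes "finite B" "0 < sum p B"
  shows "expect_bits B (\<lambda>r. 1 / ((1 + real (num_true B r)) * (2 + real (num_true B r)))) \<le> 1 / (sum p B)\<^sup>2"
proof -
  let ?f = "\<lambda>n::nat. 1 / (max 1 (real n) * (1 + real n))"
  have a: "antimono ?f" by (auto simp: antimono_def intro!: divide_left_mono mult_mono)
  have e: "?f (Suc n) = 1 / ((1 + real n) * (2 + real n))" for n
    by (simp add: max_def algebra_simps)
  have "sum p B * expect_bits B (\<lambda>r. 1 / ((1 + real (num_true B r)) * (2 + real (num_true B r))))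
     = sum p B * expect_bits B (\<lambda>r. ?f (Suc (num_true B r)))"
    unfolding e ..
  also have "\<dots> \<le> expect_bits B (\<lambda>r. real (num_true B r) * ?f (num_true B r))"
    by (rule expect_bits_size_bias[OF assms(1) a])
  also have "\<dots> \<le> expect_bits B (\<lambda>r. 1 / (1 + real (num_true B r)))"
    by (rule expect_bits_mono) (use assms in \<open>auto simp: max_def divide_simps not_le\<close>)
  also have "\<dots> \<le> 1 / sum p B" by (rule expect_bits_inverse_Suc[OF assms])
  finally show ?thesis using assms by (simp add: field_simps power2_eq_square)
qed

lemma expect_bits_exp:
  assumes "finite B"
  shows "expect_bits B (\<lambda>r. exp (\<Sum>y\<in>B. l y * of_bool (r y))) \<le> exp (\<Sum>y\<in>B. p y * (exp (l y) - 1))"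
  using assms
proof (induction B rule: finite_induct)
  case empty
  then show ?case by (simp add: expect_bits_const)
next
  case (insert i B)
  have s: "(\<Sum>y\<in>insert i B. l y * of_bool ((r(i := b)) y)) = l i * of_bool b + (\<Sum>y\<in>B. l y * of_bool (r y))" for r b
    using insert by (auto intro!: sum.cong simp: fun_upd_def)
  have "expect_bits (insert i B) (\<lambda>r. exp (\<Sum>y\<in>insert i B. l y * of_bool (r y)))
    = (1 + p i * (exp (l i) - 1)) * expect_bits B (\<lambda>r. exp (\<Sum>y\<in>B. l y * of_bool (r y)))"
    using insert by (subst expect_bits_insert) (simp, simp, unfold s exp_add expect_bits_cmult, simp add: algebra_simps)
  also have "\<dots> \<le> exp (p i * (exp (l i) - 1)) * exp (\<Sum>y\<in>B. p y * (exp (l y) - 1))"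
    using insert p01 by (intro mult_mono exp_ge_add_one_self expect_bits_nonneg) auto
  finally show ?case using insert by (simp add: exp_add)
qed

end

section \<open>Path expansions\<close>

text \<open>Paths are lists in reverse order: the head is the current (last) vertex.\<close>

definition paths :: "'a set \<Rightarrow> nat \<Rightarrow> 'a list set" where
  "paths V s = {l. set l \<subseteq> V \<and> length l = Suc s}"

definition edges :: "'a list \<Rightarrow> ('a \<times> 'a) set" where
  "edges l = set (zip (tl l) l)"

fun path_weight :: "('a \<Rightarrow> 'a \<Rightarrow> real) \<Rightarrow> 'a list \<Rightarrow> real" where
  "path_weight K [] = 1"
| "path_weight K [a] = 1"
| "path_weight K (a # b # l) = K b a * path_weight K (b # l)"

fun walk :: "'a set \<Rightarrow> ('a \<Rightarrow> real) \<Rightarrow> ('a \<Rightarrow> 'a \<Rightarrow> real) \<Rightarrow> nat \<Rightarrow> 'a \<Rightarrow> real" where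
  "walk V f K 0 y = f y"
| "walk V f K (Suc s) y = (\<Sum>b\<in>V. walk V f K s b * K b y)"

lemma edges_simps [simp]: "edges [] = {}" "edges [a] = {}"
  "edges (a # b # l) = insert (b, a) (edges (b # l))"
  by (auto simp: edges_def)

lemma finite_edges [simp]: "finite (edges l)"
  by (simp add: edges_def)

lemma edges_set: "(b, a) \<in> edges l \<Longrightarrow> a \<in> set l \<and> b \<in> set l"
  unfolding edges_def by (cases l) (auto dest: set_zip_leftD set_zip_rightD)

lemma edges_nth: "(b, a) \<in> edges l \<longleftrightarrow> (\<exists>i. Suc i < length l \<and> b = l ! Suc i \<and> a = l ! i)"
  by (cases l) (auto simp: edges_def in_set_zip nth_tl)

lemma edges_functional:
  assumes "distinct l" "(b, a) \<in> edges l" "(b, a') \<in> edges l"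
  shows "a = a'"
  using assms unfolding edges_nth by (metis nth_eq_iff_index_eq nat.inject)

lemma edges_injective:
  assumes "distinct l" "(b, a) \<in> edges l" "(b', a) \<in> edges l"
  shows "b = b'"
  using assms unfolding edges_nth by (metis nth_eq_iff_index_eq Suc_lessD)

lemma edges_suffix:
  assumes "distinct (p @ a # l)" "(b, a) \<in> edges (p @ a # l)"
  shows "l \<noteq> []" "b = hd l"
proof -
  obtain i where i: "Suc i < length (p @ a # l)" "b = (p @ a # l) ! Suc i" "a = (p @ a # l) ! i"
    using assms(2) unfolding edges_nth by blast
  have "(p @ a # l) ! length p = a" by simp
  then have "i = length p" using i assms(1)
    by (metis Suc_lessD length_append length_Cons less_add_Suc1 nth_eq_iff_index_eq add_Suc_right)
  then show "l \<noteq> []" "b = hd l" using i by (auto simp: nth_append hd_conv_nth)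
qed

lemma path_weight_Cons: "l \<noteq> [] \<Longrightarrow> path_weight K (a # l) = K (hd l) a * path_weight K l"
  by (cases l) auto

lemma path_weight_nonneg: "(\<And>a b. 0 \<le> K a b) \<Longrightarrow> 0 \<le> path_weight K l"
  by (induction K l rule: path_weight.induct) auto

lemma path_weight_cong:
  "(\<And>a b. a \<in> set l \<Longrightarrow> K a b = K' a b) \<Longrightarrow> path_weight K l = path_weight K' l"
  by (induction K l rule: path_weight.induct) auto

lemma path_weight_cmult:
  "length l = Suc s \<Longrightarrow> path_weight (\<lambda>a b. c * K a b) l = c ^ s * path_weight K l"
  by (induction "\<lambda>a b. c * K a b" l arbitrary: s rule: path_weight.induct)
    (auto simp: less_Suc_eq_0_disj length_Suc_conv)

lemma path_weight_edges:
  "distinct l \<Longrightarrow> path_weight K l = (\<Prod>e\<in>edges l. K (fst e) (snd e))"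
proof (induction K l rule: path_weight.induct)
  case (3 K a b l)
  have "(b, a) \<notin> edges (b # l)" using 3(2) edges_set by fastforce
  with 3 show ?case by simp
qed auto

lemma finite_paths [simp]: "finite V \<Longrightarrow> finite (paths V s)"
  unfolding paths_def by (rule finite_lists_length_eq)

lemma paths_nonempty: "l \<in> paths V s \<Longrightarrow> l \<noteq> [] \<and> hd l \<in> V \<and> last l \<in> V"
  unfolding paths_def by (cases l) auto

lemma sum_paths_0: "(\<Sum>l\<in>paths V 0. F l) = (\<Sum>a\<in>V. F [a])"
proof -
  have "paths V 0 = (\<lambda>a. [a]) ` V"
    by (auto simp: paths_def length_Suc_conv)
  then show ?thesis by (simp add: sum.reindex inj_on_def)
qed

lemma sum_paths_Suc: "(\<Sum>l\<in>paths V (Suc s). F l) = (\<Sum>a\<in>V. \<Sum>l\<in>paths V s. F (a # l))"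
proof -
  have "paths V (Suc s) = (\<lambda>(a, l). a # l) ` (V \<times> paths V s)"
    by (auto simp: paths_def length_Suc_conv image_iff)
  then show ?thesis
    by (simp add: sum.reindex inj_on_def sum.cartesian_product split_def)
qed

lemma sum_path_weight:
  "(\<Sum>l\<in>paths V s. f (last l) * path_weight K l * g (hd l)) = (\<Sum>y\<in>V. walk V f K s y * g y)"
proof (induction s arbitrary: g)
  case 0
  show ?case by (simp add: sum_paths_0)
next
  case (Suc s)
  have "(\<Sum>l\<in>paths V (Suc s). f (last l) * path_weight K l * g (hd l))
     = (\<Sum>a\<in>V. \<Sum>l\<in>paths V s. f (last l) * path_weight K l * (K (hd l) a * g a))"
    unfolding sum_paths_Suc
    by (intro sum.cong refl) (auto simp: path_weight_Cons dest: paths_nonempty)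
  also have "\<dots> = (\<Sum>a\<in>V. \<Sum>b\<in>V. walk V f K s b * (K b a * g a))"
    by (subst Suc.IH[symmetric]) simp
  finally show ?case by (simp add: sum_distrib_left sum_distrib_right mult_ac)
qed

lemma walk_nonneg:
  "(\<And>y. 0 \<le> f y) \<Longrightarrow> (\<And>a b. 0 \<le> K a b) \<Longrightarrow> 0 \<le> walk V f K s y"
  by (induction s arbitrary: y) (auto intro!: sum_nonneg)

lemma sum_at_most_one:
  fixes g :: "'a \<Rightarrow> real"
  assumes "finite V" "\<And>a a'. P a \<Longrightarrow> P a' \<Longrightarrow> a = a'" "\<And>a. a \<in> V \<Longrightarrow> P a \<Longrightarrow> g a \<le> m" "0 \<le> m"
  shows "(\<Sum>a\<in>V. if P a then g a else 0) \<le> m"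
proof (cases "\<exists>a\<in>V. P a")
  case True
  then obtain a where a: "a \<in> V" "P a" by auto
  have "(\<Sum>b\<in>V. if P b then g b else 0) = (\<Sum>b\<in>V. if b = a then g b else 0)"
    using assms(2) a by (intro sum.cong) auto
  then show ?thesis using assms a by simp
next
  case False
  then have "(\<Sum>a\<in>V. if P a then g a else 0) = 0" by (intro sum.neutral) auto
  then show ?thesis using assms by simp
qed

text \<open>The kernel of the second path in the second moment: sharing an edge of \<open>v\<close> costs only \<open>\<theta>\<close>,
  since \<open>E [P x a * P x a]\<close> is of order \<open>\<theta> * \<mu> a\<close> instead of \<open>(\<mu> a)\<^sup>2\<close>.\<close>

definition kern :: "('a \<Rightarrow> real) \<Rightarrow> real \<Rightarrow> 'a list \<Rightarrow> 'a \<Rightarrow> 'a \<Rightarrow> real" where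
  "kern \<mu> \<theta> v b a = \<mu> a + (if (b, a) \<in> edges v then \<theta> else 0)"

fun discounted :: "('a \<Rightarrow> real) \<Rightarrow> real \<Rightarrow> 'a list \<Rightarrow> real" where
  "discounted \<mu> \<theta> [] = 0"
| "discounted \<mu> \<theta> (a # l) = \<mu> a + \<theta> * discounted \<mu> \<theta> l"

locale finite_dist =
  fixes V :: "'a set" and \<mu> :: "'a \<Rightarrow> real"
  assumes finV: "finite V" and mu_nonneg: "\<And>a. 0 \<le> \<mu> a" and mu_sum: "sum \<mu> V = 1"
begin

context
  fixes \<theta> :: real and v :: "'a list"
  assumes th: "0 \<le> \<theta>" and dv: "distinct v"
begin

lemma kern_nonneg: "0 \<le> kern \<mu> \<theta> v b a"
  using th mu_nonneg by (simp add: kern_def)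

lemma kern_row: "(\<Sum>a\<in>V. kern \<mu> \<theta> v b a) \<le> 1 + \<theta>"
  unfolding kern_def sum.distrib mu_sum
  using sum_at_most_one[OF finV, of "\<lambda>a. (b, a) \<in> edges v" "\<lambda>_. \<theta>" \<theta>] edges_functional[OF dv] th
  by auto

lemma walk_kern_nonneg: "(\<And>a. 0 \<le> f a) \<Longrightarrow> 0 \<le> walk V f (kern \<mu> \<theta> v) s y"
  by (intro walk_nonneg kern_nonneg)

lemma walk_kern_total:
  assumes "\<And>a. 0 \<le> f a" "sum f V \<le> 1"
  shows "(\<Sum>y\<in>V. walk V f (kern \<mu> \<theta> v) s y) \<le> (1 + \<theta>) ^ s"
proof (induction s)
  case (Suc s)
  have "(\<Sum>y\<in>V. walk V f (kern \<mu> \<theta> v) (Suc s) y)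
     = (\<Sum>b\<in>V. walk V f (kern \<mu> \<theta> v) s b * (\<Sum>y\<in>V. kern \<mu> \<theta> v b y))"
    by (simp add: sum_distrib_left) (rule sum.swap)
  also have "\<dots> \<le> (\<Sum>b\<in>V. walk V f (kern \<mu> \<theta> v) s b * (1 + \<theta>))"
    using assms by (intro sum_mono mult_left_mono kern_row walk_kern_nonneg)
  also have "\<dots> \<le> (1 + \<theta>) ^ s * (1 + \<theta>)"
    unfolding sum_distrib_right[symmetric] using Suc th by (intro mult_right_mono) auto
  finally show ?case by (simp add: mult_ac)
qed (use assms in simp)

lemma walk_kern_Suc:
  "walk V f (kern \<mu> \<theta> v) (Suc s) y = (\<Sum>b\<in>V. walk V f (kern \<mu> \<theta> v) s b) * \<mu> y
     + \<theta> * (\<Sum>b\<in>V. if (b, y) \<in> edges v then walk V f (kern \<mu> \<theta> v) s b else 0)"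
  unfolding sum_distrib_right sum_distrib_left
  by (simp add: kern_def algebra_simps sum.distrib[symmetric])
    (intro sum.cong, auto simp: algebra_simps)

lemma walk_kern_le:
  assumes "\<And>a. 0 \<le> f a" "sum f V \<le> 1" "\<And>a. f a \<le> m" "\<And>a. \<mu> a \<le> m"
  shows "walk V f (kern \<mu> \<theta> v) s y \<le> (1 + \<theta>) ^ s * m"
proof (induction s arbitrary: y)
  case (Suc s)
  have m: "0 \<le> m" using assms(1,3) order_trans by blast
  have "(\<Sum>b\<in>V. if (b, y) \<in> edges v then walk V f (kern \<mu> \<theta> v) s b else 0) \<le> (1 + \<theta>) ^ s * m"
    using Suc edges_injective[OF dv] th m by (intro sum_at_most_one finV) auto
  then have "walk V f (kern \<mu> \<theta> v) (Suc s) y \<le> (1 + \<theta>) ^ s * m + \<theta> * ((1 + \<theta>) ^ s * m)"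
    unfolding walk_kern_Suc using th assms mu_nonneg
    by (intro add_mono mult_mono walk_kern_total mult_left_mono) auto
  then show ?case by (simp add: algebra_simps)
qed (use assms in simp)

lemma discounted_nonneg: "0 \<le> discounted \<mu> \<theta> l"
  using mu_nonneg th by (induction l) auto

text \<open>Along \<open>v\<close> the walk either has followed \<open>v\<close> from the start, or its last jump off \<open>v\<close>
  landed \<open>k\<close> steps upstream, at a cost of \<open>\<theta> ^ k\<close>.\<close>

lemma walk_kern_on_path:
  assumes "\<And>a. 0 \<le> f a" "sum f V \<le> 1" "\<And>a. f a \<le> 1" "\<And>p a l. v = p @ a # l \<Longrightarrow> l \<noteq> [] \<Longrightarrow> f a = 0"
    and "v = p @ a # l"
  shows "walk V f (kern \<mu> \<theta> v) s a \<le> (1 + \<theta>) ^ s * discounted \<mu> \<theta> (a # l) + \<theta> ^ s"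
  using assms(5)
proof (induction s arbitrary: p a l)
  case 0
  have "0 \<le> discounted \<mu> \<theta> (a # l)" by (rule discounted_nonneg)
  then show ?case using assms(3)[of a] by simp
next
  case (Suc s)
  let ?w = "walk V f (kern \<mu> \<theta> v) s"
  have up: "(\<Sum>b\<in>V. if (b, a) \<in> edges v then ?w b else 0) \<le> (1 + \<theta>) ^ s * discounted \<mu> \<theta> l + \<theta> ^ s"
  proof (rule sum_at_most_one[OF finV])
    fix b assume "(b, a) \<in> edges v"
    then have "l \<noteq> []" "b = hd l" using edges_suffix dv Suc.prems by metis+
    then obtain l' where l': "l = b # l'" by (cases l) auto
    have "v = (p @ [a]) @ b # l'" using Suc.prems l' by simp
    from Suc.IH[OF this] l' show "?w b \<le> (1 + \<theta>) ^ s * discounted \<mu> \<theta> l + \<theta> ^ s" by simp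
  qed (use edges_injective[OF dv] discounted_nonneg th in auto)
  have "walk V f (kern \<mu> \<theta> v) (Suc s) a
      \<le> (1 + \<theta>) ^ s * \<mu> a + \<theta> * ((1 + \<theta>) ^ s * discounted \<mu> \<theta> l + \<theta> ^ s)"
    unfolding walk_kern_Suc using assms mu_nonneg th up
    by (intro add_mono mult_right_mono mult_left_mono walk_kern_total) auto
  also have "\<dots> = (1 + \<theta>) ^ s * discounted \<mu> \<theta> (a # l) + \<theta> ^ Suc s"
    by (simp add: algebra_simps)
  also have "\<dots> \<le> (1 + \<theta>) ^ Suc s * discounted \<mu> \<theta> (a # l) + \<theta> ^ Suc s"
    using th discounted_nonneg[of "a # l"] by (intro add_mono mult_right_mono) auto
  finally show ?case .
qed

lemma sum_kern_meetings:
  assumes f: "\<And>a. 0 \<le> f a" "sum f V \<le> 1" "\<And>a. f a \<le> m" "\<And>a. \<mu> a \<le> m"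
  shows "(\<Sum>u\<in>paths V s. f (last u) * path_weight (kern \<mu> \<theta> v) u * (\<Sum>a\<leftarrow>u. of_bool (a \<in> set v)))
     \<le> real (Suc s) * real (length v) * (1 + \<theta>) ^ s * m"
proof -
  let ?K = "kern \<mu> \<theta> v"
  have m: "0 \<le> m" using f(1,3) order_trans by blast
  have on: "(\<Sum>a\<in>V. walk V f ?K s a * of_bool (a \<in> set v)) \<le> real (length v) * (1 + \<theta>) ^ s * m" for s
  proof -
    have "(\<Sum>a\<in>V. walk V f ?K s a * of_bool (a \<in> set v)) = (\<Sum>a\<in>V \<inter> set v. walk V f ?K s a)"
      using finV by (intro sum.mono_neutral_cong_right) auto
    also have "\<dots> \<le> (\<Sum>a\<in>V \<inter> set v. (1 + \<theta>) ^ s * m)"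
      by (intro sum_mono walk_kern_le f)
    also have "\<dots> \<le> real (length v) * ((1 + \<theta>) ^ s * m)"
      using m th by (auto intro!: mult_right_mono order_trans[OF card_mono[OF _ Int_lower2] card_length])
    finally show ?thesis by (simp add: mult_ac)
  qed
  show ?thesis
  proof (induction s)
    case 0
    show ?case using on[of 0] by (simp add: sum_paths_0)
  next
    case (Suc s)
    let ?h = "\<lambda>u. (\<Sum>a\<leftarrow>u. of_bool (a \<in> set v) :: real)"
    have h: "0 \<le> ?h u" for u by (intro sum_list_nonneg) auto
    have "(\<Sum>u\<in>paths V (Suc s). f (last u) * path_weight ?K u * ?h u)
       = (\<Sum>a\<in>V. \<Sum>u\<in>paths V s. f (last u) * path_weight ?K u * ?h u * ?K (hd u) a)
         + (\<Sum>u\<in>paths V (Suc s). f (last u) * path_weight ?K u * of_bool (hd u \<in> set v))"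
      unfolding sum_paths_Suc sum.distrib[symmetric]
      by (intro sum.cong refl) (auto simp: path_weight_Cons algebra_simps dest: paths_nonempty)
    also have "(\<Sum>a\<in>V. \<Sum>u\<in>paths V s. f (last u) * path_weight ?K u * ?h u * ?K (hd u) a)
       = (\<Sum>u\<in>paths V s. f (last u) * path_weight ?K u * ?h u * (\<Sum>a\<in>V. ?K (hd u) a))"
      unfolding sum_distrib_left by (rule sum.swap)
    also have "\<dots> \<le> (\<Sum>u\<in>paths V s. f (last u) * path_weight ?K u * ?h u * (1 + \<theta>))"
      using f(1) h by (intro sum_mono mult_left_mono kern_row mult_nonneg_nonneg path_weight_nonneg kern_nonneg)
    also have "\<dots> \<le> real (Suc s) * real (length v) * (1 + \<theta>) ^ s * m * (1 + \<theta>)"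
      unfolding sum_distrib_right[symmetric] using Suc th by (intro mult_right_mono) auto
    also have "(\<Sum>u\<in>paths V (Suc s). f (last u) * path_weight ?K u * of_bool (hd u \<in> set v))
       \<le> real (length v) * (1 + \<theta>) ^ Suc s * m"
      using on[of "Suc s"] sum_path_weight[of f ?K "\<lambda>a. of_bool (a \<in> set v)" V "Suc s"] by simp
    finally show ?case by (simp add: algebra_simps)
  qed
qed

end

lemma sum_prod_list_mu: "(\<Sum>l\<in>paths V s. prod_list (map \<mu> l)) = 1"
  by (induction s) (simp_all add: sum_paths_0 sum_paths_Suc mu_sum flip: sum_distrib_left)

lemma sum_discounted:
  assumes "0 \<le> \<theta>" "\<theta> \<le> 1/2" "(\<Sum>a\<in>V. (\<mu> a)\<^sup>2) \<le> q"
  shows "(\<Sum>l\<in>paths V s. prod_list (map \<mu> l) * discounted \<mu> \<theta> l) \<le> 2 * q"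
proof -
  have q: "0 \<le> q" using assms(3) sum_nonneg[of V "\<lambda>a. (\<mu> a)\<^sup>2"] by simp
  show ?thesis
  proof (induction s)
    case 0
    show ?case using assms(3) q by (simp add: sum_paths_0 power2_eq_square)
  next
    case (Suc s)
    have "(\<Sum>l\<in>paths V (Suc s). prod_list (map \<mu> l) * discounted \<mu> \<theta> l)
      = (\<Sum>a\<in>V. (\<mu> a)\<^sup>2 * (\<Sum>l\<in>paths V s. prod_list (map \<mu> l)))
        + (\<Sum>a\<in>V. \<mu> a * (\<theta> * (\<Sum>l\<in>paths V s. prod_list (map \<mu> l) * discounted \<mu> \<theta> l)))"
      unfolding sum_paths_Suc sum.distrib[symmetric] sum_distrib_left
      by (intro sum.cong refl) (simp add: algebra_simps power2_eq_square)
    also have "\<dots> = (\<Sum>a\<in>V. (\<mu> a)\<^sup>2)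
        + \<theta> * (\<Sum>l\<in>paths V s. prod_list (map \<mu> l) * discounted \<mu> \<theta> l)"
      by (simp add: sum_prod_list_mu mu_sum flip: sum_distrib_right)
    also have "\<dots> \<le> q + 1/2 * (2 * q)"
      using assms Suc q mu_nonneg
      by (intro add_mono mult_mono sum_nonneg mult_nonneg_nonneg discounted_nonneg prod_list_nonneg) auto
    finally show ?case by simp
  qed
qed

end

section \<open>Random matrices with independent rows\<close>

lemma sum_delta_pair:
  assumes "finite V" "\<And>l. l \<in> S \<Longrightarrow> h l \<in> V \<and> k l \<in> V"
  shows "(\<Sum>z\<in>V. \<Sum>y\<in>V. \<phi> z y * (\<Sum>l\<in>S. of_bool (h l = z \<and> k l = y) * F l))
     = (\<Sum>l\<in>S. \<phi> (h l) (k l) * (F l :: real))"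
proof -
  have "(\<Sum>z\<in>V. \<Sum>y\<in>V. \<phi> z y * (\<Sum>l\<in>S. of_bool (h l = z \<and> k l = y) * F l))
     = (\<Sum>z\<in>V. \<Sum>y\<in>V. \<Sum>l\<in>S. \<phi> z y * of_bool (h l = z \<and> k l = y) * F l)"
    by (simp add: sum_distrib_left mult.assoc)
  also have "\<dots> = (\<Sum>l\<in>S. \<Sum>z\<in>V. \<Sum>y\<in>V. \<phi> z y * of_bool (h l = z \<and> k l = y) * F l)"
    by (subst sum.swap[of _ V S], intro sum.cong refl, rule sum.swap)
  also have "\<dots> = (\<Sum>l\<in>S. \<phi> (h l) (k l) * F l)"
  proof (intro sum.cong refl)
    fix l assume "l \<in> S"
    then have l: "h l \<in> V" "k l \<in> V" using assms by auto
    have "(\<Sum>z\<in>V. \<Sum>y\<in>V. \<phi> z y * of_bool (h l = z \<and> k l = y) * F l)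
        = (\<Sum>z\<in>V. if z = h l then (\<Sum>y\<in>V. if y = k l then \<phi> z y * F l else 0) else 0)"
      by (intro sum.cong refl) (auto intro!: sum.cong sum.neutral)
    then show "(\<Sum>z\<in>V. \<Sum>y\<in>V. \<phi> z y * of_bool (h l = z \<and> k l = y) * F l) = \<phi> (h l) (k l) * F l"
      using assms(1) l by simp
  qed
  finally show ?thesis .
qed

locale random_rows = finite_dist V \<mu> for V :: "'a set" and \<mu> :: "'a \<Rightarrow> real" +
  fixes row :: "'a \<Rightarrow> 'r pmf" and dflt :: 'r and P :: "'a \<Rightarrow> 'r \<Rightarrow> 'a \<Rightarrow> real" and c \<theta> :: real
  assumes mu_pos: "\<And>a. a \<in> V \<Longrightarrow> 0 < \<mu> a"
    and fin_row: "\<And>x. x \<in> V \<Longrightarrow> finite (set_pmf (row x))"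
    and P_nonneg: "\<And>x r a. 0 \<le> P x r a"
    and c_ge_1: "1 \<le> c" and theta_nonneg: "0 \<le> \<theta>"
    and P_mean: "\<And>x a. x \<in> V \<Longrightarrow> a \<in> V \<Longrightarrow>
      measure_pmf.expectation (row x) (\<lambda>r. P x r a) \<le> c * \<mu> a"
    and P_mean2: "\<And>x a b. x \<in> V \<Longrightarrow> a \<in> V \<Longrightarrow> b \<in> V \<Longrightarrow>
      measure_pmf.expectation (row x) (\<lambda>r. P x r a * P x r b)
        \<le> c\<^sup>2 * \<mu> a * (\<mu> b + (if a = b then \<theta> else 0))"
begin

definition M :: "('a \<Rightarrow> 'r) pmf" where "M = Pi_pmf V dflt row"

definition ker :: "('a \<Rightarrow> 'r) \<Rightarrow> 'a \<Rightarrow> 'a \<Rightarrow> real" where "ker \<omega> x a = P x (\<omega> x) a"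

definition mean :: "'a \<Rightarrow> 'a \<Rightarrow> real" where
  "mean x a = measure_pmf.expectation (row x) (\<lambda>r. P x r a)"

definition simple_paths :: "nat \<Rightarrow> 'a list set" where
  "simple_paths t = {l \<in> paths V t. distinct l}"

lemma finite_M [simp]: "finite (set_pmf M)"
  unfolding M_def by (intro finite_set_Pi_pmf finV fin_row)

lemma integrable_M [simp]: "integrable (measure_pmf M) (f :: _ \<Rightarrow> real)"
  by (intro integrable_measure_pmf_finite) simp

lemma ker_nonneg: "0 \<le> ker \<omega> x a"
  by (simp add: ker_def P_nonneg)

lemma pw_ker_nonneg: "0 \<le> path_weight (ker \<omega>) l"
  by (intro path_weight_nonneg ker_nonneg)

lemma mean_nonneg: "0 \<le> mean x a"
  unfolding mean_def by (intro Bochner_Integration.integral_nonneg P_nonneg)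

lemma finite_simple_paths [simp]: "finite (simple_paths t)"
  using finV by (simp add: simple_paths_def)

lemma simple_pathsD:
  assumes "l \<in> simple_paths t"
  shows "l \<in> paths V t" "distinct l" "length l = Suc t" "set l \<subseteq> V" "l \<noteq> []" "hd l \<in> V" "last l \<in> V"
  using assms paths_nonempty by (auto simp: simple_paths_def paths_def)

definition edges_from :: "'a list \<Rightarrow> 'a \<Rightarrow> ('a \<times> 'a) set" where
  "edges_from l x = {e \<in> edges l. fst e = x}"

lemma edges_at:
  assumes "l \<in> simple_paths t"
  obtains "edges_from l x = {}"
  | a where "a \<in> V" "edges_from l x = {(x, a)}"
proof (cases "\<exists>a. (x, a) \<in> edges l")
  case True
  then obtain a where a: "(x, a) \<in> edges l" by auto
  have "edges_from l x = {(x, a)}"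
  proof (intro equalityI subsetI)
    fix e assume "e \<in> edges_from l x"
    then have "(x, snd e) \<in> edges l" "fst e = x" by (auto simp: edges_from_def)
    then show "e \<in> {(x, a)}"
      using edges_functional[OF simple_pathsD(2)[OF assms] a] by (cases e) auto
  qed (use a in \<open>auto simp: edges_from_def\<close>)
  moreover have "a \<in> V" using edges_set[OF a] simple_pathsD(4)[OF assms] by auto
  ultimately show ?thesis using that(2) by simp
next
  case False
  then have "edges_from l x = {}" by (auto simp: edges_from_def)
  with that(1) show ?thesis .
qed

lemma prod_edges:
  assumes "l \<in> simple_paths t"
  shows "(\<Prod>e\<in>edges l. F (fst e) (snd e)) =
    (\<Prod>x\<in>V. \<Prod>e\<in>edges_from l x. (F x (snd e) :: real))"
proof -
  have "fst ` edges l \<subseteq> V"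
    using edges_set simple_pathsD(4)[OF assms] by fastforce
  then have "(\<Prod>x\<in>V. \<Prod>e\<in>edges_from l x. F (fst e) (snd e)) = (\<Prod>e\<in>edges l. F (fst e) (snd e))"
    unfolding edges_from_def by (intro prod.group finV finite_edges)
  moreover have "(\<Prod>x\<in>V. \<Prod>e\<in>edges_from l x. F (fst e) (snd e))
      = (\<Prod>x\<in>V. \<Prod>e\<in>edges_from l x. F x (snd e))"
    by (intro prod.cong) (auto simp: edges_from_def)
  ultimately show ?thesis by simp
qed

lemma expectation_path_pair:
  assumes v: "v \<in> simple_paths s" and u: "u \<in> simple_paths s'"
  shows "measure_pmf.expectation M (\<lambda>\<omega>. path_weight (ker \<omega>) v * path_weight (ker \<omega>) u)
    \<le> c ^ s * path_weight (\<lambda>_. \<mu>) v * (c ^ s' * path_weight (kern \<mu> \<theta> v) u)"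
proof -
  define G where "G x r = (\<Prod>e\<in>edges_from v x. P x r (snd e))
    * (\<Prod>e\<in>edges_from u x. P x r (snd e))" for x r
  define B where "B x = (\<Prod>e\<in>edges_from v x. c * \<mu> (snd e))
    * (\<Prod>e\<in>edges_from u x. c * kern \<mu> \<theta> v x (snd e))" for x
  have G0: "0 \<le> G x r" for x r
    unfolding G_def by (intro mult_nonneg_nonneg prod_nonneg ballI P_nonneg)
  have "path_weight (ker \<omega>) v * path_weight (ker \<omega>) u = (\<Prod>x\<in>V. G x (\<omega> x))" for \<omega>
    unfolding G_def prod.distrib using simple_pathsD(2)[OF v] simple_pathsD(2)[OF u]
    by (simp add: path_weight_edges ker_def prod_edges[OF v, of "\<lambda>x. P x (\<omega> x)"] prod_edges[OF u, of "\<lambda>x. P x (\<omega> x)"])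
  then have "measure_pmf.expectation M (\<lambda>\<omega>. path_weight (ker \<omega>) v * path_weight (ker \<omega>) u)
     = (\<Prod>x\<in>V. measure_pmf.expectation (row x) (G x))"
    unfolding M_def using fin_row G0
    by (simp add: finV expectation_prod_Pi_pmf integrable_measure_pmf_finite)
  also have "\<dots> \<le> (\<Prod>x\<in>V. B x)"
  proof (intro prod_mono conjI)
    fix x assume x: "x \<in> V"
    show "0 \<le> measure_pmf.expectation (row x) (G x)"
      using G0 by (intro Bochner_Integration.integral_nonneg) auto
    show "measure_pmf.expectation (row x) (G x) \<le> B x"
    proof (cases rule: edges_at[OF v, of x])
      case 1
      show ?thesis
      proof (cases rule: edges_at[OF u, of x])
        case 1
        with \<open>edges_from v x = {}\<close> show ?thesis by (simp add: G_def[abs_def] B_def)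
      next
        case (2 b)
        have "(x, b) \<notin> edges v" using 1 by (auto simp: edges_from_def)
        with 1 2 P_mean[OF x, of b] show ?thesis by (simp add: G_def[abs_def] B_def kern_def)
      qed
    next
      case (2 a)
      have ev: "(x, b) \<in> edges v \<longleftrightarrow> a = b" for b
      proof -
        have "(x, b) \<in> edges v \<longleftrightarrow> (x, b) \<in> edges_from v x" by (simp add: edges_from_def)
        then show ?thesis using 2 by auto
      qed
      show ?thesis
      proof (cases rule: edges_at[OF u, of x])
        case 1
        with 2 P_mean[OF x, of a] show ?thesis by (simp add: G_def[abs_def] B_def)
      next
        case (2 b)
        with \<open>edges_from v x = {(x, a)}\<close> \<open>a \<in> V\<close> P_mean2[OF x, of a b] show ?thesis
          by (simp add: G_def[abs_def] B_def kern_def ev power2_eq_square mult_ac)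
      qed
    qed
  qed
  also have "\<dots> = path_weight (\<lambda>_ a. c * \<mu> a) v * path_weight (\<lambda>x a. c * kern \<mu> \<theta> v x a) u"
    unfolding B_def prod.distrib[of _ _ V]
    by (simp only: path_weight_edges[OF simple_pathsD(2)[OF v]] path_weight_edges[OF simple_pathsD(2)[OF u]]
      prod_edges[OF v, of "\<lambda>_ a. c * \<mu> a"] prod_edges[OF u, of "\<lambda>x a. c * kern \<mu> \<theta> v x a"])
  also have "\<dots> = c ^ s * path_weight (\<lambda>_. \<mu>) v * (c ^ s' * path_weight (kern \<mu> \<theta> v) u)"
    using simple_pathsD(3)[OF v] simple_pathsD(3)[OF u] by (simp add: path_weight_cmult)
  finally show ?thesis .
qed

lemma expectation_path:
  assumes v: "v \<in> simple_paths s"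
  shows "measure_pmf.expectation M (\<lambda>\<omega>. path_weight (ker \<omega>) v) = path_weight mean v"
proof -
  define G where "G x r = (\<Prod>e\<in>edges_from v x. P x r (snd e))" for x r
  have G0: "0 \<le> G x r" for x r
    unfolding G_def by (intro prod_nonneg ballI P_nonneg)
  have "path_weight (ker \<omega>) v = (\<Prod>x\<in>V. G x (\<omega> x))" for \<omega>
    unfolding G_def using simple_pathsD(2)[OF v]
    by (simp add: path_weight_edges prod_edges[OF v, of "\<lambda>x. P x (\<omega> x)"] ker_def)
  then have "measure_pmf.expectation M (\<lambda>\<omega>. path_weight (ker \<omega>) v)
     = (\<Prod>x\<in>V. measure_pmf.expectation (row x) (G x))"
    unfolding M_def using fin_row G0
    by (simp add: finV expectation_prod_Pi_pmf integrable_measure_pmf_finite)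
  also have "\<dots> = (\<Prod>x\<in>V. \<Prod>e\<in>edges_from v x. mean x (snd e))"
  proof (intro prod.cong refl)
    fix x
    show "measure_pmf.expectation (row x) (G x) = (\<Prod>e\<in>edges_from v x. mean x (snd e))"
      by (cases rule: edges_at[OF v, of x]) (simp_all only: G_def[abs_def] mean_def, simp_all)
  qed
  also have "\<dots> = path_weight mean v"
    using simple_pathsD(2)[OF v] by (simp add: path_weight_edges prod_edges[OF v, of mean])
  finally show ?thesis .
qed

definition T :: "nat \<Rightarrow> ('a \<Rightarrow> 'r) \<Rightarrow> 'a set \<Rightarrow> 'a \<Rightarrow> 'a \<Rightarrow> real" where
  "T t \<omega> A z y = (\<Sum>l\<in>simple_paths t.
     of_bool (last l = z \<and> hd l = y) * (of_bool (A \<inter> set l = {}) * path_weight (ker \<omega>) l))"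

definition deficit :: "nat \<Rightarrow> ('a \<Rightarrow> 'r) \<Rightarrow> 'a set \<Rightarrow> 'a \<Rightarrow> real" where
  "deficit t \<omega> A z = (\<Sum>y\<in>V. max 0 (\<mu> y - T t \<omega> A z y))"

definition through :: "nat \<Rightarrow> ('a \<Rightarrow> 'r) \<Rightarrow> 'a \<Rightarrow> real" where
  "through t \<omega> x = (\<Sum>l\<in>simple_paths t. of_bool (x \<in> set l) * \<mu> (last l) * path_weight (ker \<omega>) l)"

lemma T_nonneg: "0 \<le> T t \<omega> A z y"
  unfolding T_def by (intro sum_nonneg mult_nonneg_nonneg pw_ker_nonneg) auto

lemma deficit_bounds: "0 \<le> deficit t \<omega> A z" "deficit t \<omega> A z \<le> 1"
proof -
  show "0 \<le> deficit t \<omega> A z" unfolding deficit_def by (intro sum_nonneg) auto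
  have "deficit t \<omega> A z \<le> sum \<mu> V"
    unfolding deficit_def using T_nonneg mu_nonneg by (intro sum_mono) auto
  then show "deficit t \<omega> A z \<le> 1" using mu_sum by simp
qed

lemma sum_T:
  "(\<Sum>z\<in>V. \<Sum>y\<in>V. \<phi> z y * T t \<omega> A z y) =
   (\<Sum>l\<in>simple_paths t. \<phi> (last l) (hd l) * (of_bool (A \<inter> set l = {}) * path_weight (ker \<omega>) l))"
  unfolding T_def by (intro sum_delta_pair finV) (auto dest: simple_pathsD)

lemma T_upd: "T t (fun_upd \<omega> x r) {x} z y = T t \<omega> {x} z y"
  unfolding T_def
proof (intro sum.cong refl)
  fix l
  have "path_weight (ker (fun_upd \<omega> x r)) l = path_weight (ker \<omega>) l" if "x \<notin> set l"
    using that by (intro path_weight_cong) (auto simp: ker_def)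
  then show "of_bool (last l = z \<and> hd l = y) * (of_bool ({x} \<inter> set l = {}) * path_weight (ker (fun_upd \<omega> x r)) l) =
    of_bool (last l = z \<and> hd l = y) * (of_bool ({x} \<inter> set l = {}) * path_weight (ker \<omega>) l)"
    by auto
qed

lemma deficit_upd: "deficit t (fun_upd \<omega> x r) {x} z = deficit t \<omega> {x} z"
  by (simp add: deficit_def T_upd)

lemma deficit_avoiding:
  "(\<Sum>z\<in>V. \<mu> z * deficit t \<omega> {x} z) \<le> (\<Sum>z\<in>V. \<mu> z * deficit t \<omega> {} z) + through t \<omega> x"
proof -
  have mono: "T t \<omega> {x} z y \<le> T t \<omega> {} z y" for z y
    unfolding T_def by (intro sum_mono mult_left_mono mult_right_mono pw_ker_nonneg) auto
  have "(\<Sum>z\<in>V. \<mu> z * deficit t \<omega> {x} z)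
    \<le> (\<Sum>z\<in>V. \<mu> z * (deficit t \<omega> {} z + (\<Sum>y\<in>V. T t \<omega> {} z y - T t \<omega> {x} z y)))"
    unfolding deficit_def sum.distrib[symmetric]
  proof (intro sum_mono mult_left_mono mu_nonneg)
    fix z y show "max 0 (\<mu> y - T t \<omega> {x} z y) \<le> max 0 (\<mu> y - T t \<omega> {} z y) + (T t \<omega> {} z y - T t \<omega> {x} z y)"
      using mono[of z y] by auto
  qed
  also have "\<dots> = (\<Sum>z\<in>V. \<mu> z * deficit t \<omega> {} z)
     + ((\<Sum>z\<in>V. \<Sum>y\<in>V. \<mu> z * T t \<omega> {} z y) - (\<Sum>z\<in>V. \<Sum>y\<in>V. \<mu> z * T t \<omega> {x} z y))"
    by (simp add: sum.distrib sum_subtractf sum_distrib_left algebra_simps)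
  also have "(\<Sum>z\<in>V. \<Sum>y\<in>V. \<mu> z * T t \<omega> {} z y) - (\<Sum>z\<in>V. \<Sum>y\<in>V. \<mu> z * T t \<omega> {x} z y) = through t \<omega> x"
    unfolding sum_T through_def sum_subtractf[symmetric] by (intro sum.cong) auto
  finally show ?thesis .
qed

lemma expectation_T_squared:
  assumes t: "0 < t" and th: "\<theta> \<le> 1/2" and q: "(\<Sum>a\<in>V. (\<mu> a)\<^sup>2) \<le> q"
  shows "measure_pmf.expectation M (\<lambda>\<omega>. \<Sum>z\<in>V. \<Sum>y\<in>V. \<mu> z / \<mu> y * (T t \<omega> {} z y)\<^sup>2)
     \<le> c ^ (2 * t) * ((1 + \<theta>) ^ t * (1 + 2 * \<theta> * card V * q) + card V * \<theta> ^ t)"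
proof -
  let ?S = "simple_paths t"
  let ?w = "\<lambda>\<omega>. path_weight (ker \<omega>)"
  let ?I = "\<lambda>v u. of_bool (last u = last v \<and> hd u = hd v) :: real"
  have "(\<Sum>z\<in>V. \<Sum>y\<in>V. \<mu> z / \<mu> y * (T t \<omega> {} z y)\<^sup>2)
     = (\<Sum>v\<in>?S. \<Sum>u\<in>?S. \<mu> (last v) / \<mu> (hd v) * ?I v u * (?w \<omega> v * ?w \<omega> u))" for \<omega>
  proof -
    have "(\<Sum>z\<in>V. \<Sum>y\<in>V. \<mu> z / \<mu> y * (T t \<omega> {} z y)\<^sup>2)
       = (\<Sum>z\<in>V. \<Sum>y\<in>V. (\<mu> z / \<mu> y * T t \<omega> {} z y) * T t \<omega> {} z y)"
      by (simp add: power2_eq_square mult_ac)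
    also have "\<dots> = (\<Sum>v\<in>?S. (\<mu> (last v) / \<mu> (hd v) * T t \<omega> {} (last v) (hd v)) * ?w \<omega> v)"
      unfolding sum_T by simp
    also have "\<dots> = (\<Sum>v\<in>?S. \<Sum>u\<in>?S. \<mu> (last v) / \<mu> (hd v) * ?I v u * (?w \<omega> v * ?w \<omega> u))"
      unfolding T_def sum_distrib_left sum_distrib_right by (simp add: mult_ac)
    finally show ?thesis .
  qed
  then have "measure_pmf.expectation M (\<lambda>\<omega>. \<Sum>z\<in>V. \<Sum>y\<in>V. \<mu> z / \<mu> y * (T t \<omega> {} z y)\<^sup>2)
     = (\<Sum>v\<in>?S. \<Sum>u\<in>?S. \<mu> (last v) / \<mu> (hd v) * ?I v u *
         measure_pmf.expectation M (\<lambda>\<omega>. ?w \<omega> v * ?w \<omega> u))"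
    by (simp add: Bochner_Integration.integral_sum)
  also have "\<dots> \<le> (\<Sum>v\<in>?S. \<Sum>u\<in>?S. \<mu> (last v) / \<mu> (hd v) * ?I v u *
         (c ^ t * path_weight (\<lambda>_. \<mu>) v * (c ^ t * path_weight (kern \<mu> \<theta> v) u)))"
    using mu_nonneg by (intro sum_mono mult_left_mono expectation_path_pair) auto
  also have "\<dots> = c ^ (2 * t) * (\<Sum>v\<in>?S. \<mu> (last v) * path_weight (\<lambda>_. \<mu>) v / \<mu> (hd v) *
       (\<Sum>u\<in>?S. ?I v u * path_weight (kern \<mu> \<theta> v) u))"
    unfolding sum_distrib_left by (intro sum.cong refl) (simp add: power_mult power2_eq_square power_mult_distrib)
  also have "\<dots> \<le> c ^ (2 * t) * (\<Sum>v\<in>?S. \<mu> (last v) * path_weight (\<lambda>_. \<mu>) v / \<mu> (hd v) *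
       ((1 + \<theta>) ^ t * discounted \<mu> \<theta> v + \<theta> ^ t))"
  proof (intro mult_left_mono sum_mono)
    fix v assume v: "v \<in> ?S"
    note vD = simple_pathsD[OF v]
    let ?f = "\<lambda>a. of_bool (a = last v) :: real"
    have "(\<Sum>u\<in>?S. ?I v u * path_weight (kern \<mu> \<theta> v) u)
       \<le> (\<Sum>u\<in>paths V t. ?I v u * path_weight (kern \<mu> \<theta> v) u)"
      using theta_nonneg vD(2) finV by (intro sum_mono2 mult_nonneg_nonneg path_weight_nonneg kern_nonneg)
        (auto simp: simple_paths_def)
    also have "\<dots> = (\<Sum>u\<in>paths V t. ?f (last u) * path_weight (kern \<mu> \<theta> v) u * of_bool (hd u = hd v))"
      by (intro sum.cong) auto
    also have "\<dots> = walk V ?f (kern \<mu> \<theta> v) t (hd v)"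
      unfolding sum_path_weight[of ?f _ "\<lambda>a. of_bool (a = hd v)"]
      using finV vD(6) by (simp add: of_bool_def if_distrib cong: if_cong)
    also have "\<dots> \<le> (1 + \<theta>) ^ t * discounted \<mu> \<theta> (hd v # tl v) + \<theta> ^ t"
    proof (rule walk_kern_on_path[OF theta_nonneg vD(2), of _ "[]"])
      show "sum ?f V \<le> 1" using finV by (simp add: of_bool_def)
      fix p a l assume "v = p @ a # l" "l \<noteq> []"
      then show "?f a = 0" using vD(2) by (auto simp: last_append)
    qed (use vD(5) in auto)
    finally show "(\<Sum>u\<in>?S. ?I v u * path_weight (kern \<mu> \<theta> v) u) \<le> (1 + \<theta>) ^ t * discounted \<mu> \<theta> v + \<theta> ^ t"
      using vD(5) by simp
  qed (use mu_nonneg c_ge_1 in \<open>auto intro!: divide_nonneg_nonneg mult_nonneg_nonneg path_weight_nonneg\<close>)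
  also have "\<dots> \<le> c ^ (2 * t) * (\<Sum>v\<in>paths V t. \<mu> (last v) * path_weight (\<lambda>_. \<mu>) v / \<mu> (hd v) *
       ((1 + \<theta>) ^ t * discounted \<mu> \<theta> v + \<theta> ^ t))"
    using mu_nonneg c_ge_1 finV theta_nonneg
    by (intro mult_left_mono sum_mono2 mult_nonneg_nonneg add_nonneg_nonneg discounted_nonneg
      divide_nonneg_nonneg path_weight_nonneg) (auto simp: simple_paths_def intro: discounted_nonneg)
  also have "(\<Sum>v\<in>paths V t. \<mu> (last v) * path_weight (\<lambda>_. \<mu>) v / \<mu> (hd v) *
       ((1 + \<theta>) ^ t * discounted \<mu> \<theta> v + \<theta> ^ t))
     \<le> (1 + \<theta>) ^ t * (1 + 2 * \<theta> * card V * q) + card V * \<theta> ^ t"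
  proof -
    obtain s where s: "t = Suc s" using t gr0_implies_Suc by blast
    have pl: "\<mu> (last v) * path_weight (\<lambda>_. \<mu>) v = prod_list (map \<mu> v)" if "v \<noteq> []" for v
      using that by (induction "\<lambda>_::'a. \<mu>" v rule: path_weight.induct) (auto simp: mult_ac)
    have "(\<Sum>v\<in>paths V t. \<mu> (last v) * path_weight (\<lambda>_. \<mu>) v / \<mu> (hd v) *
       ((1 + \<theta>) ^ t * discounted \<mu> \<theta> v + \<theta> ^ t))
      = (\<Sum>a\<in>V. \<Sum>l\<in>paths V s. prod_list (map \<mu> l) *
          ((1 + \<theta>) ^ t * (\<mu> a + \<theta> * discounted \<mu> \<theta> l) + \<theta> ^ t))"
      unfolding s sum_paths_Suc
    proof (intro sum.cong refl)
      fix a l assume "a \<in> V" "l \<in> paths V s"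
      then show "\<mu> (last (a # l)) * path_weight (\<lambda>_. \<mu>) (a # l) / \<mu> (hd (a # l)) *
          ((1 + \<theta>) ^ Suc s * discounted \<mu> \<theta> (a # l) + \<theta> ^ Suc s)
        = prod_list (map \<mu> l) * ((1 + \<theta>) ^ Suc s * (\<mu> a + \<theta> * discounted \<mu> \<theta> l) + \<theta> ^ Suc s)"
        using mu_pos[of a] by (subst pl) auto
    qed
    also have "\<dots> = (1 + \<theta>) ^ t * ((\<Sum>a\<in>V. \<mu> a * (\<Sum>l\<in>paths V s. prod_list (map \<mu> l)))
        + \<theta> * (\<Sum>a\<in>V. \<Sum>l\<in>paths V s. prod_list (map \<mu> l) * discounted \<mu> \<theta> l))
        + \<theta> ^ t * (\<Sum>a\<in>V. \<Sum>l\<in>paths V s. prod_list (map \<mu> l))"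
      unfolding sum_distrib_left sum.distrib[symmetric]
      by (intro sum.cong refl) (simp add: algebra_simps)
    also have "\<dots> = (1 + \<theta>) ^ t * (1 + \<theta> * (card V * (\<Sum>l\<in>paths V s. prod_list (map \<mu> l) * discounted \<mu> \<theta> l)))
        + card V * \<theta> ^ t"
      by (simp add: sum_prod_list_mu mu_sum)
    also have "\<dots> \<le> (1 + \<theta>) ^ t * (1 + \<theta> * (card V * (2 * q))) + card V * \<theta> ^ t"
      using theta_nonneg th q by (intro add_mono mult_left_mono sum_discounted) auto
    finally show ?thesis by (simp add: mult_ac)
  qed
  finally show ?thesis using c_ge_1 by (simp add: mult_left_mono)
qed

lemma expectation_T_mass:
  assumes mass: "\<And>x. x \<in> V \<Longrightarrow> 1 - \<kappa>\<^sub>0 \<le> (\<Sum>a\<in>V. mean x a)"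
    and m: "\<And>a. \<mu> a \<le> m" and k: "\<kappa>\<^sub>0 + c * real (Suc t) * m \<le> 1" and z: "z \<in> V"
  shows "(1 - (\<kappa>\<^sub>0 + c * real (Suc t) * m)) ^ t
    \<le> measure_pmf.expectation M (\<lambda>\<omega>. \<Sum>y\<in>V. T t \<omega> {} z y)"
proof -
  let ?\<kappa> = "\<kappa>\<^sub>0 + c * real (Suc t) * m"
  let ?D = "\<lambda>l. of_bool (distinct l \<and> last l = z) :: real"
  have m0: "0 \<le> m" using m mu_nonneg order_trans by blast
  have *: "(1 - ?\<kappa>) ^ s \<le> (\<Sum>l\<in>paths V s. ?D l * path_weight mean l)" if "s \<le> t" for s
    using that
  proof (induction s)
    case 0
    show ?case using finV z by (simp add: sum_paths_0 of_bool_def)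
  next
    case (Suc s)
    have ext: "1 - ?\<kappa> \<le> (\<Sum>a\<in>V. of_bool (a \<notin> set l) * mean (hd l) a)" if l: "l \<in> paths V s" for l
    proof -
      have lD: "set l \<subseteq> V" "length l = Suc s" "hd l \<in> V" using l paths_nonempty by (auto simp: paths_def)
      have "(\<Sum>a\<in>V. mean (hd l) a) - (\<Sum>a\<in>V. of_bool (a \<notin> set l) * mean (hd l) a)
         = (\<Sum>a\<in>set l. mean (hd l) a)"
        unfolding sum_subtractf[symmetric] using lD(1) finV
        by (intro sum.mono_neutral_cong_right) auto
      also have "\<dots> \<le> (\<Sum>a\<in>set l. c * m)"
      proof (intro sum_mono)
        fix a assume "a \<in> set l"
        then have "mean (hd l) a \<le> c * \<mu> a" unfolding mean_def using lD by (intro P_mean) auto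
        also have "\<dots> \<le> c * m" using m c_ge_1 by (intro mult_left_mono) auto
        finally show "mean (hd l) a \<le> c * m" .
      qed
      also have "\<dots> \<le> real (Suc t) * (c * m)"
        using lD(2) Suc.prems c_ge_1 m0 card_length[of l] by (auto intro!: mult_right_mono simp del: of_nat_Suc)
      finally show ?thesis using mass[OF lD(3)] by (simp add: algebra_simps)
    qed
    have "(1 - ?\<kappa>) ^ Suc s \<le> (\<Sum>l\<in>paths V s. ?D l * path_weight mean l) * (1 - ?\<kappa>)"
      unfolding power_Suc2 using Suc k by (intro mult_right_mono) auto
    also have "\<dots> \<le> (\<Sum>l\<in>paths V s. ?D l * path_weight mean l * (\<Sum>a\<in>V. of_bool (a \<notin> set l) * mean (hd l) a))"
      unfolding sum_distrib_right
      by (intro sum_mono mult_left_mono ext mult_nonneg_nonneg path_weight_nonneg mean_nonneg) auto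
    also have "\<dots> = (\<Sum>l\<in>paths V (Suc s). ?D l * path_weight mean l)"
      unfolding sum_distrib_left sum_paths_Suc
      by (subst sum.swap, intro sum.cong refl) (auto simp: path_weight_Cons dest: paths_nonempty)
    finally show ?case .
  qed
  have "(\<Sum>y\<in>V. T t \<omega> {} z y) = (\<Sum>l\<in>simple_paths t. of_bool (last l = z) * path_weight (ker \<omega>) l)" for \<omega>
    using sum_T[of "\<lambda>z' y. of_bool (z' = z)" t \<omega> "{}"] finV z
    by (simp add: of_bool_def if_distrib[of "\<lambda>x. x * _"] sum.delta cong: if_cong)
      (subst (asm) sum.swap, simp)
  then have "measure_pmf.expectation M (\<lambda>\<omega>. \<Sum>y\<in>V. T t \<omega> {} z y)
    = (\<Sum>l\<in>simple_paths t. of_bool (last l = z) * path_weight mean l)"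
    by (simp add: Bochner_Integration.integral_sum) (auto intro!: sum.cong simp: expectation_path)
  also have "\<dots> = (\<Sum>l\<in>paths V t. ?D l * path_weight mean l)"
    using finV by (intro sum.mono_neutral_cong_left) (auto simp: simple_paths_def)
  finally show ?thesis using *[of t] by simp
qed

lemma expectation_through_squared:
  assumes m: "\<And>a. \<mu> a \<le> m"
  shows "measure_pmf.expectation M (\<lambda>\<omega>. \<Sum>x\<in>V. (through t \<omega> x)\<^sup>2)
    \<le> c ^ (2 * t) * (real (Suc t) ^ 2 * (1 + \<theta>) ^ t * m)"
proof -
  let ?S = "simple_paths t"
  let ?w = "\<lambda>\<omega>. path_weight (ker \<omega>)"
  let ?N = "\<lambda>v u. (\<Sum>a\<leftarrow>u. of_bool (a \<in> set v)) :: real"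
  have N: "(\<Sum>x\<in>V. of_bool (x \<in> set v) * of_bool (x \<in> set u)) = ?N v u" if "u \<in> ?S" for u v
  proof -
    have "(\<Sum>x\<in>V. of_bool (x \<in> set v) * of_bool (x \<in> set u)) = (\<Sum>x\<in>set u. of_bool (x \<in> set v) :: real)"
      using finV simple_pathsD(4)[OF that] by (intro sum.mono_neutral_cong_right) auto
    also have "\<dots> = ?N v u" using simple_pathsD(2)[OF that] by (simp add: sum_list_distinct_conv_sum_set)
    finally show ?thesis .
  qed
  have "(\<Sum>x\<in>V. (through t \<omega> x)\<^sup>2)
     = (\<Sum>v\<in>?S. \<Sum>u\<in>?S. \<mu> (last v) * \<mu> (last u) * ?N v u * (?w \<omega> v * ?w \<omega> u))" for \<omega>
  proof -
    have "(\<Sum>x\<in>V. (through t \<omega> x)\<^sup>2) = (\<Sum>x\<in>V. \<Sum>v\<in>?S. \<Sum>u\<in>?S.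
        (of_bool (x \<in> set v) * of_bool (x \<in> set u)) * (\<mu> (last v) * \<mu> (last u) * (?w \<omega> v * ?w \<omega> u)))"
      unfolding through_def power2_eq_square sum_product by (simp add: mult_ac)
    also have "\<dots> = (\<Sum>v\<in>?S. \<Sum>u\<in>?S. (\<Sum>x\<in>V. of_bool (x \<in> set v) * of_bool (x \<in> set u))
        * (\<mu> (last v) * \<mu> (last u) * (?w \<omega> v * ?w \<omega> u)))"
      unfolding sum_distrib_right by (subst sum.swap, intro sum.cong refl, rule sum.swap)
    also have "\<dots> = (\<Sum>v\<in>?S. \<Sum>u\<in>?S. \<mu> (last v) * \<mu> (last u) * ?N v u * (?w \<omega> v * ?w \<omega> u))"
      by (intro sum.cong refl) (simp only: N mult_ac)
    finally show ?thesis .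
  qed
  then have "measure_pmf.expectation M (\<lambda>\<omega>. \<Sum>x\<in>V. (through t \<omega> x)\<^sup>2)
     = (\<Sum>v\<in>?S. \<Sum>u\<in>?S. \<mu> (last v) * \<mu> (last u) * ?N v u *
         measure_pmf.expectation M (\<lambda>\<omega>. ?w \<omega> v * ?w \<omega> u))"
    by (simp add: Bochner_Integration.integral_sum)
  also have "\<dots> \<le> (\<Sum>v\<in>?S. \<Sum>u\<in>?S. \<mu> (last v) * \<mu> (last u) * ?N v u *
         (c ^ t * path_weight (\<lambda>_. \<mu>) v * (c ^ t * path_weight (kern \<mu> \<theta> v) u)))"
    using mu_nonneg by (intro sum_mono mult_left_mono expectation_path_pair mult_nonneg_nonneg sum_list_nonneg) auto
  also have "\<dots> = c ^ (2 * t) * (\<Sum>v\<in>?S. \<mu> (last v) * path_weight (\<lambda>_. \<mu>) v *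
       (\<Sum>u\<in>?S. \<mu> (last u) * path_weight (kern \<mu> \<theta> v) u * ?N v u))"
    unfolding sum_distrib_left by (intro sum.cong refl) (simp add: power_mult power2_eq_square power_mult_distrib)
  also have "\<dots> \<le> c ^ (2 * t) * (\<Sum>v\<in>?S. \<mu> (last v) * path_weight (\<lambda>_. \<mu>) v *
       (real (Suc t) ^ 2 * (1 + \<theta>) ^ t * m))"
  proof (intro mult_left_mono sum_mono)
    fix v assume v: "v \<in> ?S"
    note vD = simple_pathsD[OF v]
    have "(\<Sum>u\<in>?S. \<mu> (last u) * path_weight (kern \<mu> \<theta> v) u * ?N v u)
       \<le> (\<Sum>u\<in>paths V t. \<mu> (last u) * path_weight (kern \<mu> \<theta> v) u * ?N v u)"
      using theta_nonneg vD(2) finV mu_nonneg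
      by (intro sum_mono2 mult_nonneg_nonneg path_weight_nonneg kern_nonneg sum_list_nonneg)
        (auto simp: simple_paths_def)
    also have "\<dots> \<le> real (Suc t) * real (length v) * (1 + \<theta>) ^ t * m"
      using m mu_nonneg mu_sum by (intro sum_kern_meetings theta_nonneg vD(2)) auto
    finally show "(\<Sum>u\<in>?S. \<mu> (last u) * path_weight (kern \<mu> \<theta> v) u * ?N v u)
       \<le> real (Suc t) ^ 2 * (1 + \<theta>) ^ t * m"
      using vD(3) by (simp add: power2_eq_square)
  qed (use mu_nonneg c_ge_1 in \<open>auto intro!: mult_nonneg_nonneg path_weight_nonneg\<close>)
  also have "\<dots> \<le> c ^ (2 * t) * (1 * (real (Suc t) ^ 2 * (1 + \<theta>) ^ t * m))"
    unfolding sum_distrib_right[symmetric]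
  proof (intro mult_left_mono mult_right_mono)
    have "(\<Sum>v\<in>?S. \<mu> (last v) * path_weight (\<lambda>_. \<mu>) v) \<le> (\<Sum>v\<in>paths V t. \<mu> (last v) * path_weight (\<lambda>_. \<mu>) v)"
      using mu_nonneg finV by (intro sum_mono2 mult_nonneg_nonneg path_weight_nonneg) (auto simp: simple_paths_def)
    also have "\<dots> = (\<Sum>v\<in>paths V t. prod_list (map \<mu> v))"
    proof (intro sum.cong refl)
      fix v assume "v \<in> paths V t"
      then have "v \<noteq> []" using paths_nonempty by blast
      then show "\<mu> (last v) * path_weight (\<lambda>_. \<mu>) v = prod_list (map \<mu> v)"
        by (induction "\<lambda>_::'a. \<mu>" v rule: path_weight.induct) (auto simp: mult_ac)
    qed
    finally show "(\<Sum>v\<in>?S. \<mu> (last v) * path_weight (\<lambda>_. \<mu>) v) \<le> 1" by (simp add: sum_prod_list_mu)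
    show "0 \<le> real (Suc t) ^ 2 * (1 + \<theta>) ^ t * m"
      using theta_nonneg order_trans[OF mu_nonneg m] by (intro mult_nonneg_nonneg) auto
  qed (use c_ge_1 in auto)
  finally show ?thesis by simp
qed

lemma expectation_deficit:
  assumes d: "0 < \<delta>"
    and second: "measure_pmf.expectation M (\<lambda>\<omega>. \<Sum>z\<in>V. \<Sum>y\<in>V. \<mu> z / \<mu> y * (T t \<omega> {} z y)\<^sup>2) \<le> A"
    and mass: "\<And>z. z \<in> V \<Longrightarrow> B \<le> measure_pmf.expectation M (\<lambda>\<omega>. \<Sum>y\<in>V. T t \<omega> {} z y)"
  shows "measure_pmf.expectation M (\<lambda>\<omega>. \<Sum>z\<in>V. \<mu> z * deficit t \<omega> {} z) \<le> \<delta> / 2 + (A - 2 * B + 1) / (2 * \<delta>)"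
proof -
  let ?Q = "\<lambda>\<omega>. \<Sum>z\<in>V. \<Sum>y\<in>V. \<mu> z / \<mu> y * (T t \<omega> {} z y)\<^sup>2"
  let ?R = "\<lambda>\<omega>. \<Sum>z\<in>V. \<mu> z * (\<Sum>y\<in>V. T t \<omega> {} z y)"
  have pt: "max 0 (\<mu> y - x) \<le> \<delta> / 2 * \<mu> y + (x\<^sup>2 / \<mu> y - 2 * x + \<mu> y) / (2 * \<delta>)" if "y \<in> V" for x y
  proof -
    have y: "0 < \<mu> y" using mu_pos that .
    have "0 \<le> (\<delta> * \<mu> y - \<bar>\<mu> y - x\<bar>)\<^sup>2 / (2 * \<delta> * \<mu> y)" using y d by simp
    also have "\<dots> = \<delta> / 2 * \<mu> y + (x\<^sup>2 / \<mu> y - 2 * x + \<mu> y) / (2 * \<delta>) - \<bar>\<mu> y - x\<bar>"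
      using y d by (simp add: power2_diff field_simps power2_eq_square)
    finally show ?thesis by linarith
  qed
  have lin: "(\<Sum>z\<in>V. \<mu> z * (\<delta> / 2 + (a z - 2 * b z + 1) / (2 * \<delta>))) =
     (\<Sum>z\<in>V. \<mu> z) * (\<delta> / 2 + 1 / (2 * \<delta>)) + ((\<Sum>z\<in>V. \<mu> z * a z) - 2 * (\<Sum>z\<in>V. \<mu> z * b z)) / (2 * \<delta>)"
    for a b
  proof -
    have "\<mu> z * (\<delta> / 2 + (a z - 2 * b z + 1) / (2 * \<delta>)) =
       \<mu> z * (\<delta> / 2 + 1 / (2 * \<delta>)) + (\<mu> z * a z - 2 * (\<mu> z * b z)) / (2 * \<delta>)" for z
      using d by (simp add: field_simps)
    then show ?thesis
      by (simp add: sum.distrib sum_subtractf flip: sum_distrib_left sum_distrib_right sum_divide_distrib)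
  qed
  have le: "(\<Sum>z\<in>V. \<mu> z * deficit t \<omega> {} z) \<le> \<delta> / 2 + (?Q \<omega> - 2 * ?R \<omega> + 1) / (2 * \<delta>)" for \<omega>
  proof -
    have "deficit t \<omega> {} z \<le> \<delta> / 2 + ((\<Sum>y\<in>V. (T t \<omega> {} z y)\<^sup>2 / \<mu> y) - 2 * (\<Sum>y\<in>V. T t \<omega> {} z y) + 1) / (2 * \<delta>)" for z
    proof -
      have "deficit t \<omega> {} z \<le> (\<Sum>y\<in>V. \<delta> / 2 * \<mu> y + ((T t \<omega> {} z y)\<^sup>2 / \<mu> y - 2 * T t \<omega> {} z y + \<mu> y) / (2 * \<delta>))"
        unfolding deficit_def by (intro sum_mono pt)
      also have "\<dots> = \<delta> / 2 + ((\<Sum>y\<in>V. (T t \<omega> {} z y)\<^sup>2 / \<mu> y) - 2 * (\<Sum>y\<in>V. T t \<omega> {} z y) + 1) / (2 * \<delta>)"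
        by (simp add: sum.distrib sum_subtractf mu_sum flip: sum_distrib_left sum_divide_distrib)
      finally show ?thesis .
    qed
    then have "(\<Sum>z\<in>V. \<mu> z * deficit t \<omega> {} z) \<le> (\<Sum>z\<in>V. \<mu> z * (\<delta> / 2 +
        ((\<Sum>y\<in>V. (T t \<omega> {} z y)\<^sup>2 / \<mu> y) - 2 * (\<Sum>y\<in>V. T t \<omega> {} z y) + 1) / (2 * \<delta>)))"
      using mu_nonneg by (intro sum_mono mult_left_mono) auto
    also have "\<dots> = (\<Sum>z\<in>V. \<mu> z) * (\<delta> / 2 + 1 / (2 * \<delta>)) +
        ((\<Sum>z\<in>V. \<mu> z * (\<Sum>y\<in>V. (T t \<omega> {} z y)\<^sup>2 / \<mu> y)) - 2 * ?R \<omega>) / (2 * \<delta>)"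
      by (rule lin)
    also have "(\<Sum>z\<in>V. \<mu> z * (\<Sum>y\<in>V. (T t \<omega> {} z y)\<^sup>2 / \<mu> y)) = ?Q \<omega>"
      by (simp add: sum_distrib_left)
    finally show ?thesis by (simp add: mu_sum add_divide_distrib diff_divide_distrib)
  qed
  have R: "B \<le> measure_pmf.expectation M ?R"
  proof -
    have "B = (\<Sum>z\<in>V. \<mu> z * B)" by (simp add: mu_sum flip: sum_distrib_right)
    also have "\<dots> \<le> (\<Sum>z\<in>V. \<mu> z * measure_pmf.expectation M (\<lambda>\<omega>. \<Sum>y\<in>V. T t \<omega> {} z y))"
      using mu_nonneg mass by (intro sum_mono mult_left_mono) auto
    also have "\<dots> = measure_pmf.expectation M ?R"
      by (subst Bochner_Integration.integral_sum) auto
    finally show ?thesis .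
  qed
  have "measure_pmf.expectation M (\<lambda>\<omega>. \<Sum>z\<in>V. \<mu> z * deficit t \<omega> {} z)
     \<le> measure_pmf.expectation M (\<lambda>\<omega>. \<delta> / 2 + (?Q \<omega> - 2 * ?R \<omega> + 1) / (2 * \<delta>))"
    by (intro expectation_mono_finite le) simp
  also have "\<dots> = \<delta> / 2 + (measure_pmf.expectation M ?Q - 2 * measure_pmf.expectation M ?R + 1) / (2 * \<delta>)"
    by (subst Bochner_Integration.integral_add, simp, simp) simp
  also have "\<dots> \<le> \<delta> / 2 + (A - 2 * B + 1) / (2 * \<delta>)"
    using second R d by (intro add_mono divide_right_mono) auto
  finally show ?thesis .
qed

end

section \<open>Mixing and stationarity of finite chains\<close>

lemma trans_mat_nonneg: "0 \<le> trans_mat n G x y"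
  by (simp add: trans_mat_def)

lemma trans_pow_nonneg: "0 \<le> trans_pow n G t x y"
  by (induction t arbitrary: x) (auto intro!: sum_nonneg mult_nonneg_nonneg trans_mat_nonneg)

lemma trans_mat_row:
  "(\<Sum>y\<in>{1..n}. trans_mat n G x y) = (if outdeg n G x = 0 then 0 else 1)"
proof -
  have "(\<Sum>y\<in>{1..n}. trans_mat n G x y) = (\<Sum>y\<in>{y \<in> {1..n}. G (x, y)}. 1 / real (outdeg n G x))"
    by (intro sum.mono_neutral_cong_right) (auto simp: trans_mat_def)
  then show ?thesis by (simp add: outdeg_def)
qed

lemma trans_pow_row_le: "x \<in> {1..n} \<Longrightarrow> (\<Sum>y\<in>{1..n}. trans_pow n G t x y) \<le> 1"
proof (induction t arbitrary: x)
  case (Suc t)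
  have "(\<Sum>y\<in>{1..n}. trans_pow n G (Suc t) x y)
     = (\<Sum>z\<in>{1..n}. trans_mat n G x z * (\<Sum>y\<in>{1..n}. trans_pow n G t z y))"
    by (simp only: trans_pow.simps sum_distrib_left) (rule sum.swap)
  also have "\<dots> \<le> (\<Sum>z\<in>{1..n}. trans_mat n G x z * 1)"
    using Suc.IH by (intro sum_mono mult_left_mono trans_mat_nonneg) auto
  also have "\<dots> \<le> 1" using trans_mat_row[of n G x] by simp
  finally show ?case .
qed simp

lemma trans_pow_row:
  assumes "\<And>x. x \<in> {1..n} \<Longrightarrow> outdeg n G x \<noteq> 0"
  shows "x \<in> {1..n} \<Longrightarrow> (\<Sum>y\<in>{1..n}. trans_pow n G t x y) = 1"
proof (induction t arbitrary: x)
  case (Suc t)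
  have "(\<Sum>y\<in>{1..n}. trans_pow n G (Suc t) x y)
     = (\<Sum>z\<in>{1..n}. trans_mat n G x z * (\<Sum>y\<in>{1..n}. trans_pow n G t z y))"
    by (simp only: trans_pow.simps sum_distrib_left) (rule sum.swap)
  also have "\<dots> = (\<Sum>z\<in>{1..n}. trans_mat n G x z * 1)"
    using Suc.IH by (intro sum.cong) auto
  also have "\<dots> = 1" using trans_mat_row[of n G x] assms Suc.prems by simp
  finally show ?case .
qed simp

lemma trans_pow_Suc_right:
  "x \<in> {1..n} \<Longrightarrow> y \<in> {1..n} \<Longrightarrow>
    trans_pow n G (Suc t) x y = (\<Sum>z\<in>{1..n}. trans_pow n G t x z * trans_mat n G z y)"
proof (induction t arbitrary: x)
  case 0
  have a: "(\<Sum>z\<in>{1..n}. trans_mat n G x z * (if z = y then 1 else 0)) = trans_mat n G x y"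
    using 0 by (simp add: if_distrib cong: if_cong)
  have b: "(\<Sum>z\<in>{1..n}. (if x = z then 1 else 0) * trans_mat n G z y) = trans_mat n G x y"
    using 0 by (simp add: if_distrib[of "\<lambda>u. u * _"] cong: if_cong)
  show ?case using a b by simp
next
  case (Suc t)
  have "trans_pow n G (Suc (Suc t)) x y
     = (\<Sum>z\<in>{1..n}. trans_mat n G x z * (\<Sum>w\<in>{1..n}. trans_pow n G t z w * trans_mat n G w y))"
    using Suc by (subst trans_pow.simps(2), intro sum.cong) auto
  also have "\<dots> = (\<Sum>w\<in>{1..n}. (\<Sum>z\<in>{1..n}. trans_mat n G x z * trans_pow n G t z w) * trans_mat n G w y)"
    unfolding sum_distrib_left sum_distrib_right mult.assoc by (rule sum.swap)
  finally show ?case by simp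
qed

lemma trans_pow_walk:
  "x \<in> {1..n} \<Longrightarrow> y \<in> {1..n} \<Longrightarrow>
    walk {1..n} (\<lambda>a. of_bool (x = a)) (trans_mat n G) t y = trans_pow n G t x y"
proof (induction t arbitrary: y)
  case (Suc t)
  show ?case
    unfolding trans_pow_Suc_right[OF Suc.prems] walk.simps using Suc by (intro sum.cong) auto
qed simp

lemma tv_dist_eq_positive_part:
  assumes "sum p {1..n} = sum \<mu> {1..n}"
  shows "tv_dist n p \<mu> = (\<Sum>y\<in>{1..n}. max 0 (\<mu> y - p y))"
proof -
  have "\<bar>p y - \<mu> y\<bar> = 2 * max 0 (\<mu> y - p y) + (p y - \<mu> y)" for y
    by (auto simp: abs_if max_def)
  then have "(\<Sum>y\<in>{1..n}. \<bar>p y - \<mu> y\<bar>)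
    = 2 * (\<Sum>y\<in>{1..n}. max 0 (\<mu> y - p y)) + (sum p {1..n} - sum \<mu> {1..n})"
    by (simp add: sum.distrib sum_distrib_left sum_subtractf)
  with assms show ?thesis by (simp add: tv_dist_def)
qed

lemma tv_dist_triangle: "tv_dist n p q \<le> tv_dist n p r + tv_dist n q r"
proof -
  have "(\<Sum>x\<in>{1..n}. \<bar>p x - q x\<bar>) \<le> (\<Sum>x\<in>{1..n}. \<bar>p x - r x\<bar> + \<bar>q x - r x\<bar>)"
    by (intro sum_mono) auto
  then show ?thesis by (simp add: tv_dist_def sum.distrib field_simps)
qed

lemma tv_dist_le_1:
  assumes "\<And>x. x \<in> {1..n} \<Longrightarrow> 0 \<le> p x" "\<And>x. x \<in> {1..n} \<Longrightarrow> 0 \<le> q x"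
    "sum p {1..n} \<le> 1" "sum q {1..n} \<le> 1"
  shows "tv_dist n p q \<le> 1"
proof -
  have "(\<Sum>x\<in>{1..n}. \<bar>p x - q x\<bar>) \<le> (\<Sum>x\<in>{1..n}. p x + q x)"
    using assms by (intro sum_mono) (auto simp: abs_le_iff)
  then show ?thesis using assms by (simp add: tv_dist_def sum.distrib)
qed

lemma tv_dist_ge:
  assumes "sum p {1..n} = sum q {1..n}" "S \<subseteq> {1..n}"
  shows "sum p S - sum q S \<le> tv_dist n p q"
proof -
  have fin: "finite S" using assms(2) finite_subset by auto
  have "sum p S - sum q S = (\<Sum>x\<in>S. p x - q x)" by (simp add: sum_subtractf)
  also have "\<dots> \<le> (\<Sum>x\<in>S. max 0 (p x - q x))" by (intro sum_mono) auto
  also have "\<dots> \<le> (\<Sum>x\<in>{1..n}. max 0 (p x - q x))" using assms by (intro sum_mono2) auto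
  also have "\<dots> = tv_dist n q p" using assms by (subst tv_dist_eq_positive_part) auto
  also have "\<dots> = tv_dist n p q" by (simp add: tv_dist_def abs_minus_commute)
  finally show ?thesis .
qed

definition push :: "nat \<Rightarrow> digraph \<Rightarrow> nat \<Rightarrow> (nat \<Rightarrow> real) \<Rightarrow> nat \<Rightarrow> real" where
  "push n G t \<nu> y = (\<Sum>x\<in>{1..n}. \<nu> x * trans_pow n G t x y)"

lemma push_invariant:
  assumes "\<And>y. y \<in> {1..n} \<Longrightarrow> (\<Sum>x\<in>{1..n}. \<nu> x * trans_mat n G x y) = \<nu> y"
  shows "y \<in> {1..n} \<Longrightarrow> push n G t \<nu> y = \<nu> y"
proof (induction t arbitrary: y)
  case 0
  then show ?case by (simp add: push_def if_distrib cong: if_cong)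
next
  case (Suc t)
  have "push n G (Suc t) \<nu> y = (\<Sum>z\<in>{1..n}. push n G t \<nu> z * trans_mat n G z y)"
    unfolding push_def sum_distrib_right
    by (subst sum.swap, intro sum.cong refl)
      (simp only: trans_pow_Suc_right[OF _ Suc.prems] sum_distrib_left mult.assoc)
  also have "\<dots> = (\<Sum>z\<in>{1..n}. \<nu> z * trans_mat n G z y)"
    using Suc.IH by (intro sum.cong) auto
  finally show ?case using assms Suc.prems by simp
qed

lemma push_contracts:
  assumes tv: "\<And>x. x \<in> {1..n} \<Longrightarrow> tv_dist n (trans_pow n G t x) \<mu> \<le> \<epsilon>"
    and "sum \<nu> {1..n} = sum \<nu>' {1..n}"
  shows "(\<Sum>y\<in>{1..n}. \<bar>push n G t \<nu> y - push n G t \<nu>' y\<bar>) \<le> 2 * \<epsilon> * (\<Sum>y\<in>{1..n}. \<bar>\<nu> y - \<nu>' y\<bar>)"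
proof -
  have "push n G t \<nu> y - push n G t \<nu>' y = (\<Sum>x\<in>{1..n}. (\<nu> x - \<nu>' x) * (trans_pow n G t x y - \<mu> y))" for y
  proof -
    have "(\<Sum>x\<in>{1..n}. (\<nu> x - \<nu>' x) * (trans_pow n G t x y - \<mu> y))
      = push n G t \<nu> y - push n G t \<nu>' y - (\<Sum>x\<in>{1..n}. (\<nu> x - \<nu>' x)) * \<mu> y"
      unfolding push_def sum_distrib_right sum_subtractf[symmetric]
      by (intro sum.cong) (auto simp: algebra_simps)
    then show ?thesis using assms by (simp add: sum_subtractf)
  qed
  then have "(\<Sum>y\<in>{1..n}. \<bar>push n G t \<nu> y - push n G t \<nu>' y\<bar>)
     \<le> (\<Sum>y\<in>{1..n}. \<Sum>x\<in>{1..n}. \<bar>\<nu> x - \<nu>' x\<bar> * \<bar>trans_pow n G t x y - \<mu> y\<bar>)"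
    by (auto intro!: sum_mono order_trans[OF sum_abs] simp: abs_mult)
  also have "\<dots> = (\<Sum>x\<in>{1..n}. \<bar>\<nu> x - \<nu>' x\<bar> * (2 * tv_dist n (trans_pow n G t x) \<mu>))"
    by (subst sum.swap) (simp add: tv_dist_def sum_distrib_left)
  also have "\<dots> \<le> (\<Sum>x\<in>{1..n}. \<bar>\<nu> x - \<nu>' x\<bar> * (2 * \<epsilon>))"
    using tv by (intro sum_mono mult_left_mono) auto
  finally show ?thesis by (simp add: sum_distrib_right mult_ac flip: sum_distrib_left)
qed

lemma push_tv:
  assumes tv: "\<And>x. x \<in> {1..n} \<Longrightarrow> tv_dist n (trans_pow n G t x) \<mu> \<le> \<epsilon>"
    and nu: "sum \<nu> {1..n} = 1" "\<And>x. x \<in> {1..n} \<Longrightarrow> 0 \<le> \<nu> x"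
  shows "tv_dist n (push n G t \<nu>) \<mu> \<le> \<epsilon>"
proof -
  have "push n G t \<nu> y - \<mu> y = (\<Sum>x\<in>{1..n}. \<nu> x * (trans_pow n G t x y - \<mu> y))" for y
  proof -
    have "(\<Sum>x\<in>{1..n}. \<nu> x * (trans_pow n G t x y - \<mu> y)) = push n G t \<nu> y - (\<Sum>x\<in>{1..n}. \<nu> x) * \<mu> y"
      unfolding push_def sum_distrib_right sum_subtractf[symmetric]
      by (intro sum.cong) (auto simp: algebra_simps)
    then show ?thesis using nu by simp
  qed
  then have "(\<Sum>y\<in>{1..n}. \<bar>push n G t \<nu> y - \<mu> y\<bar>)
     \<le> (\<Sum>y\<in>{1..n}. \<Sum>x\<in>{1..n}. \<nu> x * \<bar>trans_pow n G t x y - \<mu> y\<bar>)"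
    using nu by (auto intro!: sum_mono order_trans[OF sum_abs] simp: abs_mult)
  also have "\<dots> = (\<Sum>x\<in>{1..n}. \<nu> x * (2 * tv_dist n (trans_pow n G t x) \<mu>))"
    by (subst sum.swap) (simp add: tv_dist_def sum_distrib_left)
  also have "\<dots> \<le> (\<Sum>x\<in>{1..n}. \<nu> x * (2 * \<epsilon>))"
    using tv nu by (intro sum_mono mult_left_mono) auto
  also have "\<dots> = 2 * \<epsilon>" using nu by (simp flip: sum_distrib_right)
  finally show ?thesis by (simp add: tv_dist_def)
qed

lemma push_sum:
  assumes "\<And>x. x \<in> {1..n} \<Longrightarrow> outdeg n G x \<noteq> 0"
  shows "sum (push n G t \<nu>) {1..n} = sum \<nu> {1..n}"
proof -
  have "sum (push n G t \<nu>) {1..n} = (\<Sum>x\<in>{1..n}. \<nu> x * (\<Sum>y\<in>{1..n}. trans_pow n G t x y))"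
    unfolding push_def sum_distrib_left by (rule sum.swap)
  also have "\<dots> = (\<Sum>x\<in>{1..n}. \<nu> x * 1)"
    using trans_pow_row[OF assms] by (intro sum.cong) auto
  finally show ?thesis by simp
qed

lemma push_Suc_swap:
  assumes "y \<in> {1..n}"
  shows "push n G t (push n G 1 \<nu>) y = push n G 1 (push n G t \<nu>) y"
proof -
  have 1: "push n G 1 \<rho> y = (\<Sum>x\<in>{1..n}. \<rho> x * trans_mat n G x y)" if "y \<in> {1..n}" for \<rho> y
    using that by (simp add: push_def if_distrib cong: if_cong)
  have "push n G t (push n G 1 \<nu>) y = (\<Sum>z\<in>{1..n}. (\<Sum>x\<in>{1..n}. \<nu> x * trans_mat n G x z) * trans_pow n G t z y)"
    unfolding push_def[of n G t "push n G 1 \<nu>"] by (intro sum.cong) (simp_all only: 1)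
  also have "\<dots> = (\<Sum>x\<in>{1..n}. \<nu> x * trans_pow n G (Suc t) x y)"
    unfolding trans_pow.simps sum_distrib_left sum_distrib_right mult.assoc by (rule sum.swap)
  also have "\<dots> = (\<Sum>x\<in>{1..n}. \<Sum>z\<in>{1..n}. \<nu> x * trans_pow n G t x z * trans_mat n G z y)"
    by (intro sum.cong refl) (simp only: trans_pow_Suc_right[OF _ assms] sum_distrib_left mult.assoc)
  also have "\<dots> = push n G 1 (push n G t \<nu>) y"
    unfolding 1[OF assms] unfolding push_def sum_distrib_right by (rule sum.swap)
  finally show ?thesis .
qed

lemma push_unique:
  assumes tv: "\<And>x. x \<in> {1..n} \<Longrightarrow> tv_dist n (trans_pow n G t x) \<mu> \<le> 1/4"
    and "sum \<nu> {1..n} = sum \<nu>' {1..n}"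
    and "\<And>y. y \<in> {1..n} \<Longrightarrow> push n G t \<nu> y = \<nu> y" "\<And>y. y \<in> {1..n} \<Longrightarrow> push n G t \<nu>' y = \<nu>' y"
    and y: "y \<in> {1..n}"
  shows "\<nu> y = \<nu>' y"
proof -
  let ?D = "\<Sum>y\<in>{1..n}. \<bar>\<nu> y - \<nu>' y\<bar>"
  have "?D = (\<Sum>y\<in>{1..n}. \<bar>push n G t \<nu> y - push n G t \<nu>' y\<bar>)"
    using assms by (intro sum.cong) auto
  also have "\<dots> \<le> 2 * (1/4) * ?D" by (rule push_contracts[OF tv assms(2)])
  finally have "?D \<le> 0" by simp
  then have "?D = 0" by (simp add: order_antisym sum_nonneg)
  then show ?thesis using y by (auto simp: sum_nonneg_eq_0_iff)
qed

lemma convergent_geometric: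
  fixes a :: "nat \<Rightarrow> real"
  assumes "\<And>j. \<bar>a (Suc j) - a j\<bar> \<le> C * (1/2) ^ j"
  shows "convergent a"
proof -
  have "summable (\<lambda>j. C * (1/2::real) ^ j)" by (intro summable_mult summable_geometric) auto
  then have "summable (\<lambda>j. a (Suc j) - a j)"
    using assms by (elim summable_comparison_test') auto
  then have "convergent (\<lambda>k. \<Sum>j<k. a (Suc j) - a j)"
    by (simp add: summable_iff_convergent)
  then have "convergent (\<lambda>k. a k - a 0)" by (simp add: sum_lessThan_telescope)
  then show ?thesis
    by (simp add: convergent_diff_const_right_iff)
qed

lemma ex1_invariant_prob:
  assumes n: "1 \<le> n" and deg: "\<And>x. x \<in> {1..n} \<Longrightarrow> outdeg n G x \<noteq> 0"
    and tv: "\<And>x. x \<in> {1..n} \<Longrightarrow> tv_dist n (trans_pow n G t x) \<mu> \<le> 1/4"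
  shows "\<exists>!\<nu>. invariant_prob n G \<nu>"
proof -
  let ?V = "{1..n}"
  define b where "b j = ((push n G t) ^^ j) (\<lambda>y. of_bool (y = 1))" for j
  have b_Suc: "b (Suc j) = push n G t (b j)" for j by (simp add: b_def)
  have b_nonneg: "0 \<le> b j y" for j y
    by (induction j arbitrary: y)
      (auto simp: b_Suc push_def intro!: sum_nonneg mult_nonneg_nonneg trans_pow_nonneg, simp add: b_def)
  have b_sum: "sum (b j) ?V = 1" for j
  proof (induction j)
    case 0
    show ?case using n by (simp add: b_def of_bool_def)
  qed (simp only: b_Suc push_sum[OF deg])
  have step: "(\<Sum>y\<in>?V. \<bar>b (Suc j) y - b j y\<bar>) \<le> 2 * (1/2) ^ j" for j
  proof (induction j)
    case 0
    have "(\<Sum>y\<in>?V. \<bar>b (Suc 0) y - b 0 y\<bar>) \<le> (\<Sum>y\<in>?V. b (Suc 0) y + b 0 y)"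
      using b_nonneg by (intro sum_mono) (auto simp: abs_le_iff)
    then show ?case using b_sum[of "Suc 0"] b_sum[of 0] by (simp add: sum.distrib)
  next
    case (Suc j)
    have "(\<Sum>y\<in>?V. \<bar>b (Suc (Suc j)) y - b (Suc j) y\<bar>) \<le> 2 * (1/4) * (\<Sum>y\<in>?V. \<bar>b (Suc j) y - b j y\<bar>)"
      unfolding b_Suc[of "Suc j"] b_Suc[of j]
      by (rule push_contracts[OF tv]) (assumption, rule push_sum[OF deg])
    with Suc show ?case by simp
  qed
  define \<nu> where "\<nu> y = (if y \<in> ?V then lim (\<lambda>j. b j y) else 0)" for y
  have lim: "(\<lambda>j. b j y) \<longlonglongrightarrow> \<nu> y" if "y \<in> ?V" for y
  proof -
    have "\<bar>b (Suc j) y - b j y\<bar> \<le> 2 * (1/2) ^ j" for j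
      using that by (intro order_trans[OF member_le_sum step[of j]]) auto
    then have "convergent (\<lambda>j. b j y)" by (rule convergent_geometric)
    then show ?thesis using that by (simp add: \<nu>_def convergent_LIMSEQ_iff)
  qed
  have nu_nonneg: "0 \<le> \<nu> y" for y
  proof (cases "y \<in> ?V")
    case True
    show ?thesis by (rule LIMSEQ_le_const[OF lim[OF True]]) (use b_nonneg in auto)
  qed (auto simp: \<nu>_def)
  have nu_sum: "sum \<nu> ?V = 1"
  proof (rule LIMSEQ_unique)
    show "(\<lambda>j. sum (b j) ?V) \<longlonglongrightarrow> sum \<nu> ?V" by (intro tendsto_sum lim)
    show "(\<lambda>j. sum (b j) ?V) \<longlonglongrightarrow> 1" unfolding b_sum by (rule tendsto_const)
  qed
  have nu_t: "push n G t \<nu> y = \<nu> y" if "y \<in> ?V" for y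
  proof (rule LIMSEQ_unique)
    show "(\<lambda>j. b (Suc j) y) \<longlonglongrightarrow> push n G t \<nu> y"
      unfolding b_Suc push_def by (intro tendsto_sum tendsto_mult lim tendsto_const)
    show "(\<lambda>j. b (Suc j) y) \<longlonglongrightarrow> \<nu> y" using lim[OF that] by (rule LIMSEQ_Suc)
  qed
  have nu_1: "push n G 1 \<nu> y = \<nu> y" if "y \<in> ?V" for y
  proof (rule push_unique[OF tv])
    fix z assume z: "z \<in> ?V"
    show "push n G t (push n G 1 \<nu>) z = push n G 1 \<nu> z"
      unfolding push_Suc_swap[OF z] unfolding push_def[of n G 1] using nu_t by (intro sum.cong) auto
  qed (use that nu_t push_sum[OF deg] in auto)
  have one: "push n G 1 \<rho> y = (\<Sum>x\<in>?V. \<rho> x * trans_mat n G x y)" if "y \<in> ?V" for \<rho> y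
    using that by (simp add: push_def if_distrib cong: if_cong)
  have emb: "pmf (embed_pmf \<nu>) y = \<nu> y" for y
  proof (rule pmf_embed_pmf)
    have "(\<integral>\<^sup>+x. ennreal (\<nu> x) \<partial>count_space UNIV) = (\<integral>\<^sup>+x. ennreal (\<nu> x) \<partial>count_space ?V)"
      by (rule nn_integral_count_space_eq) (auto simp: \<nu>_def)
    also have "\<dots> = 1"
      using nu_sum nu_nonneg by (simp add: nn_integral_count_space_finite sum_ennreal)
    finally show "(\<integral>\<^sup>+x. ennreal (\<nu> x) \<partial>count_space UNIV) = 1" .
  qed (rule nu_nonneg)
  show ?thesis
  proof (rule ex1I[of _ "embed_pmf \<nu>"])
    have "set_pmf (embed_pmf \<nu>) \<subseteq> ?V"
      by (auto simp: set_pmf_eq emb \<nu>_def split: if_splits)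
    then show "invariant_prob n G (embed_pmf \<nu>)"
      unfolding invariant_prob_def emb using nu_1 one by metis
  next
    fix \<rho> assume r: "invariant_prob n G \<rho>"
    show "\<rho> = embed_pmf \<nu>"
    proof (rule pmf_eqI)
      fix y
      show "pmf \<rho> y = pmf (embed_pmf \<nu>) y"
      proof (cases "y \<in> ?V")
        case True
        have "pmf \<rho> y = \<nu> y"
        proof (rule push_unique[OF tv])
          show "sum (pmf \<rho>) ?V = sum \<nu> ?V"
            using r nu_sum by (simp add: invariant_prob_def sum_pmf_eq_1)
          show "push n G t (pmf \<rho>) y = pmf \<rho> y" if "y \<in> ?V" for y
            using r that by (intro push_invariant) (auto simp: invariant_prob_def)
        qed (use True nu_t in auto)
        then show ?thesis by (simp add: emb)
      next
        case False
        then have "y \<notin> set_pmf \<rho>" using r by (auto simp: invariant_prob_def)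
        then show ?thesis using False by (auto simp: emb \<nu>_def set_pmf_eq)
      qed
    qed
  qed
qed

lemma tv_invariant:
  assumes "invariant_prob n G \<nu>"
    and tv: "\<And>x. x \<in> {1..n} \<Longrightarrow> tv_dist n (trans_pow n G t x) \<mu> \<le> \<epsilon>"
  shows "tv_dist n (pmf \<nu>) \<mu> \<le> \<epsilon>"
proof -
  have "tv_dist n (push n G t (pmf \<nu>)) \<mu> \<le> \<epsilon>"
    using assms(1) by (intro push_tv[OF tv]) (auto simp: invariant_prob_def sum_pmf_eq_1)
  moreover have "tv_dist n (push n G t (pmf \<nu>)) \<mu> = tv_dist n (pmf \<nu>) \<mu>"
    using assms(1) unfolding tv_dist_def
    by (intro arg_cong2[where f = "(*)"] sum.cong refl)
      (subst push_invariant[where n = n], auto simp: invariant_prob_def)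
  ultimately show ?thesis by simp
qed

lemma card_support_trans_pow:
  assumes "\<And>x. x \<in> {1..n} \<Longrightarrow> outdeg n G x \<le> D"
  shows "x \<in> {1..n} \<Longrightarrow> card {y \<in> {1..n}. trans_pow n G t x y \<noteq> 0} \<le> D ^ t"
proof (induction t arbitrary: x)
  case 0
  have "{y \<in> {1..n}. trans_pow n G 0 x y \<noteq> 0} \<subseteq> {x}" by auto
  from card_mono[OF _ this] show ?case by simp
next
  case (Suc t)
  let ?N = "{z \<in> {1..n}. G (x, z)}"
  have "{y \<in> {1..n}. trans_pow n G (Suc t) x y \<noteq> 0}
    \<subseteq> (\<Union>z\<in>?N. {y \<in> {1..n}. trans_pow n G t z y \<noteq> 0})"
  proof
    fix y assume y: "y \<in> {y \<in> {1..n}. trans_pow n G (Suc t) x y \<noteq> 0}"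
    then obtain z where "z \<in> {1..n}" "trans_mat n G x z * trans_pow n G t z y \<noteq> 0"
      by (auto elim!: sum.not_neutral_contains_not_neutral)
    with y show "y \<in> (\<Union>z\<in>?N. {y \<in> {1..n}. trans_pow n G t z y \<noteq> 0})"
      by (auto simp: trans_mat_def split: if_splits)
  qed
  then have "card {y \<in> {1..n}. trans_pow n G (Suc t) x y \<noteq> 0}
    \<le> card (\<Union>z\<in>?N. {y \<in> {1..n}. trans_pow n G t z y \<noteq> 0})"
    by (intro card_mono) auto
  also have "\<dots> \<le> (\<Sum>z\<in>?N. card {y \<in> {1..n}. trans_pow n G t z y \<noteq> 0})"
    by (intro card_UN_le) auto
  also have "\<dots> \<le> (\<Sum>z\<in>?N. D ^ t)" using Suc.IH by (intro sum_mono) auto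
  also have "\<dots> \<le> D * D ^ t"
    using assms[OF Suc.prems] by (auto simp: outdeg_def)
  finally show ?case by simp
qed

text \<open>A walk of length \<open>s\<close> sees only \<open>D ^ s\<close> vertices; by Cauchy-Schwarz \<open>\<mu>\<close>, hence \<open>\<nu>\<close>,
  gives them little mass.\<close>

lemma tv_trans_pow_ge:
  assumes deg0: "\<And>x. x \<in> {1..n} \<Longrightarrow> outdeg n G x \<noteq> 0"
    and deg: "\<And>x. x \<in> {1..n} \<Longrightarrow> outdeg n G x \<le> D"
    and tv: "tv_dist n \<nu> \<mu> \<le> \<epsilon>"
    and nu: "sum \<nu> {1..n} = 1" and mu: "sum \<mu> {1..n} = 1"
    and q: "(\<Sum>y\<in>{1..n}. (\<mu> y)\<^sup>2) \<le> q"
    and x: "x \<in> {1..n}"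
  shows "1 - sqrt (real D ^ s * q) - \<epsilon> \<le> tv_dist n (trans_pow n G s x) \<nu>"
proof -
  let ?S = "{y \<in> {1..n}. trans_pow n G s x y \<noteq> 0}"
  have "sum (trans_pow n G s x) ?S = sum (trans_pow n G s x) {1..n}"
    by (intro sum.mono_neutral_left) auto
  then have s1: "sum (trans_pow n G s x) ?S = 1" using trans_pow_row[OF deg0 x] by simp
  have s2: "sum \<nu> ?S - sum \<mu> ?S \<le> \<epsilon>"
    by (rule order_trans[OF tv_dist_ge tv]) (simp only: nu mu, blast)
  have "(\<Sum>y\<in>?S. 1 * \<mu> y)\<^sup>2 \<le> (\<Sum>y\<in>?S. 1\<^sup>2) * (\<Sum>y\<in>?S. (\<mu> y)\<^sup>2)"
    by (rule Cauchy_Schwarz_ineq_sum)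
  also have "\<dots> \<le> real D ^ s * q"
  proof (intro mult_mono)
    show "(\<Sum>y\<in>?S. 1\<^sup>2) \<le> real D ^ s"
      using card_support_trans_pow[where G=G and t=s, OF deg x] by (simp flip: of_nat_power)
    have "(\<Sum>y\<in>?S. (\<mu> y)\<^sup>2) \<le> (\<Sum>y\<in>{1..n}. (\<mu> y)\<^sup>2)" by (intro sum_mono2) auto
    then show "(\<Sum>y\<in>?S. (\<mu> y)\<^sup>2) \<le> q" using q by simp
  qed (auto intro: sum_nonneg)
  finally have s3: "sum \<mu> ?S \<le> sqrt (real D ^ s * q)" by (simp add: real_le_rsqrt)
  have "1 - sum \<nu> ?S \<le> tv_dist n (trans_pow n G s x) \<nu>"
    unfolding s1[symmetric] by (rule tv_dist_ge) (simp only: nu trans_pow_row[OF deg0 x], blast)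
  with s2 s3 show ?thesis by linarith
qed

section \<open>The Chung-Lu digraph for fixed n\<close>

locale chung_lu_model =
  fixes n :: nat and wp wm :: "nat \<Rightarrow> real" and M0 M1 b :: real
  assumes n2: "2 \<le> n" and M0: "1 < M0"
    and wp: "\<And>x. x \<in> {1..n} \<Longrightarrow> M0 \<le> wp x \<and> wp x \<le> M1"
    and wm: "\<And>x. x \<in> {1..n} \<Longrightarrow> 0 < wm x"
    and balanced: "sum wp {1..n} = sum wm {1..n}"
    and wm_le: "\<And>x. x \<in> {1..n} \<Longrightarrow> wm x \<le> b * sum wm {1..n}"
    and b_le: "6 * b \<le> 1"
    and untruncated: "\<And>x y. x \<in> {1..n} \<Longrightarrow> y \<in> {1..n} \<Longrightarrow> wp x * wm y * (ln (real n) / real n) \<le> 1"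
begin

definition W :: real where "W = sum wm {1..n}"
definition L :: real where "L = ln (real n)"
definition c :: real where "c = 1 / (1 - 3 * b)"
definition \<mu> :: "nat \<Rightarrow> real" where "\<mu> y = (if y \<in> {1..n} then mu_in n wm y else 0)"
definition p :: "nat \<Rightarrow> nat \<Rightarrow> real" where
  "p x y = (if x \<in> {1..n} \<and> y \<in> {1..n} then wp x * wm y * (L / real n) else 0)"
definition row :: "nat \<Rightarrow> (nat \<Rightarrow> bool) pmf" where
  "row x = Pi_pmf ({1..n} - {x}) False (\<lambda>y. bernoulli_pmf (p x y))"
definition P :: "nat \<Rightarrow> (nat \<Rightarrow> bool) \<Rightarrow> nat \<Rightarrow> real" where
  "P x r a = (if r a then 1 / real (num_true {1..n} r) else 0)"

lemma L_pos: "0 < L" using n2 by (simp add: L_def)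

lemma W_bounds: "M0 * real n \<le> W" "W \<le> M1 * real n" "0 < W"
proof -
  have "(\<Sum>x\<in>{1..n}. M0) \<le> sum wp {1..n}" "sum wp {1..n} \<le> (\<Sum>x\<in>{1..n}. M1)"
    using wp by (intro sum_mono; auto)+
  then show 1: "M0 * real n \<le> W" "W \<le> M1 * real n" using balanced by (auto simp: W_def mult.commute)
  have "0 < M0 * real n" using M0 n2 by simp
  with 1 show "0 < W" by linarith
qed

lemma M1: "1 < M1" using wp[of 1] M0 n2 by auto

lemma b_nonneg: "0 \<le> b"
proof -
  have "0 < b * W" using wm[of 1] wm_le[of 1] n2 by (auto simp: W_def)
  then show ?thesis using W_bounds(3) by (simp add: zero_less_mult_iff)
qed

lemma c_bounds: "1 \<le> c" "c \<le> 2" "c \<le> 1 + 6 * b" "(1 - 3 * b) * c = 1" "0 < 1 - 3 * b"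
proof -
  show pos: "0 < 1 - 3 * b" using b_le by linarith
  show "1 \<le> c" "c \<le> 2" using b_nonneg b_le by (auto simp: c_def divide_simps)
  show "(1 - 3 * b) * c = 1" using pos by (simp add: c_def)
  have "1 \<le> (1 + 6 * b) * (1 - 3 * b)"
    using mult_left_mono[OF b_le b_nonneg] by (simp add: algebra_simps)
  then show "c \<le> 1 + 6 * b" using pos by (simp add: c_def divide_le_eq)
qed

lemma p01: "0 \<le> p x y \<and> p x y \<le> 1"
proof (cases "x \<in> {1..n} \<and> y \<in> {1..n}")
  case True
  then have "0 \<le> wp x" "0 \<le> wm y" using wp[of x] wm[of y] M0 by auto
  then have "0 \<le> wp x * wm y * (L / real n)" using L_pos by (intro mult_nonneg_nonneg) auto
  with True untruncated[of x y] show ?thesis by (simp add: p_def L_def)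
qed (auto simp: p_def)

lemma mu_nonneg: "0 \<le> \<mu> y" and mu_pos: "y \<in> {1..n} \<Longrightarrow> 0 < \<mu> y"
  and mu_sum: "sum \<mu> {1..n} = 1" and mu_le: "\<mu> y \<le> b" and mu_eq: "y \<in> {1..n} \<Longrightarrow> \<mu> y = wm y / W"
proof -
  show eq: "\<mu> y = wm y / W" if "y \<in> {1..n}" for y using that by (auto simp: \<mu>_def mu_in_def W_def)
  show pos: "0 < \<mu> y" if "y \<in> {1..n}" for y using wm[OF that] W_bounds(3) eq[OF that] by simp
  show "0 \<le> \<mu> y" using pos[of y] by (cases "y \<in> {1..n}") (auto simp: \<mu>_def)
  have "sum \<mu> {1..n} = (\<Sum>y\<in>{1..n}. wm y / W)" by (intro sum.cong refl eq)
  also have "\<dots> = 1" using W_bounds(3) by (simp add: W_def flip: sum_divide_distrib)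
  finally show "sum \<mu> {1..n} = 1" .
  show "\<mu> y \<le> b"
  proof (cases "y \<in> {1..n}")
    case True
    then show ?thesis using wm_le[OF True] W_bounds(3) eq[OF True] by (simp add: W_def divide_le_eq)
  qed (use b_nonneg in \<open>auto simp: \<mu>_def\<close>)
qed

definition m :: "nat \<Rightarrow> real" where "m x = wp x * (L / real n) * W"

lemma m_bounds:
  assumes "x \<in> {1..n}"
  shows "M0\<^sup>2 * L \<le> m x" "m x \<le> M1\<^sup>2 * L" "0 < m x"
proof -
  have n0: "0 < real n" using n2 by simp
  have "M0 * (L / real n) * (M0 * real n) \<le> m x"
    unfolding m_def using wp[OF assms] W_bounds L_pos M0 n0 by (intro mult_mono) auto
  then show 1: "M0\<^sup>2 * L \<le> m x" using n0 by (simp add: power2_eq_square mult_ac)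
  have "m x \<le> M1 * (L / real n) * (M1 * real n)"
    unfolding m_def using wp[OF assms] W_bounds L_pos M0 n0 M1 by (intro mult_mono) auto
  then show "m x \<le> M1\<^sup>2 * L" using n0 by (simp add: power2_eq_square mult_ac)
  have "0 < M0\<^sup>2 * L" using M0 L_pos by simp
  with 1 show "0 < m x" by linarith
qed

lemma p_eq: "x \<in> {1..n} \<Longrightarrow> y \<in> {1..n} \<Longrightarrow> p x y = m x * \<mu> y"
  using W_bounds(3) by (simp add: p_def m_def mu_eq del: atLeastAtMost_iff)

lemma sum_p_le: "x \<in> {1..n} \<Longrightarrow> B \<subseteq> {1..n} \<Longrightarrow> sum (p x) B \<le> m x"
proof -
  assume x: "x \<in> {1..n}" and B: "B \<subseteq> {1..n}"
  have "sum (p x) B = m x * sum \<mu> B"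
    unfolding sum_distrib_left using x B by (intro sum.cong refl p_eq) auto
  also have "\<dots> \<le> m x * sum \<mu> {1..n}"
    using m_bounds(3)[OF x] B mu_nonneg by (intro mult_left_mono sum_mono2) auto
  finally show ?thesis by (simp only: mu_sum)
qed

lemma sum_p_ge:
  assumes x: "x \<in> {1..n}" and B: "B \<subseteq> {1..n}" and C: "{1..n} \<subseteq> B \<union> {x,a,a'}"
  shows "m x / c \<le> sum (p x) B"
proof -
  have finB: "finite B" using B finite_subset by blast
  have "1 = sum \<mu> {1..n}" using mu_sum by simp
  also have "\<dots> \<le> sum \<mu> (B \<union> {x,a,a'})" using C finB mu_nonneg by (intro sum_mono2) auto
  also have "\<dots> \<le> sum \<mu> B + sum \<mu> {x,a,a'}" 
    using sum.union_inter[OF finB, of "{x,a,a'}" \<mu>] sum_nonneg[of "B \<inter> {x,a,a'}" \<mu>] mu_nonneg by simp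
  also have "sum \<mu> {x,a,a'} \<le> (\<Sum>y\<in>{x,a,a'}. b)" using mu_le by (intro sum_mono)
  also have "\<dots> \<le> 3 * b" using b_nonneg by (auto intro!: mult_right_mono simp: card_insert_if)
  finally have "1 - 3 * b \<le> sum \<mu> B" by simp
  then have "m x * (1 - 3 * b) \<le> m x * sum \<mu> B" using m_bounds(3)[OF x] by (intro mult_left_mono) auto
  also have "\<dots> = sum (p x) B"
    unfolding sum_distrib_left using x B by (intro sum.cong refl p_eq[symmetric]) auto
  finally show ?thesis by (simp add: c_def)
qed

lemma set_row: "r \<in> set_pmf (row x) \<Longrightarrow> y \<notin> {1..n} - {x} \<Longrightarrow> r y = False"
  unfolding row_def using set_Pi_pmf_subset[of "{1..n} - {x}" False "\<lambda>y. bernoulli_pmf (p x y)"] by auto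

lemma num_true_row: "r \<in> set_pmf (row x) \<Longrightarrow> num_true {1..n} r = num_true ({1..n} - {x}) r"
  unfolding num_true_def by (intro arg_cong[of _ _ card]) (auto dest: set_row[of r x x])

lemma finite_row: "finite (set_pmf (row x))"
  by (simp add: row_def)

lemma expectation_row:
  assumes "\<And>r. r \<in> set_pmf (row x) \<Longrightarrow> f r = g r"
  shows "measure_pmf.expectation (row x) f = expect_bits (p x) ({1..n} - {x}) g"
proof -
  have "measure_pmf.expectation (row x) f = measure_pmf.expectation (row x) g"
    using assms by (intro integral_cong_AE) (auto simp: AE_measure_pmf_iff)
  then show ?thesis by (simp add: expect_bits_def[where p = "p x", OF p01] row_def)
qed

lemma theta_bound:
  assumes "x \<in> {1..n}" shows "2 * c / m x \<le> c * (2 / L)"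
proof -
  have "1 * L \<le> M0\<^sup>2 * L" using M0 L_pos by (intro mult_right_mono) auto
  then have "L \<le> m x" using m_bounds(1)[OF assms] by linarith
  then have "2 * c / m x \<le> 2 * c / L" using L_pos c_bounds by (intro divide_left_mono) auto
  then show ?thesis by (simp add: mult.commute)
qed

lemma P_mean:
  assumes x: "x \<in> {1..n}" and a: "a \<in> {1..n}"
  shows "measure_pmf.expectation (row x) (\<lambda>r. P x r a) \<le> c * \<mu> a"
proof (cases "a = x")
  case True
  have "measure_pmf.expectation (row x) (\<lambda>r. P x r a) = expect_bits (p x) ({1..n} - {x}) (\<lambda>r. 0)"
    using True by (intro expectation_row) (auto simp: P_def dest: set_row[of _ x x])
  then show ?thesis using c_bounds mu_nonneg[of a] by (simp add: expect_bits_const[where p = "p x", OF p01])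
next
  case False
  let ?B = "{1..n} - {x}" and ?C = "{1..n} - {x} - {a}"
  have s: "m x / c \<le> sum (p x) ?C" by (rule sum_p_ge[OF x, of _ a a]) auto
  have mc: "0 < m x / c" using m_bounds[OF x] c_bounds by simp
  have "measure_pmf.expectation (row x) (\<lambda>r. P x r a) = expect_bits (p x) ?B (\<lambda>r. of_bool (r a) * (1 / real (num_true ?B r)))"
    by (rule expectation_row) (simp add: P_def num_true_row del: One_nat_def)
  also have "\<dots> = p x a * expect_bits (p x) ?C (\<lambda>r. 1 / real (Suc (num_true ?C r)))"
    using expect_bits_single[where p = "p x", OF p01, where B = ?B and i = a and f = "\<lambda>k. 1 / real k"] False a
    by (auto simp del: One_nat_def)
  also have "\<dots> \<le> p x a * (1 / sum (p x) ?C)"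
    using expect_bits_inverse_Suc[where p = "p x", OF p01, where B = ?C] s mc p01 by (intro mult_left_mono) (auto simp: add.commute)
  also have "\<dots> \<le> p x a * (1 / (m x / c))"
    using s mc p01 less_le_trans[OF mc s]
      by (intro mult_left_mono divide_left_mono mult_pos_pos) auto
  also have "\<dots> = c * \<mu> a" using m_bounds[OF x] by (simp add: p_eq[OF x a])
  finally show ?thesis .
qed

lemma P_mean2:
  assumes x: "x \<in> {1..n}" and a: "a \<in> {1..n}" and a': "a' \<in> {1..n}"
  shows "measure_pmf.expectation (row x) (\<lambda>r. P x r a * P x r a')
     \<le> c\<^sup>2 * \<mu> a * (\<mu> a' + (if a = a' then 2 / L else 0))"
proof (cases "a = x \<or> a' = x")
  case True
  have "measure_pmf.expectation (row x) (\<lambda>r. P x r a * P x r a') = expect_bits (p x) ({1..n} - {x}) (\<lambda>r. 0)"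
    using True by (intro expectation_row) (auto simp: P_def dest: set_row[of _ x x])
  then show ?thesis using c_bounds mu_nonneg[of a] mu_nonneg[of a'] L_pos by (simp add: expect_bits_const[where p = "p x", OF p01])
next
  case ne: False
  let ?B = "{1..n} - {x}"
  define C where "C = {1..n} - {x,a,a'}"
  have finC: "finite C" by (simp add: C_def)
  have s: "m x / c \<le> sum (p x) C" unfolding C_def by (rule sum_p_ge[OF x, of _ a a']) auto
  have mc: "0 < m x / c" using m_bounds[OF x] c_bounds by simp
  have inv: "expect_bits (p x) C (\<lambda>r. 1 / ((1 + real (num_true C r)) * (2 + real (num_true C r)))) \<le> (c / m x)\<^sup>2"
  proof -
    have "1 / (sum (p x) C)\<^sup>2 \<le> 1 / (m x / c)\<^sup>2"
      using s mc less_le_trans[OF mc s]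
      by (intro divide_left_mono power_mono mult_pos_pos zero_less_power) auto
    also have "\<dots> = (c / m x)\<^sup>2" by (simp add: power_divide)
    finally show ?thesis
      using expect_bits_inverse_Suc_Suc[where p = "p x", OF p01 finC] s mc by linarith
  qed
  show ?thesis
  proof (cases "a = a'")
    case False
    have "measure_pmf.expectation (row x) (\<lambda>r. P x r a * P x r a')
      = expect_bits (p x) ?B (\<lambda>r. of_bool (r a) * of_bool (r a') * (1 / (real (num_true ?B r))\<^sup>2))"
      by (rule expectation_row) (simp add: P_def num_true_row power2_eq_square del: One_nat_def)
    also have "\<dots> = p x a * p x a' * expect_bits (p x) C (\<lambda>r. 1 / (real (Suc (Suc (num_true C r))))\<^sup>2)"
    proof -
      have "?B - {a, a'} = C" by (auto simp: C_def)
      then show ?thesis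
        using expect_bits_pair[where p = "p x", OF p01, where B = ?B and i = a and j = a' and f = "\<lambda>k. 1 / (real k)\<^sup>2"] False ne a a'
        by (auto simp del: One_nat_def)
    qed
    also have "\<dots> \<le> p x a * p x a' * expect_bits (p x) C (\<lambda>r. 1 / ((1 + real (num_true C r)) * (2 + real (num_true C r))))"
      using p01 finC by (intro mult_left_mono expect_bits_mono[where p = "p x", OF p01])
        (auto simp: power2_eq_square intro!: divide_left_mono mult_mono)
    also have "\<dots> \<le> p x a * p x a' * (c / m x)\<^sup>2"
      using p01 by (intro mult_left_mono inv) auto
    also have "\<dots> = c\<^sup>2 * \<mu> a * \<mu> a'"
      using m_bounds[OF x] by (simp add: p_eq[OF x a] p_eq[OF x a'] power2_eq_square)
    finally show ?thesis using False by simp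
  next
    case True
    have "measure_pmf.expectation (row x) (\<lambda>r. P x r a * P x r a')
      = expect_bits (p x) ?B (\<lambda>r. of_bool (r a) * (1 / (real (num_true ?B r))\<^sup>2))"
      using True by (intro expectation_row) (simp add: P_def num_true_row power2_eq_square del: One_nat_def)
    also have "\<dots> = p x a * expect_bits (p x) C (\<lambda>r. 1 / (real (Suc (num_true C r)))\<^sup>2)"
    proof -
      have "?B - {a} = C" using True by (auto simp: C_def)
      then show ?thesis
        using expect_bits_single[where p = "p x", OF p01, where B = ?B and i = a and f = "\<lambda>k. 1 / (real k)\<^sup>2"] ne a
        by (auto simp del: One_nat_def)
    qed
    also have "\<dots> \<le> p x a * expect_bits (p x) C (\<lambda>r. 2 * (1 / ((1 + real (num_true C r)) * (2 + real (num_true C r)))))"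
      using p01 finC by (intro mult_left_mono expect_bits_mono[where p = "p x", OF p01])
        (auto simp: power2_eq_square divide_simps)
    also have "\<dots> \<le> p x a * (2 * (c / m x)\<^sup>2)"
      using p01 inv unfolding expect_bits_cmult[where p = "p x", OF p01] by (intro mult_left_mono) auto
    also have "\<dots> = c * \<mu> a * (2 * c / m x)"
      using m_bounds[OF x] by (simp add: p_eq[OF x a] power2_eq_square)
    also have "\<dots> \<le> c * \<mu> a * (c * (2 / L))"
      using c_bounds mu_nonneg by (intro mult_left_mono theta_bound x) auto
    also have "\<dots> \<le> c\<^sup>2 * \<mu> a * (\<mu> a + 2 / L)"
      using c_bounds mu_nonneg[of a] by (simp add: algebra_simps power2_eq_square)
    finally show ?thesis using True by simp
  qed
qed

sublocale R: random_rows "{1..n}" \<mu> row "\<lambda>_. False" P c "2 / L"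
proof
  show "1 \<le> c" "0 \<le> 2 / L" using c_bounds L_pos by auto
  show "0 \<le> P x r a" for x r a by (simp add: P_def)
qed (use mu_nonneg mu_sum mu_pos finite_row P_mean P_mean2 in auto)

lemma mean_row_ge:
  assumes x: "x \<in> {1..n}"
  shows "1 - 8 / L\<^sup>2 \<le> (\<Sum>a\<in>{1..n}. R.mean x a)"
proof -
  let ?B = "{1..n} - {x}"
  have s: "m x / c \<le> sum (p x) ?B" by (rule sum_p_ge[OF x, of _ x x]) auto
  have mc: "0 < m x / c" using m_bounds[OF x] c_bounds by simp
  have "(\<Sum>a\<in>{1..n}. P x r a) = of_bool (num_true {1..n} r \<noteq> 0)" for r
  proof -
    have "(\<Sum>a\<in>{1..n}. P x r a) = (\<Sum>a\<in>{a \<in> {1..n}. r a}. 1 / real (num_true {1..n} r))"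
      by (intro sum.mono_neutral_cong_right) (auto simp: P_def)
    then show ?thesis by (simp add: num_true_def)
  qed
  then have "(\<Sum>a\<in>{1..n}. R.mean x a) = measure_pmf.expectation (row x) (\<lambda>r. of_bool (num_true {1..n} r \<noteq> 0))"
    unfolding R.mean_def
    by (subst Bochner_Integration.integral_sum[symmetric]) (auto intro: integrable_measure_pmf_finite finite_row)
  also have "\<dots> = expect_bits (p x) ?B (\<lambda>r. of_bool (num_true ?B r \<noteq> 0))"
    by (rule expectation_row) (simp add: num_true_row del: One_nat_def)
  finally have eq: "(\<Sum>a\<in>{1..n}. R.mean x a) = expect_bits (p x) ?B (\<lambda>r. of_bool (num_true ?B r \<noteq> 0))" .
  have "expect_bits (p x) ?B (\<lambda>r. 1 + (-2) * (1 / ((1 + real (num_true ?B r)) * (2 + real (num_true ?B r)))))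
     \<le> expect_bits (p x) ?B (\<lambda>r. of_bool (num_true ?B r \<noteq> 0))"
    by (intro expect_bits_mono[where p = "p x", OF p01]) auto
  then have le: "1 - 2 * expect_bits (p x) ?B (\<lambda>r. 1 / ((1 + real (num_true ?B r)) * (2 + real (num_true ?B r))))
     \<le> expect_bits (p x) ?B (\<lambda>r. of_bool (num_true ?B r \<noteq> 0))"
    unfolding expect_bits_add[where p = "p x", OF p01 finite_Diff[OF finite_atLeastAtMost]] expect_bits_cmult[where p = "p x", OF p01] expect_bits_const[where p = "p x", OF p01] by simp
  have "expect_bits (p x) ?B (\<lambda>r. 1 / ((1 + real (num_true ?B r)) * (2 + real (num_true ?B r)))) \<le> 1 / (sum (p x) ?B)\<^sup>2"
    using s mc by (intro expect_bits_inverse_Suc_Suc[where p = "p x", OF p01]) auto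
  also have "1 / (sum (p x) ?B)\<^sup>2 \<le> 1 / (L / 2)\<^sup>2"
  proof -
    have "L * 1 / 2 \<le> m x / c"
    proof (intro frac_le)
      have "1 * L \<le> M0\<^sup>2 * L" using M0 L_pos by (intro mult_right_mono) auto
      then show "L * 1 \<le> m x" using m_bounds(1)[OF x] by linarith
    qed (use L_pos c_bounds m_bounds[OF x] in auto)
    with s have "L / 2 \<le> sum (p x) ?B" by linarith
    then show ?thesis using L_pos by (intro divide_left_mono power_mono) auto
  qed
  finally show ?thesis using eq le by (simp add: power_divide)
qed

end

lemma prob_le_expectation:
  fixes f :: "'a \<Rightarrow> real"
  assumes "finite (set_pmf N)" "\<And>x. x \<in> set_pmf N \<Longrightarrow> 0 \<le> f x" "\<And>x. x \<in> set_pmf N \<Longrightarrow> x \<in> A \<Longrightarrow> 1 \<le> f x"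
  shows "measure_pmf.prob N A \<le> measure_pmf.expectation N f"
proof -
  have "measure_pmf.prob N A = measure_pmf.expectation N (indicator A)" by simp
  also have "\<dots> \<le> measure_pmf.expectation N f"
    using assms by (intro expectation_mono_finite) (auto simp: indicator_def)
  finally show ?thesis .
qed

lemma prob_Pi_pmf_row:
  assumes A: "finite A" "x \<in> A" and B: "0 \<le> B"
    and le: "\<And>f. measure_pmf.prob (p x) {r. fun_upd f x r \<in> S} \<le> B"
  shows "measure_pmf.prob (Pi_pmf A d p) S \<le> B"
proof -
  have "Pi_pmf A d p = Pi_pmf (insert x (A - {x})) d p" using A by (simp add: insert_absorb)
  also have "\<dots> = bind_pmf (Pi_pmf (A - {x}) d p) (\<lambda>f. map_pmf (\<lambda>r. fun_upd f x r) (p x))"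
    using A by (subst Pi_pmf_insert') (auto simp: map_pmf_def bind_commute_pmf[of "p x"])
  finally have "emeasure (Pi_pmf A d p) S
     = (\<integral>\<^sup>+f. emeasure (map_pmf (\<lambda>r. fun_upd f x r) (p x)) S \<partial>Pi_pmf (A - {x}) d p)"
    by simp
  also have "\<dots> \<le> (\<integral>\<^sup>+f. ennreal B \<partial>Pi_pmf (A - {x}) d p)"
    using le by (intro nn_integral_mono) (auto simp: measure_pmf.emeasure_eq_measure vimage_def intro!: ennreal_leI)
  also have "\<dots> = ennreal B" by simp
  finally show ?thesis using B by (simp add: measure_pmf.emeasure_eq_measure)
qed

context chung_lu_model
begin

lemma row_chernoff:
  assumes x: "x \<in> {1..n}" and S: "\<And>z. 0 \<le> S z \<and> S z \<le> 1" and \<sigma>: "(\<Sum>z\<in>{1..n}. \<mu> z * S z) \<le> \<sigma>"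
    and lam: "0 \<le> lam" and \<epsilon>: "0 < \<epsilon>"
  shows "measure_pmf.prob (row x) {r. 0 \<le> (\<Sum>z\<in>{1..n} - {x}. of_bool (r z) * (S z - \<epsilon>))}
    \<le> exp (- (L * (M0\<^sup>2 / c * (1 - exp (- lam * \<epsilon>)) - exp lam * M1\<^sup>2 * \<sigma>)))"
proof -
  let ?B = "{1..n} - {x}"
  let ?e = "1 - exp (- lam * \<epsilon>)"
  have e: "0 \<le> ?e" using lam \<epsilon> by simp
  have "measure_pmf.prob (row x) {r. 0 \<le> (\<Sum>z\<in>?B. of_bool (r z) * (S z - \<epsilon>))}
    \<le> measure_pmf.expectation (row x) (\<lambda>r. exp (\<Sum>z\<in>?B. lam * (S z - \<epsilon>) * of_bool (r z)))"
  proof (intro prob_le_expectation finite_row)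
    fix r assume "r \<in> {r. 0 \<le> (\<Sum>z\<in>?B. of_bool (r z) * (S z - \<epsilon>))}"
    then have "0 \<le> lam * (\<Sum>z\<in>?B. of_bool (r z) * (S z - \<epsilon>))" using lam by simp
    also have "\<dots> = (\<Sum>z\<in>?B. lam * (S z - \<epsilon>) * of_bool (r z))"
      unfolding sum_distrib_left by (simp only: mult_ac)
    finally show "1 \<le> exp (\<Sum>z\<in>?B. lam * (S z - \<epsilon>) * of_bool (r z))" by (simp only: one_le_exp_iff)
  qed simp
  also have "\<dots> = expect_bits (p x) ?B (\<lambda>r. exp (\<Sum>z\<in>?B. lam * (S z - \<epsilon>) * of_bool (r z)))"
    by (rule expectation_row) simp
  also have "\<dots> \<le> exp (\<Sum>z\<in>?B. p x z * (exp (lam * (S z - \<epsilon>)) - 1))"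
    by (intro expect_bits_exp[where p = "p x", OF p01]) simp
  also have "\<dots> \<le> exp (- (L * (M0\<^sup>2 / c * ?e - exp lam * M1\<^sup>2 * \<sigma>)))"
  proof (subst exp_le_cancel_iff)
    have "exp (lam * (S z - \<epsilon>)) - 1 \<le> S z * exp lam - ?e" for z
    proof -
      have "exp ((1 - S z) *\<^sub>R 0 + S z *\<^sub>R lam) \<le> (1 - S z) * exp 0 + S z * exp lam"
        using S[of z] by (intro convex_onD[OF exp_convex]) auto
      then have "exp (lam * S z) \<le> 1 + S z * exp lam" using S[of z] by (simp add: mult.commute)
      then have "exp (- lam * \<epsilon>) * exp (lam * S z) \<le> exp (- lam * \<epsilon>) * (1 + S z * exp lam)"
        by (intro mult_left_mono) auto
      also have "\<dots> \<le> exp (- lam * \<epsilon>) + 1 * (S z * exp lam)"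
        using S[of z] e by (simp add: distrib_left) (intro mult_left_le_one_le mult_nonneg_nonneg; simp)
      finally show ?thesis by (simp add: algebra_simps flip: exp_add)
    qed
    then have "(\<Sum>z\<in>?B. p x z * (exp (lam * (S z - \<epsilon>)) - 1)) \<le> (\<Sum>z\<in>?B. p x z * (S z * exp lam - ?e))"
      using p01[of x] by (intro sum_mono mult_left_mono) auto
    also have "\<dots> = exp lam * (\<Sum>z\<in>?B. p x z * S z) - ?e * sum (p x) ?B"
      unfolding sum_distrib_left sum_subtractf[symmetric] by (intro sum.cong) (auto simp: algebra_simps)
    also have "\<dots> \<le> exp lam * (M1\<^sup>2 * L * \<sigma>) - ?e * (M0\<^sup>2 * L / c)"
    proof (intro diff_mono mult_left_mono)
      have "M0\<^sup>2 * L / c \<le> m x / c" using m_bounds[OF x] c_bounds by (intro divide_right_mono) auto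
      also have "\<dots> \<le> sum (p x) ?B" by (rule sum_p_ge[OF x, of _ x x]) auto
      finally show "M0\<^sup>2 * L / c \<le> sum (p x) ?B" .
      have "(\<Sum>z\<in>?B. p x z * S z) \<le> (\<Sum>z\<in>{1..n}. p x z * S z)"
        using p01 S by (intro sum_mono2) auto
      also have "\<dots> = m x * (\<Sum>z\<in>{1..n}. \<mu> z * S z)"
        unfolding sum_distrib_left using x by (intro sum.cong refl) (simp add: p_eq del: One_nat_def)
      also have "\<dots> \<le> m x * \<sigma>" using \<sigma> m_bounds[OF x] by (intro mult_left_mono) auto
      also have "\<dots> \<le> M1\<^sup>2 * L * \<sigma>"
      proof (intro mult_right_mono m_bounds x)
        have "0 \<le> (\<Sum>z\<in>{1..n}. \<mu> z * S z)" using mu_nonneg S by (intro sum_nonneg mult_nonneg_nonneg) auto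
        then show "0 \<le> \<sigma>" using \<sigma> by linarith
      qed
      finally show "(\<Sum>z\<in>?B. p x z * S z) \<le> M1\<^sup>2 * L * \<sigma>" .
    qed (use e in auto)
    also have "\<dots> = - (L * (M0\<^sup>2 / c * ?e - exp lam * M1\<^sup>2 * \<sigma>))" by (simp add: algebra_simps)
    finally show "(\<Sum>z\<in>?B. p x z * (exp (lam * (S z - \<epsilon>)) - 1)) \<le> - (L * (M0\<^sup>2 / c * ?e - exp lam * M1\<^sup>2 * \<sigma>))" .
  qed
  finally show ?thesis .
qed

lemma row_degree_tail:
  assumes x: "x \<in> {1..n}"
  shows "measure_pmf.prob (row x) {r. K \<le> real (num_true {1..n} r)} \<le> exp (2 * M1\<^sup>2 * L - K)"
proof -
  let ?B = "{1..n} - {x}"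
  have "measure_pmf.prob (row x) {r. K \<le> real (num_true {1..n} r)}
     \<le> measure_pmf.expectation (row x) (\<lambda>r. exp (- K) * exp (real (num_true {1..n} r)))"
    by (intro prob_le_expectation finite_row) (auto simp flip: exp_add)
  also have "\<dots> = expect_bits (p x) ?B (\<lambda>r. exp (- K) * exp (\<Sum>z\<in>?B. 1 * of_bool (r z)))"
    by (rule expectation_row) (simp only: num_true_row num_true_sum[OF finite_Diff[OF finite_atLeastAtMost]] mult_1)
  also have "\<dots> \<le> exp (- K) * exp (\<Sum>z\<in>?B. p x z * (exp 1 - 1))"
    unfolding expect_bits_cmult[where p = "p x", OF p01]
    by (intro mult_left_mono expect_bits_exp[where p = "p x", OF p01]) auto
  also have "\<dots> \<le> exp (- K) * exp (2 * M1\<^sup>2 * L)"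
  proof (intro mult_left_mono, subst exp_le_cancel_iff)
    have "(\<Sum>z\<in>?B. p x z * (exp 1 - 1)) \<le> (\<Sum>z\<in>?B. p x z * 2)"
      using exp_le p01 by (intro sum_mono mult_left_mono) auto
    also have "\<dots> = sum (p x) ?B * 2" by (simp only: sum_distrib_right)
    also have "\<dots> \<le> m x * 2" by (intro mult_right_mono sum_p_le x) auto
    finally show "(\<Sum>z\<in>?B. p x z * (exp 1 - 1)) \<le> 2 * M1\<^sup>2 * L" using m_bounds(2)[OF x] by simp
  qed simp
  finally show ?thesis by (simp add: exp_add[symmetric] add.commute)
qed

definition dev :: "nat \<Rightarrow> real \<Rightarrow> nat \<Rightarrow> (nat \<Rightarrow> nat \<Rightarrow> bool) \<Rightarrow> real" where
  "dev t \<epsilon> x \<omega> = (\<Sum>z\<in>{1..n} - {x}. of_bool (\<omega> x z) * (R.deficit t \<omega> {x} z - \<epsilon>))"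

definition good :: "nat \<Rightarrow> real \<Rightarrow> real \<Rightarrow> (nat \<Rightarrow> nat \<Rightarrow> bool) \<Rightarrow> bool" where
  "good t \<epsilon> K \<omega> \<longleftrightarrow> (\<forall>x\<in>{1..n}. dev t \<epsilon> x \<omega> < 0 \<and> real (num_true {1..n} (\<omega> x)) < K)"

lemma prob_dev:
  assumes x: "x \<in> {1..n}" and lam: "0 \<le> lam" and \<epsilon>: "0 < \<epsilon>"
  shows "measure_pmf.prob R.M {\<omega>. (\<Sum>z\<in>{1..n}. \<mu> z * R.deficit t \<omega> {x} z) \<le> \<sigma> \<and> 0 \<le> dev t \<epsilon> x \<omega>}
    \<le> exp (- (L * (M0\<^sup>2 / c * (1 - exp (- lam * \<epsilon>)) - exp lam * M1\<^sup>2 * \<sigma>)))"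
  unfolding R.M_def
proof (rule prob_Pi_pmf_row[OF _ x])
  fix f
  let ?S = "R.deficit t f {x}"
  show "measure_pmf.prob (row x) {r. fun_upd f x r \<in> {\<omega>. (\<Sum>z\<in>{1..n}. \<mu> z * R.deficit t \<omega> {x} z) \<le> \<sigma> \<and> 0 \<le> dev t \<epsilon> x \<omega>}}
    \<le> exp (- (L * (M0\<^sup>2 / c * (1 - exp (- lam * \<epsilon>)) - exp lam * M1\<^sup>2 * \<sigma>)))"
  proof (cases "(\<Sum>z\<in>{1..n}. \<mu> z * ?S z) \<le> \<sigma>")
    case True
    have "{r. fun_upd f x r \<in> {\<omega>. (\<Sum>z\<in>{1..n}. \<mu> z * R.deficit t \<omega> {x} z) \<le> \<sigma> \<and> 0 \<le> dev t \<epsilon> x \<omega>}}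
      = {r. 0 \<le> (\<Sum>z\<in>{1..n} - {x}. of_bool (r z) * (?S z - \<epsilon>))}"
      using True by (simp add: dev_def R.deficit_upd del: One_nat_def)
    then show ?thesis using row_chernoff[OF x _ True lam \<epsilon>] R.deficit_bounds by simp
  next
    case False
    then show ?thesis by (simp add: R.deficit_upd del: One_nat_def)
  qed
qed auto

lemma prob_not_good:
  assumes lam: "0 \<le> lam" and \<epsilon>: "0 < \<epsilon>" and \<sigma>: "0 < \<sigma>"
    and E1: "measure_pmf.expectation R.M (\<lambda>\<omega>. \<Sum>z\<in>{1..n}. \<mu> z * R.deficit t \<omega> {} z) \<le> e1"
    and E2: "measure_pmf.expectation R.M (\<lambda>\<omega>. \<Sum>x\<in>{1..n}. (R.through t \<omega> x)\<^sup>2) \<le> e2"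
  shows "measure_pmf.prob R.M {\<omega>. \<not> good t \<epsilon> K \<omega>}
    \<le> real n * exp (- (L * (M0\<^sup>2 / c * (1 - exp (- lam * \<epsilon>)) - exp lam * M1\<^sup>2 * \<sigma>)))
      + real n * exp (2 * M1\<^sup>2 * L - K) + e1 * (2 / \<sigma>) + e2 * (2 / \<sigma>)\<^sup>2"
proof -
  let ?s = "\<lambda>\<omega>. \<Sum>z\<in>{1..n}. \<mu> z * R.deficit t \<omega> {} z"
  let ?r = "\<lambda>\<omega>. \<Sum>x\<in>{1..n}. (R.through t \<omega> x)\<^sup>2"
  let ?A = "\<lambda>x. {\<omega>. (\<Sum>z\<in>{1..n}. \<mu> z * R.deficit t \<omega> {x} z) \<le> \<sigma> \<and> 0 \<le> dev t \<epsilon> x \<omega>}"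
  let ?D = "\<lambda>x. {\<omega>. K \<le> real (num_true {1..n} (\<omega> x))}"
  let ?F = "{\<omega>. \<sigma> / 2 \<le> ?s \<omega>}" and ?G = "{\<omega>. (\<sigma> / 2)\<^sup>2 \<le> ?r \<omega>}"
  have "{\<omega>. \<not> good t \<epsilon> K \<omega>} \<subseteq> (\<Union>x\<in>{1..n}. ?A x) \<union> (\<Union>x\<in>{1..n}. ?D x) \<union> ?F \<union> ?G"
  proof
    fix \<omega> assume "\<omega> \<in> {\<omega>. \<not> good t \<epsilon> K \<omega>}"
    then obtain x where x: "x \<in> {1..n}" and bad: "0 \<le> dev t \<epsilon> x \<omega> \<or> K \<le> real (num_true {1..n} (\<omega> x))"
      by (auto simp: good_def not_less simp del: One_nat_def)
    show "\<omega> \<in> (\<Union>x\<in>{1..n}. ?A x) \<union> (\<Union>x\<in>{1..n}. ?D x) \<union> ?F \<union> ?G"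
    proof (rule ccontr)
      assume no: "\<omega> \<notin> (\<Union>x\<in>{1..n}. ?A x) \<union> (\<Union>x\<in>{1..n}. ?D x) \<union> ?F \<union> ?G"
      then have s: "?s \<omega> < \<sigma> / 2" and r: "?r \<omega> < (\<sigma> / 2)\<^sup>2" by (auto simp: not_le simp del: One_nat_def)
      have "(R.through t \<omega> x)\<^sup>2 \<le> ?r \<omega>" using x by (intro member_le_sum) auto
      with r have "(R.through t \<omega> x)\<^sup>2 < (\<sigma> / 2)\<^sup>2" by linarith
      then have "R.through t \<omega> x < \<sigma> / 2" by (rule power_less_imp_less_base) (use \<sigma> in auto)
      with s R.deficit_avoiding[of t \<omega> x] have "(\<Sum>z\<in>{1..n}. \<mu> z * R.deficit t \<omega> {x} z) \<le> \<sigma>" by linarith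
      with no bad x show False by (auto simp del: One_nat_def)
    qed
  qed
  then have "measure_pmf.prob R.M {\<omega>. \<not> good t \<epsilon> K \<omega>}
    \<le> measure_pmf.prob R.M ((\<Union>x\<in>{1..n}. ?A x) \<union> (\<Union>x\<in>{1..n}. ?D x) \<union> ?F \<union> ?G)"
    by (intro measure_pmf.finite_measure_mono) auto
  also have "\<dots> \<le> measure_pmf.prob R.M (\<Union>x\<in>{1..n}. ?A x) + measure_pmf.prob R.M (\<Union>x\<in>{1..n}. ?D x)
      + measure_pmf.prob R.M ?F + measure_pmf.prob R.M ?G"
    by (intro order_trans[OF measure_Un_le] add_mono order_refl) auto
  also have "measure_pmf.prob R.M (\<Union>x\<in>{1..n}. ?A x) \<le> (\<Sum>x\<in>{1..n}. measure_pmf.prob R.M (?A x))"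
    by (intro measure_pmf.finite_measure_subadditive_finite) auto
  also have "\<dots> \<le> (\<Sum>x\<in>{1..n}. exp (- (L * (M0\<^sup>2 / c * (1 - exp (- lam * \<epsilon>)) - exp lam * M1\<^sup>2 * \<sigma>))))"
    by (intro sum_mono prob_dev lam \<epsilon>)
  also have "\<dots> = real n * exp (- (L * (M0\<^sup>2 / c * (1 - exp (- lam * \<epsilon>)) - exp lam * M1\<^sup>2 * \<sigma>)))"
    by simp
  also have "measure_pmf.prob R.M (\<Union>x\<in>{1..n}. ?D x) \<le> (\<Sum>x\<in>{1..n}. measure_pmf.prob R.M (?D x))"
    by (intro measure_pmf.finite_measure_subadditive_finite) auto
  also have "\<dots> \<le> (\<Sum>x\<in>{1..n}. exp (2 * M1\<^sup>2 * L - K))"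
  proof (intro sum_mono)
    fix x assume x: "x \<in> {1..n}"
    show "measure_pmf.prob R.M (?D x) \<le> exp (2 * M1\<^sup>2 * L - K)"
      unfolding R.M_def
      by (rule prob_Pi_pmf_row[OF _ x]) (use row_degree_tail[OF x] in auto)
  qed
  also have "\<dots> = real n * exp (2 * M1\<^sup>2 * L - K)" by simp
  also have "measure_pmf.prob R.M ?F \<le> measure_pmf.expectation R.M (\<lambda>\<omega>. ?s \<omega> * (2 / \<sigma>))"
    using \<sigma> mu_nonneg R.deficit_bounds
    by (intro prob_le_expectation R.finite_M mult_nonneg_nonneg sum_nonneg) (auto simp: field_simps)
  also have "\<dots> \<le> e1 * (2 / \<sigma>)" using E1 \<sigma> by (simp add: divide_right_mono)
  also have "measure_pmf.prob R.M ?G \<le> measure_pmf.expectation R.M (\<lambda>\<omega>. ?r \<omega> * (2 / \<sigma>)\<^sup>2)"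
    using \<sigma> by (intro prob_le_expectation R.finite_M mult_nonneg_nonneg sum_nonneg) (auto simp: field_simps)
  also have "\<dots> \<le> e2 * (2 / \<sigma>)\<^sup>2" using E2 \<sigma> by (simp add: divide_right_mono)
  finally show ?thesis by simp
qed

lemma chung_lu_rows: "chung_lu n wp wm = map_pmf case_prod R.M"
proof (rule pmf_eqI)
  fix G :: digraph
  have inj: "inj (case_prod :: (nat \<Rightarrow> nat \<Rightarrow> bool) \<Rightarrow> _)"
    by (rule injI) (metis curry_case_prod)
  have G: "G = case_prod (curry G)" by simp
  have arc: "arc_pairs n = (SIGMA x:{1..n}. {1..n} - {x})"
    by (auto simp: arc_pairs_def)
  have e: "edge_prob n wp wm x y = p x y" if "x \<in> {1..n}" "y \<in> {1..n}" for x y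
    using that untruncated[of x y] by (simp add: edge_prob_def p_def L_def)
  have fin: "finite (arc_pairs n)" unfolding arc by auto
  let ?ok = "\<forall>x y. (x, y) \<notin> arc_pairs n \<longrightarrow> \<not> G (x, y)"
  have "pmf (chung_lu n wp wm) G = (if ?ok then
      \<Prod>(x, y)\<in>arc_pairs n. pmf (bernoulli_pmf (edge_prob n wp wm x y)) (G (x, y)) else 0)"
  proof -
    have "(\<forall>e. e \<notin> arc_pairs n \<longrightarrow> G e = False) \<longleftrightarrow> ?ok" by auto
    then show ?thesis
      unfolding chung_lu_def pmf_Pi[OF fin] by (intro if_cong prod.cong) auto
  qed
  also have "(\<Prod>(x, y)\<in>arc_pairs n. pmf (bernoulli_pmf (edge_prob n wp wm x y)) (G (x, y)))
     = (\<Prod>x\<in>{1..n}. \<Prod>y\<in>{1..n} - {x}. pmf (bernoulli_pmf (p x y)) (G (x, y)))"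
    unfolding arc by (subst prod.Sigma[symmetric]) (auto intro!: prod.cong simp: e simp del: One_nat_def)
  also have "(if ?ok then \<dots> else 0) = pmf R.M (curry G)"
  proof (cases ?ok)
    case True
    have "\<forall>x. x \<notin> {1..n} \<longrightarrow> curry G x = (\<lambda>_. False)"
      using True by (auto simp: arc curry_def fun_eq_iff)
    moreover have "pmf (row x) (curry G x) = (\<Prod>y\<in>{1..n} - {x}. pmf (bernoulli_pmf (p x y)) (G (x, y)))" for x
      using True unfolding row_def by (subst pmf_Pi) (auto simp: arc)
    ultimately show ?thesis using True unfolding R.M_def by (subst pmf_Pi) auto
  next
    case False
    then obtain x y where xy: "(x, y) \<notin> arc_pairs n" "G (x, y)" by auto
    show ?thesis
    proof (cases "x \<in> {1..n}")
      case x: True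
      then have "pmf (row x) (curry G x) = 0"
        using xy unfolding row_def by (subst pmf_Pi) (auto simp: arc)
      then have "(\<Prod>x\<in>{1..n}. pmf (row x) (curry G x)) = 0" using x by (intro prod_zero) auto
      then show ?thesis using False unfolding R.M_def by (subst pmf_Pi) auto
    next
      case x: False
      then have "\<not> (\<forall>x. x \<notin> {1..n} \<longrightarrow> curry G x = (\<lambda>_. False))"
        using xy by (auto simp: fun_eq_iff)
      then show ?thesis using False unfolding R.M_def by (subst pmf_Pi) auto
    qed
  qed
  also have "\<dots> = pmf (map_pmf case_prod R.M) G"
    by (subst (2) G, rule pmf_map_inj'[OF inj, symmetric])
  finally show "pmf (chung_lu n wp wm) G = pmf (map_pmf case_prod R.M) G" .
qed

lemma outdeg_case_prod: "outdeg n (case_prod \<omega>) x = num_true {1..n} (\<omega> x)"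
  by (simp add: outdeg_def num_true_def)

lemma expectation_outdeg:
  assumes x: "x \<in> {1..n}"
  shows "measure_pmf.expectation (chung_lu n wp wm) (\<lambda>G. f (outdeg n G x)) =
    expect_bits (p x) ({1..n} - {x}) (\<lambda>r. f (num_true ({1..n} - {x}) r))"
proof -
  have "map_pmf (\<lambda>\<omega>. \<omega> x) R.M = row x"
    using x unfolding R.M_def by (subst Pi_pmf_component) auto
  then have "measure_pmf.expectation (row x) (\<lambda>r. f (num_true {1..n} r))
    = measure_pmf.expectation (map_pmf (\<lambda>\<omega>. \<omega> x) R.M) (\<lambda>r. f (num_true {1..n} r))" by simp
  also have "\<dots> = measure_pmf.expectation (chung_lu n wp wm) (\<lambda>G. f (outdeg n G x))"
    unfolding chung_lu_rows integral_map_pmf outdeg_case_prod ..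
  finally show ?thesis using expectation_row[of x "\<lambda>r. f (num_true {1..n} r)"] num_true_row by auto
qed

lemma entropy_upper: "entropy_H n wp wm \<le> ln (1 + M1\<^sup>2 * L)"
proof -
  have le: "measure_pmf.expectation (chung_lu n wp wm) (\<lambda>G. ln (real (max (outdeg n G x) 1))) \<le> ln (1 + M1\<^sup>2 * L)"
    if x: "x \<in> {1..n}" for x
  proof -
    let ?B = "{1..n} - {x}"
    define a where "a = 1 + m x"
    have a: "1 < a" using m_bounds[OF x] by (simp add: a_def)
    have pt: "ln (real (max k 1)) \<le> (ln a + 1 / a - 1) + 1 / a * real k" for k
    proof -
      have "ln (real (max k 1)) \<le> ln (a * ((1 + real k) / a))" using a by (subst ln_le_cancel_iff) auto
      also have "\<dots> = ln a + ln ((1 + real k) / a)" using a by (subst ln_mult_pos) auto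
      also have "\<dots> \<le> ln a + ((1 + real k) / a - 1)" using a by (intro add_left_mono ln_le_minus_one) auto
      finally show ?thesis by (simp add: add_divide_distrib)
    qed
    have "measure_pmf.expectation (chung_lu n wp wm) (\<lambda>G. ln (real (max (outdeg n G x) 1)))
       = expect_bits (p x) ?B (\<lambda>r. ln (real (max (num_true ?B r) 1)))"
      by (rule expectation_outdeg[OF x])
    also have "\<dots> \<le> expect_bits (p x) ?B (\<lambda>r. (ln a + 1 / a - 1) + 1 / a * real (num_true ?B r))"
      by (intro expect_bits_mono[where p = "p x", OF p01] pt) simp
    also have "\<dots> = (ln a + 1 / a - 1) + 1 / a * expect_bits (p x) ?B (\<lambda>r. real (num_true ?B r))"
      unfolding expect_bits_add[where p = "p x", OF p01 finite_Diff[OF finite_atLeastAtMost]]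
        expect_bits_cmult[where p = "p x", OF p01] expect_bits_const[where p = "p x", OF p01] ..
    also have "expect_bits (p x) ?B (\<lambda>r. real (num_true ?B r)) = sum (p x) ?B"
      unfolding num_true_sum[OF finite_Diff[OF finite_atLeastAtMost]]
        expect_bits_sum[where p = "p x", OF p01 finite_Diff[OF finite_atLeastAtMost]]
      using expect_bits_single[where p = "p x" and f = "\<lambda>_. 1", OF p01] by (simp add: expect_bits_const[where p = "p x", OF p01])
    also have "1 / a * sum (p x) ?B \<le> 1 / a * m x"
      using a by (intro mult_left_mono sum_p_le x) auto
    also have "(ln a + 1 / a - 1) + 1 / a * m x = ln a"
    proof -
      have "1 / a + 1 / a * m x = (1 + m x) / a" by (simp add: add_divide_distrib)
      also have "\<dots> = 1" using a by (simp add: a_def)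
      finally show ?thesis by linarith
    qed
    also have "\<dots> \<le> ln (1 + M1\<^sup>2 * L)" using m_bounds[OF x] a by (subst ln_le_cancel_iff) (auto simp: a_def)
    finally show ?thesis by simp
  qed
  have "entropy_H n wp wm \<le> (\<Sum>x\<in>{1..n}. \<mu> x * ln (1 + M1\<^sup>2 * L))"
    unfolding entropy_H_def
  proof (intro sum_mono)
    fix x assume x: "x \<in> {1..n}"
    show "mu_in n wm x * measure_pmf.expectation (chung_lu n wp wm) (\<lambda>G. ln (real (max (outdeg n G x) 1)))
       \<le> \<mu> x * ln (1 + M1\<^sup>2 * L)"
      using le[OF x] x mu_nonneg[of x] by (auto simp: \<mu>_def intro!: mult_left_mono simp del: One_nat_def)
  qed
  then show ?thesis by (simp only: mu_sum mult_1 flip: sum_distrib_right)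
qed

lemma entropy_lower: "ln (L / 2) - 1 \<le> entropy_H n wp wm"
proof -
  have le: "ln (L / 2) - 1 \<le> measure_pmf.expectation (chung_lu n wp wm) (\<lambda>G. ln (real (max (outdeg n G x) 1)))"
    if x: "x \<in> {1..n}" for x
  proof -
    let ?B = "{1..n} - {x}"
    define a where "a = L / 2"
    have a: "0 < a" using L_pos by (simp add: a_def)
    have s: "a \<le> sum (p x) ?B"
    proof -
      have "1 * L \<le> M0\<^sup>2 * L" using M0 L_pos by (intro mult_right_mono) auto
      then have "L \<le> m x" using m_bounds(1)[OF x] by linarith
      then have "L / 2 \<le> m x / c" using m_bounds[OF x] c_bounds L_pos by (intro frac_le) auto
      also have "\<dots> \<le> sum (p x) ?B" by (rule sum_p_ge[OF x, of _ x x]) auto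
      finally show ?thesis by (simp add: a_def)
    qed
    have pt: "(ln a + 1) + (- 2 * a) * (1 / (1 + real k)) \<le> ln (real (max k 1))" for k
    proof -
      let ?k = "real (max k 1)"
      have "ln (a / ?k) \<le> a / ?k - 1" using a by (intro ln_le_minus_one) auto
      moreover have "ln (a / ?k) = ln a - ln ?k" using a by (subst ln_div) auto
      moreover have "a / ?k \<le> 2 * a * (1 / (1 + real k))" using a by (auto simp: divide_simps max_def)
      ultimately show ?thesis by linarith
    qed
    have "expect_bits (p x) ?B (\<lambda>r. 1 / (1 + real (num_true ?B r))) \<le> 1 / sum (p x) ?B"
      using s a by (intro expect_bits_inverse_Suc[where p = "p x", OF p01]) auto
    also have "\<dots> \<le> 1 / a" using s a by (intro divide_left_mono) auto
    finally have inv: "2 * a * expect_bits (p x) ?B (\<lambda>r. 1 / (1 + real (num_true ?B r))) \<le> 2"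
      using a by (simp add: field_simps)
    have "ln a - 1 \<le> (ln a + 1) + (- 2 * a) * expect_bits (p x) ?B (\<lambda>r. 1 / (1 + real (num_true ?B r)))"
      using inv by linarith
    also have "\<dots> = expect_bits (p x) ?B (\<lambda>r. (ln a + 1) + (- 2 * a) * (1 / (1 + real (num_true ?B r))))"
      unfolding expect_bits_add[where p = "p x", OF p01 finite_Diff[OF finite_atLeastAtMost]]
        expect_bits_cmult[where p = "p x", OF p01] expect_bits_const[where p = "p x", OF p01] ..
    also have "\<dots> \<le> expect_bits (p x) ?B (\<lambda>r. ln (real (max (num_true ?B r) 1)))"
      by (intro expect_bits_mono[where p = "p x", OF p01] pt) simp
    also have "\<dots> = measure_pmf.expectation (chung_lu n wp wm) (\<lambda>G. ln (real (max (outdeg n G x) 1)))"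
      by (rule expectation_outdeg[OF x, symmetric])
    finally show ?thesis by (simp add: a_def)
  qed
  have "(\<Sum>x\<in>{1..n}. \<mu> x * (ln (L / 2) - 1)) \<le> entropy_H n wp wm"
    unfolding entropy_H_def
  proof (intro sum_mono)
    fix x assume x: "x \<in> {1..n}"
    show "\<mu> x * (ln (L / 2) - 1) \<le> mu_in n wm x *
        measure_pmf.expectation (chung_lu n wp wm) (\<lambda>G. ln (real (max (outdeg n G x) 1)))"
      using le[OF x] x mu_nonneg[of x] by (auto simp: \<mu>_def intro!: mult_left_mono simp del: One_nat_def)
  qed
  then show ?thesis by (simp only: mu_sum mult_1 flip: sum_distrib_right)
qed

lemma ker_trans_mat: "R.ker \<omega> = trans_mat n (case_prod \<omega>)"
  by (intro ext) (simp add: R.ker_def P_def trans_mat_def outdeg_case_prod del: One_nat_def)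

lemma T_le_trans_pow:
  assumes z: "z \<in> {1..n}" and y: "y \<in> {1..n}"
  shows "R.T t \<omega> A z y \<le> trans_pow n (case_prod \<omega>) t z y"
proof -
  have "R.T t \<omega> A z y \<le> (\<Sum>l\<in>paths {1..n} t. of_bool (z = last l) * path_weight (R.ker \<omega>) l * of_bool (hd l = y))"
  proof -
    have "R.T t \<omega> A z y \<le> (\<Sum>l\<in>R.simple_paths t. of_bool (z = last l) * path_weight (R.ker \<omega>) l * of_bool (hd l = y))"
      unfolding R.T_def using R.pw_ker_nonneg by (intro sum_mono) auto
    also have "\<dots> \<le> (\<Sum>l\<in>paths {1..n} t. of_bool (z = last l) * path_weight (R.ker \<omega>) l * of_bool (hd l = y))"
      using R.pw_ker_nonneg
      by (intro sum_mono2 mult_nonneg_nonneg) (auto simp: R.simple_paths_def simp del: One_nat_def)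
    finally show ?thesis .
  qed
  also have "\<dots> = walk {1..n} (\<lambda>a. of_bool (z = a)) (R.ker \<omega>) t y"
    unfolding sum_path_weight[of "\<lambda>a. of_bool (z = a)" _ "\<lambda>a. of_bool (a = y)"]
    using y by (simp add: of_bool_def if_distrib cong: if_cong del: One_nat_def)
  also have "\<dots> = trans_pow n (case_prod \<omega>) t z y"
    unfolding ker_trans_mat by (rule trans_pow_walk[OF z y])
  finally show ?thesis .
qed

lemma good_imp:
  assumes \<omega>: "\<omega> \<in> set_pmf R.M" and good: "good t \<epsilon> K \<omega>" and x: "x \<in> {1..n}"
  shows "outdeg n (case_prod \<omega>) x \<noteq> 0" "real (outdeg n (case_prod \<omega>) x) \<le> K"
    "tv_dist n (trans_pow n (case_prod \<omega>) (Suc t) x) \<mu> \<le> \<epsilon>"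
proof -
  let ?G = "case_prod \<omega>"
  have dev: "dev t \<epsilon> y \<omega> < 0" if "y \<in> {1..n}" for y using good that by (simp add: good_def del: One_nat_def)
  have \<omega>x: "\<omega> x \<in> set_pmf (row x)"
    using \<omega> x unfolding R.M_def by (auto simp: set_Pi_pmf PiE_dflt_def simp del: One_nat_def)
  have deg: "outdeg n ?G y \<noteq> 0" if y: "y \<in> {1..n}" for y
  proof
    assume "outdeg n ?G y = 0"
    then have "\<forall>z\<in>{1..n}. \<not> \<omega> y z" by (auto simp: outdeg_def)
    then have "dev t \<epsilon> y \<omega> = 0" unfolding dev_def by (intro sum.neutral) auto
    with dev[OF y] show False by simp
  qed
  then show deg_x: "outdeg n ?G x \<noteq> 0" using x .
  show "real (outdeg n ?G x) \<le> K"
    using good x unfolding good_def outdeg_case_prod by (intro less_imp_le) blast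
  let ?d = "real (outdeg n ?G x)"
  have out: "trans_mat n ?G x z = of_bool (\<omega> x z) / ?d" for z
    by (simp add: trans_mat_def)
  have row1: "(\<Sum>z\<in>{1..n}. trans_mat n ?G x z) = 1"
    using trans_mat_row[of n ?G x] deg_x by simp
  have "tv_dist n (trans_pow n ?G (Suc t) x) \<mu> = (\<Sum>y\<in>{1..n}. max 0 (\<mu> y - trans_pow n ?G (Suc t) x y))"
    by (rule tv_dist_eq_positive_part) (simp only: trans_pow_row[OF deg x] mu_sum)
  also have "\<dots> \<le> (\<Sum>y\<in>{1..n}. \<Sum>z\<in>{1..n}. trans_mat n ?G x z * max 0 (\<mu> y - R.T t \<omega> {x} z y))"
  proof (intro sum_mono)
    fix y assume y: "y \<in> {1..n}"
    have "\<mu> y - trans_pow n ?G (Suc t) x y = (\<Sum>z\<in>{1..n}. trans_mat n ?G x z * (\<mu> y - trans_pow n ?G t z y))"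
      unfolding right_diff_distrib sum_subtractf sum_distrib_right[symmetric] row1 by simp
    also have "\<dots> \<le> (\<Sum>z\<in>{1..n}. trans_mat n ?G x z * max 0 (\<mu> y - R.T t \<omega> {x} z y))"
      using T_le_trans_pow[OF _ y] by (intro sum_mono mult_left_mono trans_mat_nonneg) (auto simp: le_max_iff_disj)
    finally have "\<mu> y - trans_pow n ?G (Suc t) x y \<le> (\<Sum>z\<in>{1..n}. trans_mat n ?G x z * max 0 (\<mu> y - R.T t \<omega> {x} z y))" .
    moreover have "0 \<le> (\<Sum>z\<in>{1..n}. trans_mat n ?G x z * max 0 (\<mu> y - R.T t \<omega> {x} z y))"
      by (intro sum_nonneg mult_nonneg_nonneg trans_mat_nonneg) auto
    ultimately show "max 0 (\<mu> y - trans_pow n ?G (Suc t) x y) \<le> (\<Sum>z\<in>{1..n}. trans_mat n ?G x z * max 0 (\<mu> y - R.T t \<omega> {x} z y))"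
      by simp
  qed
  also have "\<dots> = (\<Sum>z\<in>{1..n}. trans_mat n ?G x z * R.deficit t \<omega> {x} z)"
    unfolding R.deficit_def sum_distrib_left by (rule sum.swap)
  also have "\<dots> = \<epsilon> + (\<Sum>z\<in>{1..n}. trans_mat n ?G x z * (R.deficit t \<omega> {x} z - \<epsilon>))"
    unfolding right_diff_distrib sum_subtractf sum_distrib_right[symmetric] row1 by simp
  also have "(\<Sum>z\<in>{1..n}. trans_mat n ?G x z * (R.deficit t \<omega> {x} z - \<epsilon>))
     = (\<Sum>z\<in>{1..n} - {x}. trans_mat n ?G x z * (R.deficit t \<omega> {x} z - \<epsilon>))"
    using set_row[OF \<omega>x, of x] by (intro sum.mono_neutral_right) (auto simp: trans_mat_def)
  also have "\<dots> = dev t \<epsilon> x \<omega> / ?d"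
    unfolding dev_def out sum_divide_distrib by simp
  also have "\<epsilon> + \<dots> \<le> \<epsilon>" using dev[OF x] by (simp add: divide_nonpos_nonneg)
  finally show "tv_dist n (trans_pow n ?G (Suc t) x) \<mu> \<le> \<epsilon>" .
qed

end

section \<open>Asymptotics\<close>

context chung_lu_model
begin

definition kappa_bound :: "real \<Rightarrow> real" where
  "kappa_bound U = 8 / L\<^sup>2 + 2 * (U + 1) * b"

definition chi_bound :: "real \<Rightarrow> real \<Rightarrow> real \<Rightarrow> real" where
  "chi_bound Q D U = exp (12 * b * U) * (exp (2 / L * U) * (1 + 4 / L * Q) + exp (L - D * ln (L / 2)))
     - 1 + 2 * U * kappa_bound U"

definition through_bound :: "real \<Rightarrow> real" where
  "through_bound U = exp (12 * b * U) * ((U + 1)\<^sup>2 * exp (2 / L * U) * b)"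

context
  fixes t :: nat and D U Q :: real
  assumes t: "0 < t" "D \<le> real t" "real t \<le> U" and L4: "4 \<le> L"
begin

lemma c_power: "c ^ (2 * t) \<le> exp (12 * b * U)"
proof -
  have "c ^ (2 * t) \<le> exp (6 * b) ^ (2 * t)"
    using c_bounds order_trans[OF c_bounds(3) exp_ge_add_one_self[of "6 * b"]] by (intro power_mono) auto
  also have "\<dots> = exp (12 * b * real t)" by (simp flip: exp_of_nat_mult add: mult_ac)
  also have "\<dots> \<le> exp (12 * b * U)" using t b_nonneg by (simp add: mult_left_mono)
  finally show ?thesis .
qed

lemma theta_power: "(1 + 2 / L) ^ t \<le> exp (2 / L * U)"
proof -
  have "(1 + 2 / L) ^ t \<le> exp (2 / L) ^ t"
    using L_pos exp_ge_add_one_self[of "2 / L"] by (intro power_mono) auto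
  also have "\<dots> = exp (2 / L * real t)" by (simp flip: exp_of_nat_mult add: mult_ac)
  also have "\<dots> \<le> exp (2 / L * U)" using t L_pos by (simp add: divide_right_mono)
  finally show ?thesis .
qed

lemma stuck_power: "real n * (2 / L) ^ t \<le> exp (L - D * ln (L / 2))"
proof -
  have "2 / L = exp (- ln (L / 2))" using L_pos by (simp add: exp_minus)
  then have "(2 / L) ^ t = exp (real t * - ln (L / 2))" by (simp only: exp_of_nat_mult)
  moreover have "real n = exp L" using n2 by (simp add: L_def)
  ultimately have "real n * (2 / L) ^ t = exp (L - real t * ln (L / 2))"
    by (simp add: exp_add[symmetric])
  also have "\<dots> \<le> exp (L - D * ln (L / 2))" using t L4 by (simp add: mult_right_mono)
  finally show ?thesis .
qed

lemma expectation_deficit_le: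
  assumes q: "real n * (\<Sum>y\<in>{1..n}. (\<mu> y)\<^sup>2) \<le> Q" and k: "kappa_bound U \<le> 1"
    and \<delta>: "0 < \<delta>" "chi_bound Q D U \<le> \<delta>\<^sup>2"
  shows "measure_pmf.expectation R.M (\<lambda>\<omega>. \<Sum>z\<in>{1..n}. \<mu> z * R.deficit t \<omega> {} z) \<le> \<delta>"
proof -
  let ?\<kappa> = "8 / L\<^sup>2 + c * real (Suc t) * b"
  let ?A = "exp (12 * b * U) * (exp (2 / L * U) * (1 + 4 / L * Q) + exp (L - D * ln (L / 2)))"
  have Q0: "0 \<le> Q" using q sum_nonneg[of "{1..n}" "\<lambda>y. (\<mu> y)\<^sup>2"]
    by (smt (verit) mult_nonneg_nonneg of_nat_0_le_iff zero_le_power2)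
  have kk: "?\<kappa> \<le> kappa_bound U"
    unfolding kappa_bound_def using c_bounds b_nonneg t by (intro add_left_mono mult_right_mono mult_mono) auto
  have k0: "0 \<le> ?\<kappa>" using c_bounds b_nonneg by simp
  have second: "measure_pmf.expectation R.M (\<lambda>\<omega>. \<Sum>z\<in>{1..n}. \<Sum>y\<in>{1..n}. \<mu> z / \<mu> y * (R.T t \<omega> {} z y)\<^sup>2) \<le> ?A"
  proof -
    have "measure_pmf.expectation R.M (\<lambda>\<omega>. \<Sum>z\<in>{1..n}. \<Sum>y\<in>{1..n}. \<mu> z / \<mu> y * (R.T t \<omega> {} z y)\<^sup>2)
      \<le> c ^ (2 * t) * ((1 + 2 / L) ^ t * (1 + 2 * (2 / L) * card {1..n} * (\<Sum>y\<in>{1..n}. (\<mu> y)\<^sup>2)) + card {1..n} * (2 / L) ^ t)"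
      using L4 by (intro R.expectation_T_squared t) (auto simp: field_simps)
    also have "\<dots> = c ^ (2 * t) * ((1 + 2 / L) ^ t * (1 + 4 / L * (real n * (\<Sum>y\<in>{1..n}. (\<mu> y)\<^sup>2))) + real n * (2 / L) ^ t)"
      by (simp add: mult_ac)
    also have "\<dots> \<le> ?A"
      using L_pos c_bounds q by (intro mult_mono c_power add_mono theta_power stuck_power mult_left_mono
        mult_nonneg_nonneg add_nonneg_nonneg sum_nonneg) auto
    finally show ?thesis .
  qed
  have mass: "1 - U * kappa_bound U \<le> measure_pmf.expectation R.M (\<lambda>\<omega>. \<Sum>y\<in>{1..n}. R.T t \<omega> {} z y)"
    if z: "z \<in> {1..n}" for z
  proof -
    have "real t * ?\<kappa> \<le> U * kappa_bound U" using t kk k0 by (intro mult_mono) auto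
    then have "1 - U * kappa_bound U \<le> 1 + real t * (- ?\<kappa>)" by (simp only: mult_minus_right)
    also have "\<dots> \<le> (1 + (- ?\<kappa>)) ^ t" using kk k by (intro Bernoulli_inequality) auto
    also have "\<dots> = (1 - ?\<kappa>) ^ t" by (simp only: add_uminus_conv_diff)
    also have "\<dots> \<le> measure_pmf.expectation R.M (\<lambda>\<omega>. \<Sum>y\<in>{1..n}. R.T t \<omega> {} z y)"
      using kk k by (intro R.expectation_T_mass mean_row_ge mu_le z) auto
    finally show ?thesis .
  qed
  have "measure_pmf.expectation R.M (\<lambda>\<omega>. \<Sum>z\<in>{1..n}. \<mu> z * R.deficit t \<omega> {} z)
     \<le> \<delta> / 2 + (?A - 2 * (1 - U * kappa_bound U) + 1) / (2 * \<delta>)"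
    by (rule R.expectation_deficit[OF \<delta>(1) second mass])
  also have "?A - 2 * (1 - U * kappa_bound U) + 1 = chi_bound Q D U" by (simp add: chi_bound_def algebra_simps)
  also have "\<delta> / 2 + chi_bound Q D U / (2 * \<delta>) \<le> \<delta> / 2 + \<delta>\<^sup>2 / (2 * \<delta>)"
    using \<delta> by (intro add_left_mono divide_right_mono) auto
  also have "\<dots> = \<delta>" using \<delta> by (simp add: power2_eq_square)
  finally show ?thesis .
qed

lemma expectation_through_le:
  "measure_pmf.expectation R.M (\<lambda>\<omega>. \<Sum>x\<in>{1..n}. (R.through t \<omega> x)\<^sup>2) \<le> through_bound U"
proof -
  have "measure_pmf.expectation R.M (\<lambda>\<omega>. \<Sum>x\<in>{1..n}. (R.through t \<omega> x)\<^sup>2)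
     \<le> c ^ (2 * t) * (real (Suc t) ^ 2 * (1 + 2 / L) ^ t * b)"
    by (intro R.expectation_through_squared mu_le)
  also have "\<dots> \<le> through_bound U"
    unfolding through_bound_def using L_pos b_nonneg t
    by (intro mult_mono c_power theta_power power_mono mult_nonneg_nonneg) auto
  finally show ?thesis .
qed

end

end

lemma ln_ratio_limit:
  "0 < A \<Longrightarrow> (\<lambda>n::nat. ln (ln (real n) / 2) / ln (1 + A * ln (real n))) \<longlonglongrightarrow> (1::real)"
  by real_asymp

lemma ln_ratio_limit':
  "0 < A \<Longrightarrow> (\<lambda>n::nat. ln (A * ln (real n)) / (ln (ln (real n) / 2) - 1)) \<longlonglongrightarrow> (1::real)"
  by real_asymp

lemma stuck_limit:
  fixes \<beta> A :: real assumes "0 < \<beta>" "0 < A"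
  shows "(\<lambda>n::nat. exp (ln (real n) - ((1 + \<beta>) * ln (real n) / ln (1 + A * ln (real n)) - 2) * ln (ln (real n) / 2))) \<longlonglongrightarrow> 0"
proof -
  let ?L = "\<lambda>n::nat. ln (real n)"
  have "(\<lambda>n. 1 - (1 + \<beta>) * (ln (?L n / 2) / ln (1 + A * ?L n)) + 2 * ln (?L n / 2) / ?L n) \<longlonglongrightarrow> 1 - (1 + \<beta>) * 1 + 0"
    by (intro tendsto_add tendsto_diff tendsto_mult tendsto_const ln_ratio_limit assms) real_asymp
  then have lim: "filterlim (\<lambda>n. (1 - (1 + \<beta>) * (ln (?L n / 2) / ln (1 + A * ?L n)) + 2 * ln (?L n / 2) / ?L n) * ?L n) at_bot sequentially"
    by (rule filterlim_tendsto_neg_mult_at_bot) (use assms in simp, real_asymp)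
  have "eventually (\<lambda>n. (1 - (1 + \<beta>) * (ln (?L n / 2) / ln (1 + A * ?L n)) + 2 * ln (?L n / 2) / ?L n) * ?L n
     = ?L n - ((1 + \<beta>) * ?L n / ln (1 + A * ?L n) - 2) * ln (?L n / 2)) sequentially"
    using eventually_gt_at_top[of 1] by eventually_elim (simp add: field_simps)
  from filterlim_cong[OF refl refl this] lim
  have "filterlim (\<lambda>n. ?L n - ((1 + \<beta>) * ?L n / ln (1 + A * ?L n) - 2) * ln (?L n / 2)) at_bot sequentially"
    by blast
  then show ?thesis by (rule filterlim_compose[OF exp_at_bot])
qed

lemma support_limit:
  fixes \<beta> A :: real assumes "0 < \<beta>" "0 < A"
  shows "(\<lambda>n::nat. exp ((1 - \<beta>) * ln (real n) / (ln (ln (real n) / 2) - 1) * ln (A * ln (real n)) - ln (real n))) \<longlonglongrightarrow> 0"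
proof -
  let ?L = "\<lambda>n::nat. ln (real n)"
  have "(\<lambda>n. (1 - \<beta>) * (ln (A * ?L n) / (ln (?L n / 2) - 1)) - 1) \<longlonglongrightarrow> (1 - \<beta>) * 1 - 1"
    by (intro tendsto_diff tendsto_mult tendsto_const ln_ratio_limit' assms)
  then have "filterlim (\<lambda>n. ((1 - \<beta>) * (ln (A * ?L n) / (ln (?L n / 2) - 1)) - 1) * ?L n) at_bot sequentially"
    by (rule filterlim_tendsto_neg_mult_at_bot) (use assms in simp, real_asymp)
  then have "filterlim (\<lambda>n. (1 - \<beta>) * ?L n / (ln (?L n / 2) - 1) * ln (A * ?L n) - ?L n) at_bot sequentially"
    by (simp add: algebra_simps)
  then show ?thesis by (rule filterlim_compose[OF exp_at_bot])
qed

lemma tv_dist_cong: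
  "(\<And>x. x \<in> {1..n} \<Longrightarrow> q x = q' x) \<Longrightarrow> tv_dist n p q = tv_dist n p q'"
  unfolding tv_dist_def by (auto intro!: sum.cong)

locale chung_lu_seq =
  fixes wp wm :: "nat \<Rightarrow> nat \<Rightarrow> real" and M0 M1 Q :: real
  assumes M0: "1 < M0" and M1: "1 < M1" and Q: "1 \<le> Q"
    and wp: "\<And>n x. 2 \<le> n \<Longrightarrow> x \<in> {1..n} \<Longrightarrow> M0 \<le> wp n x \<and> wp n x \<le> M1"
    and wm: "\<And>n x. 2 \<le> n \<Longrightarrow> x \<in> {1..n} \<Longrightarrow> 0 < wm n x"
    and balanced: "\<And>n. 2 \<le> n \<Longrightarrow> sum (wp n) {1..n} = sum (wm n) {1..n}"
    and wm_sq: "\<And>n. 2 \<le> n \<Longrightarrow> (\<Sum>x\<in>{1..n}. (wm n x)\<^sup>2) \<le> Q * real n"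
begin

definition b :: "nat \<Rightarrow> real" where "b n = sqrt (Q / real n)"

definition mixed :: "real \<Rightarrow> real \<Rightarrow> nat \<Rightarrow> digraph \<Rightarrow> bool" where
  "mixed \<beta> \<epsilon> n G \<longleftrightarrow> (\<forall>x\<in>{1..n}. outdeg n G x \<noteq> 0 \<and>
     real (outdeg n G x) \<le> (2 * M1\<^sup>2 + 2) * ln (real n) \<and>
     tv_dist n (trans_pow n G (nat \<lfloor>(1 + \<beta>) * t_ent n (wp n) (wm n)\<rfloor>) x) (mu_in n (wm n)) \<le> \<epsilon>)"

lemma wm_sum_ge: "2 \<le> n \<Longrightarrow> real n \<le> sum (wm n) {1..n}"
proof -
  assume n: "2 \<le> n"
  have "real n = (\<Sum>x\<in>{1..n}. 1)" by simp
  also have "\<dots> \<le> sum (wp n) {1..n}"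
  proof (intro sum_mono)
    fix x assume "x \<in> {1..n}"
    then have "M0 \<le> wp n x" using wp[OF n] by blast
    then show "1 \<le> wp n x" using M0 by linarith
  qed
  finally show ?thesis using balanced[OF n] by simp
qed

lemma wm_le_sqrt: "2 \<le> n \<Longrightarrow> x \<in> {1..n} \<Longrightarrow> wm n x \<le> b n * real n"
proof -
  assume n: "2 \<le> n" and x: "x \<in> {1..n}"
  have "(wm n x)\<^sup>2 \<le> (\<Sum>x\<in>{1..n}. (wm n x)\<^sup>2)" using x by (intro member_le_sum) auto
  also have "\<dots> \<le> Q * real n" by (rule wm_sq[OF n])
  also have "\<dots> = (b n * real n)\<^sup>2"
  proof -
    have "(b n)\<^sup>2 = Q / real n" unfolding b_def using Q by (intro real_sqrt_pow2) simp
    moreover have "(b n * real n)\<^sup>2 = (b n)\<^sup>2 * (real n * real n)"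
      by (simp add: power2_eq_square)
    ultimately show ?thesis using n by simp
  qed
  finally have "(wm n x)\<^sup>2 \<le> (b n * real n)\<^sup>2" .
  moreover have "0 \<le> b n * real n" unfolding b_def using Q by (intro mult_nonneg_nonneg real_sqrt_ge_zero) auto
  ultimately show ?thesis by (rule power2_le_imp_le)
qed

lemma model:
  assumes n: "2 \<le> n" "6 * b n \<le> 1" "M1 * b n * ln (real n) \<le> 1"
  shows "chung_lu_model n (wp n) (wm n) M0 M1 (b n)"
proof
  show "2 \<le> n" "1 < M0" "6 * b n \<le> 1" using n M0 by simp_all
  show "sum (wp n) {1..n} = sum (wm n) {1..n}" by (rule balanced[OF n(1)])
  fix x assume x: "x \<in> {1..n}"
  show "M0 \<le> wp n x \<and> wp n x \<le> M1" "0 < wm n x" using wp[OF n(1) x] wm[OF n(1) x] by auto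
  have "b n * real n \<le> b n * sum (wm n) {1..n}"
    using Q by (intro mult_left_mono wm_sum_ge n) (auto simp: b_def)
  with wm_le_sqrt[OF n(1) x] show "wm n x \<le> b n * sum (wm n) {1..n}" by linarith
  fix y assume y: "y \<in> {1..n}"
  have "wp n x * wm n y * (ln (real n) / real n) \<le> M1 * (b n * real n) * (ln (real n) / real n)"
    using wp[OF n(1) x] wm[OF n(1) y] wm_le_sqrt[OF n(1) y] M1 n(1)
    by (intro mult_right_mono mult_mono) auto
  also have "\<dots> = M1 * b n * ln (real n)" using n(1) by simp
  finally show "wp n x * wm n y * (ln (real n) / real n) \<le> 1" using n(3) by linarith
qed

lemma mu_sq:
  assumes "2 \<le> n" shows "(\<Sum>y\<in>{1..n}. (mu_in n (wm n) y)\<^sup>2) \<le> Q / real n"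
proof -
  let ?W = "sum (wm n) {1..n}"
  have W: "real n \<le> ?W" "0 < real n" using wm_sum_ge assms by auto
  have "(\<Sum>y\<in>{1..n}. (mu_in n (wm n) y)\<^sup>2) = (\<Sum>y\<in>{1..n}. (wm n y)\<^sup>2) / ?W\<^sup>2"
    by (simp add: mu_in_def power_divide sum_divide_distrib)
  also have "\<dots> \<le> Q * real n / (real n)\<^sup>2"
    using W wm_sq[OF assms] Q by (intro frac_le power_mono) auto
  finally show ?thesis using W by (simp add: power2_eq_square)
qed

lemma whp_mixed:
  assumes \<beta>: "0 < \<beta>" and \<epsilon>: "0 < \<epsilon>"
  shows "(\<lambda>n. measure_pmf.prob (chung_lu n (wp n) (wm n)) {G. \<not> mixed \<beta> \<epsilon> n G}) \<longlonglongrightarrow> 0"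
proof -
  define a where "a = M0\<^sup>2 - 1"
  have a: "0 < a" using M0 by (simp add: a_def)
  have M1s: "0 < M1\<^sup>2" using M1 by simp
  define lam where "lam = max 0 (ln (4 * M0\<^sup>2 / a) / \<epsilon>)"
  have lam: "0 \<le> lam" by (simp add: lam_def)
  have "ln (4 * M0\<^sup>2 / a) \<le> lam * \<epsilon>" using \<epsilon> by (simp add: lam_def max_def field_simps)
  then have "exp (- lam * \<epsilon>) \<le> exp (- ln (4 * M0\<^sup>2 / a))" by simp
  also have "\<dots> = a / (4 * M0\<^sup>2)" using a M0 by (simp add: exp_minus)
  finally have "M0\<^sup>2 * exp (- lam * \<epsilon>) \<le> M0\<^sup>2 * (a / (4 * M0\<^sup>2))" by (intro mult_left_mono) auto
  also have "\<dots> = a / 4" using M0 by simp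
  finally have e_lam: "M0\<^sup>2 * exp (- lam * \<epsilon>) \<le> a / 4" .
  define \<sigma> where "\<sigma> = a / (4 * exp lam * M1\<^sup>2)"
  have \<sigma>: "0 < \<sigma>" using a M1s by (simp add: \<sigma>_def)
  have \<sigma>_eq: "exp lam * M1\<^sup>2 * \<sigma> = a / 4" using M1s by (simp add: \<sigma>_def)
  define L where "L n = ln (real n)" for n :: nat
  define U where "U n = (1 + \<beta>) * L n / (ln (L n / 2) - 1)" for n
  define D where "D n = (1 + \<beta>) * L n / ln (1 + M1\<^sup>2 * L n) - 2" for n
  define X where "X n = exp (12 * b n * U n) * (exp (2 / L n * U n) * (1 + 4 / L n * Q) + exp (L n - D n * ln (L n / 2)))
     - 1 + 2 * U n * (8 / (L n)\<^sup>2 + 2 * (U n + 1) * b n)" for n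
  define Y where "Y n = exp (12 * b n * U n) * ((U n + 1)\<^sup>2 * exp (2 / L n * U n) * b n)" for n
  define \<delta> where "\<delta> n = sqrt (max 0 (X n) + 1 / real n)" for n
  define F where "F n = exp ((1 - (M0\<^sup>2 * (1 - 3 * b n) * (1 - exp (- lam * \<epsilon>)) - a / 4)) * L n)
     + exp (- L n) + \<delta> n * (2 / \<sigma>) + Y n * (2 / \<sigma>)\<^sup>2" for n
  have Q0: "0 < Q" using Q by simp
  have l1: "(\<lambda>n. exp (12 * b n * U n)) \<longlonglongrightarrow> exp 0"
    unfolding b_def U_def L_def using \<beta> Q0 by (intro tendsto_exp) real_asymp
  have l2: "(\<lambda>n. exp (2 / L n * U n)) \<longlonglongrightarrow> exp 0"
    unfolding U_def L_def using \<beta> by (intro tendsto_exp) real_asymp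
  have l3: "(\<lambda>n. exp (L n - D n * ln (L n / 2))) \<longlonglongrightarrow> 0"
    unfolding D_def L_def by (rule stuck_limit[OF \<beta> M1s])
  have l4: "(\<lambda>n. 2 * U n * (8 / (L n)\<^sup>2 + 2 * (U n + 1) * b n)) \<longlonglongrightarrow> 0"
    unfolding b_def U_def L_def using \<beta> Q0 by real_asymp
  have l5: "(\<lambda>n. (U n + 1)\<^sup>2 * b n) \<longlonglongrightarrow> 0"
    unfolding b_def U_def L_def using \<beta> Q0 by real_asymp
  have l6: "(\<lambda>n. 4 / L n * Q) \<longlonglongrightarrow> 0"
    unfolding L_def using Q0 by real_asymp
  have l7: "(\<lambda>n. 8 / (L n)\<^sup>2 + 2 * (U n + 1) * b n) \<longlonglongrightarrow> 0"
    unfolding b_def U_def L_def using \<beta> Q0 by real_asymp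
  have b_lim: "b \<longlonglongrightarrow> 0" unfolding b_def using Q0 by real_asymp
  have bL_lim: "(\<lambda>n. M1 * b n * L n) \<longlonglongrightarrow> 0" unfolding b_def L_def using Q0 by real_asymp
  have L_lim: "filterlim L at_top sequentially" unfolding L_def by real_asymp
  have X_lim: "X \<longlonglongrightarrow> 0"
  proof -
    have "X \<longlonglongrightarrow> exp 0 * (exp 0 * (1 + 0) + 0) - 1 + 0"
      unfolding X_def by (intro tendsto_add tendsto_diff tendsto_mult[OF l1] tendsto_mult[OF l2] tendsto_const l3 l4 l6)
    then show ?thesis by simp
  qed
  have Y_lim: "Y \<longlonglongrightarrow> 0"
  proof -
    have "(\<lambda>n. exp (12 * b n * U n) * (exp (2 / L n * U n) * ((U n + 1)\<^sup>2 * b n))) \<longlonglongrightarrow> exp 0 * (exp 0 * 0)"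
      by (intro tendsto_mult l1 l2 l5)
    then show ?thesis by (simp add: Y_def[abs_def] mult_ac)
  qed
  have \<delta>_lim: "\<delta> \<longlonglongrightarrow> 0"
  proof -
    have "(\<lambda>n. sqrt (max 0 (X n) + 1 / real n)) \<longlonglongrightarrow> sqrt (max 0 0 + 0)"
      by (intro tendsto_real_sqrt tendsto_add tendsto_max tendsto_const X_lim lim_1_over_n)
    then show ?thesis by (simp add: \<delta>_def[abs_def])
  qed
  have "F \<longlonglongrightarrow> 0 + 0 + 0 * (2 / \<sigma>) + 0 * (2 / \<sigma>)\<^sup>2"
    unfolding F_def
  proof (intro tendsto_add tendsto_mult \<delta>_lim Y_lim tendsto_const)
    show "(\<lambda>n. exp (- L n)) \<longlonglongrightarrow> 0" unfolding L_def by real_asymp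
    have "(\<lambda>n. 1 - (M0\<^sup>2 * (1 - 3 * b n) * (1 - exp (- lam * \<epsilon>)) - a / 4))
       \<longlonglongrightarrow> 1 - (M0\<^sup>2 * (1 - 3 * 0) * (1 - exp (- lam * \<epsilon>)) - a / 4)"
      by (intro tendsto_diff tendsto_mult tendsto_const b_lim)
    moreover have "1 - (M0\<^sup>2 * (1 - 3 * 0) * (1 - exp (- lam * \<epsilon>)) - a / 4) < 0"
    proof -
      have "M0\<^sup>2 * (1 - 3 * 0) * (1 - exp (- lam * \<epsilon>)) = M0\<^sup>2 - M0\<^sup>2 * exp (- lam * \<epsilon>)"
        by (simp add: algebra_simps)
      then show ?thesis using e_lam a a_def by linarith
    qed
    ultimately have "filterlim (\<lambda>n. (1 - (M0\<^sup>2 * (1 - 3 * b n) * (1 - exp (- lam * \<epsilon>)) - a / 4)) * L n) at_bot sequentially"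
      using L_lim by (rule filterlim_tendsto_neg_mult_at_bot)
    then show "(\<lambda>n. exp ((1 - (M0\<^sup>2 * (1 - 3 * b n) * (1 - exp (- lam * \<epsilon>)) - a / 4)) * L n)) \<longlonglongrightarrow> 0"
      by (rule filterlim_compose[OF exp_at_bot])
  qed
  then have F_lim: "F \<longlonglongrightarrow> 0" by simp
  have ev_b: "\<forall>\<^sub>F n in sequentially. b n < 1 / 6"
    by (rule order_tendstoD(2)[OF b_lim]) simp
  have ev_bL: "\<forall>\<^sub>F n in sequentially. M1 * b n * L n < 1"
    by (rule order_tendstoD(2)[OF bL_lim]) simp
  have ev_k: "\<forall>\<^sub>F n in sequentially. 8 / (L n)\<^sup>2 + 2 * (U n + 1) * b n < 1"
    by (rule order_tendstoD(2)[OF l7]) simp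
  have "filterlim D at_top sequentially"
    unfolding D_def L_def using \<beta> M1s by real_asymp
  then have ev_D: "\<forall>\<^sub>F n in sequentially. 1 \<le> D n" unfolding filterlim_at_top by blast
  have ev_L: "\<forall>\<^sub>F n in sequentially. 4 \<le> L n" using L_lim unfolding filterlim_at_top by blast
  have "filterlim (\<lambda>n. ln (L n / 2) - 1) at_top sequentially" unfolding L_def by real_asymp
  then have ev_lnL: "\<forall>\<^sub>F n in sequentially. 1 \<le> ln (L n / 2) - 1" unfolding filterlim_at_top by blast
  have "\<forall>\<^sub>F n in sequentially. measure_pmf.prob (chung_lu n (wp n) (wm n)) {G. \<not> mixed \<beta> \<epsilon> n G} \<le> F n"
    using eventually_ge_at_top[of 2] ev_b ev_bL ev_k ev_D ev_L ev_lnL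
  proof eventually_elim
    case (elim n)
    interpret G: chung_lu_model n "wp n" "wm n" M0 M1 "b n"
      using elim by (intro model) (auto simp: L_def)
    have L: "G.L = L n" by (simp add: G.L_def L_def)
    have n: "real n = exp (L n)" using elim by (simp add: L_def)
    let ?H = "entropy_H n (wp n) (wm n)"
    define s where "s = (1 + \<beta>) * t_ent n (wp n) (wm n)"
    define t where "t = nat \<lfloor>s\<rfloor> - 1"
    have H: "ln (L n / 2) - 1 \<le> ?H" "?H \<le> ln (1 + M1\<^sup>2 * L n)"
      using G.entropy_lower G.entropy_upper by (simp_all add: L)
    have s: "s = (1 + \<beta>) * L n / ?H" by (simp add: s_def t_ent_def L_def)
    have sU: "s \<le> U n" unfolding s U_def
      using H elim \<beta> by (intro divide_left_mono mult_pos_pos mult_nonneg_nonneg) auto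
    have sD: "D n + 2 \<le> s" unfolding s D_def
      using H elim \<beta> by (simp, intro divide_left_mono mult_pos_pos mult_nonneg_nonneg) auto
    have fl: "3 \<le> nat \<lfloor>s\<rfloor>" using sD elim by (simp add: le_nat_iff le_floor_iff)
    have T: "nat \<lfloor>s\<rfloor> = Suc t" using fl by (simp add: t_def)
    have "0 \<le> s" using sD elim by linarith
    then have "real (nat \<lfloor>s\<rfloor>) \<le> s" "s - 1 < real (nat \<lfloor>s\<rfloor>)"
      using of_int_floor_le[of s] floor_correct[of s] by (simp_all add: of_nat_nat)
    then have t: "0 < t" "D n \<le> real t" "real t \<le> U n"
      using T fl sU sD by auto
    have mu: "\<And>y. y \<in> {1..n} \<Longrightarrow> G.\<mu> y = mu_in n (wm n) y" by (simp add: G.\<mu>_def)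
    have kap: "G.kappa_bound (U n) \<le> 1" using elim by (simp add: G.kappa_bound_def L)
    have X: "G.chi_bound Q (D n) (U n) = X n" by (simp add: G.chi_bound_def G.kappa_bound_def X_def L)
    have Y: "G.through_bound (U n) = Y n" by (simp add: G.through_bound_def Y_def L)
    have q: "real n * (\<Sum>y\<in>{1..n}. (G.\<mu> y)\<^sup>2) \<le> Q"
    proof -
      have "(\<Sum>y\<in>{1..n}. (G.\<mu> y)\<^sup>2) = (\<Sum>y\<in>{1..n}. (mu_in n (wm n) y)\<^sup>2)"
        by (intro sum.cong refl) (simp only: mu)
      also have "\<dots> \<le> Q / real n" using elim by (intro mu_sq) auto
      finally show ?thesis using elim by (simp add: field_simps)
    qed
    have \<delta>0: "0 < \<delta> n" using elim by (simp add: \<delta>_def add_nonneg_pos)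
    have \<delta>X: "X n \<le> (\<delta> n)\<^sup>2" by (simp add: \<delta>_def add_increasing2)
    have E1: "measure_pmf.expectation G.R.M (\<lambda>\<omega>. \<Sum>z\<in>{1..n}. G.\<mu> z * G.R.deficit t \<omega> {} z) \<le> \<delta> n"
      using elim \<delta>0 \<delta>X X L by (intro G.expectation_deficit_le[OF t _ q kap]) auto
    have E2: "measure_pmf.expectation G.R.M (\<lambda>\<omega>. \<Sum>x\<in>{1..n}. (G.R.through t \<omega> x)\<^sup>2) \<le> Y n"
      using G.expectation_through_le[OF t] elim L Y by simp
    let ?K = "(2 * M1\<^sup>2 + 2) * L n"
    have "measure_pmf.prob (chung_lu n (wp n) (wm n)) {G. \<not> mixed \<beta> \<epsilon> n G}
      = measure_pmf.prob G.R.M {\<omega>. \<not> mixed \<beta> \<epsilon> n (case_prod \<omega>)}"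
      unfolding G.chung_lu_rows by (simp add: vimage_def)
    also have "\<dots> \<le> measure_pmf.prob G.R.M {\<omega>. \<not> G.good t \<epsilon> ?K \<omega>}"
    proof (rule measure_pmf.finite_measure_mono_AE)
      have "mixed \<beta> \<epsilon> n (case_prod \<omega>)" if "\<omega> \<in> set_pmf G.R.M" "G.good t \<epsilon> ?K \<omega>" for \<omega>
        unfolding mixed_def s_def[symmetric] T
      proof (intro ballI conjI)
        fix x assume x: "x \<in> {1..n}"
        note g = G.good_imp[OF that x]
        show "outdeg n (case_prod \<omega>) x \<noteq> 0" by (rule g)
        show "real (outdeg n (case_prod \<omega>) x) \<le> (2 * M1\<^sup>2 + 2) * ln (real n)" using g(2) by (simp add: L_def)
        show "tv_dist n (trans_pow n (case_prod \<omega>) (Suc t) x) (mu_in n (wm n)) \<le> \<epsilon>"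
          using g(3) tv_dist_cong[of n G.\<mu> "mu_in n (wm n)", OF mu] by simp
      qed
      then show "AE \<omega> in measure_pmf G.R.M. \<omega> \<in> {\<omega>. \<not> mixed \<beta> \<epsilon> n (case_prod \<omega>)} \<longrightarrow> \<omega> \<in> {\<omega>. \<not> G.good t \<epsilon> ?K \<omega>}"
        by (auto simp: AE_measure_pmf_iff)
    qed simp
    also have "\<dots> \<le> real n * exp (- (L n * (M0\<^sup>2 / G.c * (1 - exp (- lam * \<epsilon>)) - exp lam * M1\<^sup>2 * \<sigma>)))
      + real n * exp (2 * M1\<^sup>2 * L n - ?K) + \<delta> n * (2 / \<sigma>) + Y n * (2 / \<sigma>)\<^sup>2"
      using G.prob_not_good[OF lam \<epsilon> \<sigma> E1 E2, of ?K] by (simp only: L)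
    also have "\<dots> = F n"
    proof -
      have exp_L: "real n * exp (- (L n * z)) = exp ((1 - z) * L n)" for z
        by (simp only: n mult_exp_exp) (simp add: algebra_simps)
      have "M0\<^sup>2 / G.c = M0\<^sup>2 * (1 - 3 * b n)" by (simp add: G.c_def)
      moreover have "real n * exp (2 * M1\<^sup>2 * L n - ?K) = exp (- L n)"
        by (simp only: n mult_exp_exp) (simp add: algebra_simps)
      ultimately show ?thesis by (simp only: F_def exp_L \<sigma>_eq)
    qed
    finally show ?case .
  qed
  then show ?thesis
    by (rule tendsto_sandwich[OF _ _ tendsto_const F_lim, rotated]) simp
qed

end

theorem theorem1p3:
  fixes wp wm :: "nat \<Rightarrow> nat \<Rightarrow> real"
    and \<pi> :: "nat \<Rightarrow> digraph \<Rightarrow> nat pmf"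
    and M0 M1 M2 \<eta> \<beta> :: real
  assumes "M0 > 1" and "M1 > 1" and "M2 > 0" and "0 < \<eta>" and "\<eta> < 1"
    and "\<And>n x. n \<ge> 2 \<Longrightarrow> x \<in> {1..n} \<Longrightarrow> wp n x > 0 \<and> wm n x > 0"
    and "\<And>n. n \<ge> 2 \<Longrightarrow> (\<Sum>x\<in>{1..n}. wp n x) = (\<Sum>x\<in>{1..n}. wm n x)"
    and "\<And>n x. n \<ge> 2 \<Longrightarrow> x \<in> {1..n} \<Longrightarrow> M0 \<le> wp n x \<and> wp n x \<le> M1"
    and "\<And>n. n \<ge> 2 \<Longrightarrow> (\<Sum>x\<in>{1..n}. wm n x powr (2 + \<eta>)) \<le> M2 * real n"
    and "\<And>n G. n \<ge> 2 \<Longrightarrow> set_pmf (\<pi> n G) \<subseteq> {1..n}"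
    and "\<And>n G. n \<ge> 2 \<Longrightarrow> \<exists>!\<nu>. invariant_prob n G \<nu> \<Longrightarrow> invariant_prob n G (\<pi> n G)"
    and "\<beta> > 0"
  shows "(\<beta> \<le> 1 \<longrightarrow>
           tendsto_in_prob (\<lambda>n. chung_lu n (wp n) (wm n))
             (\<lambda>n G. MIN x\<in>{1..n}.
                tv_dist n (trans_pow n G (nat \<lfloor>(1 - \<beta>) * t_ent n (wp n) (wm n)\<rfloor>) x) (pmf (\<pi> n G)))
             1)
       \<and> tendsto_in_prob (\<lambda>n. chung_lu n (wp n) (wm n))
             (\<lambda>n G. MAX x\<in>{1..n}.
                tv_dist n (trans_pow n G (nat \<lfloor>(1 + \<beta>) * t_ent n (wp n) (wm n)\<rfloor>) x) (pmf (\<pi> n G)))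
             0"
proof -
  define Q where "Q = 1 + M2"
  interpret S: chung_lu_seq wp wm M0 M1 Q
  proof
    fix n :: nat assume n: "2 \<le> n"
    have "(\<Sum>x\<in>{1..n}. (wm n x)\<^sup>2) \<le> (\<Sum>x\<in>{1..n}. 1 + wm n x powr (2 + \<eta>))"
    proof (intro sum_mono)
      fix x assume "x \<in> {1..n}"
      then have w: "0 < wm n x" using assms(6)[OF n] by auto
      show "(wm n x)\<^sup>2 \<le> 1 + wm n x powr (2 + \<eta>)"
      proof (cases "wm n x \<le> 1")
        case True
        then have "(wm n x)\<^sup>2 \<le> 1" using w by (simp add: power_le_one)
        then show ?thesis by (smt (verit) powr_ge_zero)
      next
        case False
        have "(wm n x)\<^sup>2 = wm n x powr 2" using w by (simp add: powr_numeral)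
        also have "\<dots> \<le> wm n x powr (2 + \<eta>)" using False assms(4) by (intro powr_mono) auto
        finally show ?thesis by simp
      qed
    qed
    also have "\<dots> \<le> Q * real n" using assms(9)[OF n] by (simp add: sum.distrib Q_def algebra_simps)
    finally show "(\<Sum>x\<in>{1..n}. (wm n x)\<^sup>2) \<le> Q * real n" .
  qed (use assms in \<open>auto simp: Q_def\<close>)
  have inv: "tv_dist n (pmf (\<pi> n G)) (mu_in n (wm n)) \<le> \<epsilon>"
    if "2 \<le> n" "S.mixed \<beta> \<epsilon> n G" "\<epsilon> \<le> 1/4" for n G \<epsilon>
  proof (rule tv_invariant)
    let ?t = "nat \<lfloor>(1 + \<beta>) * t_ent n (wp n) (wm n)\<rfloor>"
    show tv: "tv_dist n (trans_pow n G ?t x) (mu_in n (wm n)) \<le> \<epsilon>" if "x \<in> {1..n}" for x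
      using that \<open>S.mixed \<beta> \<epsilon> n G\<close> unfolding S.mixed_def by blast
    have "\<exists>!\<nu>. invariant_prob n G \<nu>"
    proof (rule ex1_invariant_prob)
      show "tv_dist n (trans_pow n G ?t x) (mu_in n (wm n)) \<le> 1/4" if "x \<in> {1..n}" for x
        using tv[OF that] \<open>\<epsilon> \<le> 1/4\<close> by linarith
      show "outdeg n G x \<noteq> 0" if "x \<in> {1..n}" for x
        using that \<open>S.mixed \<beta> \<epsilon> n G\<close> unfolding S.mixed_def by blast
    qed (use \<open>2 \<le> n\<close> in simp)
    then show "invariant_prob n G (\<pi> n G)" by (rule assms(11)[OF \<open>2 \<le> n\<close>])
  qed
  have pi_sum: "sum (pmf (\<pi> n G)) {1..n} = 1" if "2 \<le> n" for n G
    using assms(10)[OF that] by (intro sum_pmf_eq_1) auto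
  have conv: "tendsto_in_prob (\<lambda>n. chung_lu n (wp n) (wm n)) Z z"
    if "\<And>e. 0 < e \<Longrightarrow> \<exists>\<epsilon>>0. \<forall>\<^sub>F n in sequentially. \<forall>G. S.mixed \<beta> \<epsilon> n G \<longrightarrow> \<bar>Z n G - z\<bar> \<le> e" for Z z
    unfolding tendsto_in_prob_def
  proof (intro allI impI)
    fix e :: real assume "0 < e"
    then obtain \<epsilon> where \<epsilon>: "0 < \<epsilon>" "\<forall>\<^sub>F n in sequentially. \<forall>G. S.mixed \<beta> \<epsilon> n G \<longrightarrow> \<bar>Z n G - z\<bar> \<le> e"
      using \<open>\<And>e. 0 < e \<Longrightarrow> _\<close> by blast
    have "\<forall>\<^sub>F n in sequentially. measure_pmf.prob (chung_lu n (wp n) (wm n)) {G. \<bar>Z n G - z\<bar> > e}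
       \<le> measure_pmf.prob (chung_lu n (wp n) (wm n)) {G. \<not> S.mixed \<beta> \<epsilon> n G}"
      using \<epsilon>(2) by eventually_elim (intro measure_pmf.finite_measure_mono, force+)
    then show "(\<lambda>n. measure_pmf.prob (chung_lu n (wp n) (wm n)) {G. \<bar>Z n G - z\<bar> > e}) \<longlonglongrightarrow> 0"
      by (rule tendsto_sandwich[OF _ _ tendsto_const S.whp_mixed[OF \<open>\<beta> > 0\<close> \<epsilon>(1)], rotated]) simp
  qed
  have upper: "tendsto_in_prob (\<lambda>n. chung_lu n (wp n) (wm n))
             (\<lambda>n G. MAX x\<in>{1..n}.
                tv_dist n (trans_pow n G (nat \<lfloor>(1 + \<beta>) * t_ent n (wp n) (wm n)\<rfloor>) x) (pmf (\<pi> n G)))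
             0"
  proof (rule conv)
    fix e :: real assume e: "0 < e"
    define \<epsilon> where "\<epsilon> = min (1/4) (e / 2)"
    have "\<bar>(MAX x\<in>{1..n}. tv_dist n (trans_pow n G (nat \<lfloor>(1 + \<beta>) * t_ent n (wp n) (wm n)\<rfloor>) x) (pmf (\<pi> n G))) - 0\<bar> \<le> e"
      if n: "2 \<le> n" and G: "S.mixed \<beta> \<epsilon> n G" for n G
    proof -
      let ?f = "\<lambda>x. tv_dist n (trans_pow n G (nat \<lfloor>(1 + \<beta>) * t_ent n (wp n) (wm n)\<rfloor>) x) (pmf (\<pi> n G))"
      have ne: "?f ` {1..n} \<noteq> {}" using n by simp
      have le: "?f x \<le> e" if x: "x \<in> {1..n}" for x
      proof -
        have "?f x \<le> tv_dist n (trans_pow n G (nat \<lfloor>(1 + \<beta>) * t_ent n (wp n) (wm n)\<rfloor>) x) (mu_in n (wm n))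
            + tv_dist n (pmf (\<pi> n G)) (mu_in n (wm n))"
          by (rule tv_dist_triangle)
        also have "\<dots> \<le> \<epsilon> + \<epsilon>"
        proof (rule add_mono)
          show "tv_dist n (trans_pow n G (nat \<lfloor>(1 + \<beta>) * t_ent n (wp n) (wm n)\<rfloor>) x) (mu_in n (wm n)) \<le> \<epsilon>"
            using G x unfolding S.mixed_def by blast
          show "tv_dist n (pmf (\<pi> n G)) (mu_in n (wm n)) \<le> \<epsilon>"
            by (rule inv[OF n G]) (simp add: \<epsilon>_def)
        qed
        finally show ?thesis by (simp add: \<epsilon>_def)
      qed
      have "0 \<le> ?f 1" by (simp add: tv_dist_def sum_nonneg)
      also have "\<dots> \<le> Max (?f ` {1..n})" using n by (intro Max_ge) auto
      finally have "0 \<le> Max (?f ` {1..n})" .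
      moreover have "Max (?f ` {1..n}) \<le> e" using ne le by (subst Max_le_iff) auto
      ultimately show ?thesis by simp
    qed
    then have "\<forall>\<^sub>F n in sequentially. \<forall>G. S.mixed \<beta> \<epsilon> n G \<longrightarrow>
       \<bar>(MAX x\<in>{1..n}. tv_dist n (trans_pow n G (nat \<lfloor>(1 + \<beta>) * t_ent n (wp n) (wm n)\<rfloor>) x) (pmf (\<pi> n G))) - 0\<bar> \<le> e"
      by (intro eventually_mono[OF eventually_ge_at_top[of 2]]) blast
    moreover have "0 < \<epsilon>" using e by (simp add: \<epsilon>_def)
    ultimately show "\<exists>\<epsilon>>0. \<forall>\<^sub>F n in sequentially. \<forall>G. S.mixed \<beta> \<epsilon> n G \<longrightarrow>
       \<bar>(MAX x\<in>{1..n}. tv_dist n (trans_pow n G (nat \<lfloor>(1 + \<beta>) * t_ent n (wp n) (wm n)\<rfloor>) x) (pmf (\<pi> n G))) - 0\<bar> \<le> e"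
      by blast
  qed
  have lower: "tendsto_in_prob (\<lambda>n. chung_lu n (wp n) (wm n))
             (\<lambda>n G. MIN x\<in>{1..n}.
                tv_dist n (trans_pow n G (nat \<lfloor>(1 - \<beta>) * t_ent n (wp n) (wm n)\<rfloor>) x) (pmf (\<pi> n G)))
             1" if \<beta>1: "\<beta> \<le> 1"
  proof (rule conv)
    fix e :: real assume e: "0 < e"
    define \<epsilon> where "\<epsilon> = min (1/4) (e / 2)"
    define K where "K = 2 * M1\<^sup>2 + 2"
    have K: "0 < K" using assms(2) by (simp add: K_def add_nonneg_pos)
    let ?L = "\<lambda>n::nat. ln (real n)"
    define R where "R n = exp ((1 - \<beta>) * ?L n / (ln (?L n / 2) - 1) * ln (K * ?L n) - ?L n) * Q" for n
    have "R \<longlonglongrightarrow> 0 * Q" unfolding R_def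
      by (intro tendsto_mult tendsto_const support_limit \<open>\<beta> > 0\<close> K)
    then have "(\<lambda>n. sqrt (R n)) \<longlonglongrightarrow> sqrt 0" by (intro tendsto_real_sqrt) simp
    then have ev_R: "\<forall>\<^sub>F n in sequentially. sqrt (R n) < e / 2"
      using e by (intro order_tendstoD(2)) auto
    have ev_b: "\<forall>\<^sub>F n in sequentially. S.b n < 1 / 6"
    proof (rule order_tendstoD(2))
      show "S.b \<longlonglongrightarrow> 0" unfolding S.b_def using S.Q by real_asymp
    qed simp
    have ev_bL: "\<forall>\<^sub>F n in sequentially. M1 * S.b n * ?L n < 1"
    proof (rule order_tendstoD(2))
      show "(\<lambda>n. M1 * S.b n * ?L n) \<longlonglongrightarrow> 0" unfolding S.b_def using S.Q by real_asymp
    qed simp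
    have "filterlim (\<lambda>n. ln (?L n / 2) - 1) at_top sequentially" by real_asymp
    then have ev_lnL: "\<forall>\<^sub>F n in sequentially. 1 \<le> ln (?L n / 2) - 1" unfolding filterlim_at_top by blast
    have "filterlim (\<lambda>n. K * ?L n) at_top sequentially" using K by real_asymp
    then have ev_KL: "\<forall>\<^sub>F n in sequentially. 1 \<le> K * ?L n" unfolding filterlim_at_top by blast
    have "\<forall>\<^sub>F n in sequentially. \<forall>G. S.mixed \<beta> \<epsilon> n G \<longrightarrow>
       \<bar>(MIN x\<in>{1..n}. tv_dist n (trans_pow n G (nat \<lfloor>(1 - \<beta>) * t_ent n (wp n) (wm n)\<rfloor>) x) (pmf (\<pi> n G))) - 1\<bar> \<le> e"
      using eventually_ge_at_top[of 2] ev_R ev_b ev_bL ev_lnL ev_KL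
    proof eventually_elim
      case (elim n)
      interpret C: chung_lu_model n "wp n" "wm n" M0 M1 "S.b n"
        using elim by (intro S.model) auto
      have n: "2 \<le> n" using elim by simp
      let ?s = "nat \<lfloor>(1 - \<beta>) * t_ent n (wp n) (wm n)\<rfloor>"
      have H: "ln (?L n / 2) - 1 \<le> entropy_H n (wp n) (wm n)"
        using C.entropy_lower by (simp add: C.L_def)
      have "(1 - \<beta>) * t_ent n (wp n) (wm n) \<le> (1 - \<beta>) * (?L n / (ln (?L n / 2) - 1))"
        unfolding t_ent_def using H elim \<beta>1 by (intro mult_left_mono divide_left_mono mult_pos_pos) auto
      moreover have "0 \<le> (1 - \<beta>) * t_ent n (wp n) (wm n)"
        unfolding t_ent_def using H elim \<beta>1 by (intro mult_nonneg_nonneg divide_nonneg_nonneg) auto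
      ultimately have s: "real ?s \<le> (1 - \<beta>) * ?L n / (ln (?L n / 2) - 1)"
        by (simp add: of_nat_nat) (use of_int_floor_le order_trans in blast)
      have ln0: "0 \<le> ln (K * ?L n)" using elim by simp
      have R: "real (nat \<lfloor>K * ?L n\<rfloor>) ^ ?s * (Q / real n) \<le> R n"
      proof -
        have "real (nat \<lfloor>K * ?L n\<rfloor>) ^ ?s \<le> (K * ?L n) ^ ?s"
          using elim by (intro power_mono) auto
        also have "\<dots> = exp (real ?s * ln (K * ?L n))" using elim by (simp add: exp_of_nat_mult)
        also have "\<dots> \<le> exp ((1 - \<beta>) * ?L n / (ln (?L n / 2) - 1) * ln (K * ?L n))"
          using mult_right_mono[OF s ln0] by simp
        finally have "real (nat \<lfloor>K * ?L n\<rfloor>) ^ ?s * (Q / real n)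
          \<le> exp ((1 - \<beta>) * ?L n / (ln (?L n / 2) - 1) * ln (K * ?L n)) * (Q / real n)"
          using S.Q by (intro mult_right_mono) auto
        also have "\<dots> = R n" using n by (simp add: R_def exp_diff)
        finally show ?thesis .
      qed
      show ?case
      proof (intro allI impI)
        fix G assume G: "S.mixed \<beta> \<epsilon> n G"
        let ?f = "\<lambda>x. tv_dist n (trans_pow n G ?s x) (pmf (\<pi> n G))"
        have deg: "outdeg n G x \<noteq> 0" "outdeg n G x \<le> nat \<lfloor>K * ?L n\<rfloor>" if "x \<in> {1..n}" for x
          using G that by (auto simp: S.mixed_def K_def le_nat_iff le_floor_iff simp del: One_nat_def)
        have mu1: "sum (mu_in n (wm n)) {1..n} = 1"
        proof -
          have "sum (mu_in n (wm n)) {1..n} = sum C.\<mu> {1..n}"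
            by (intro sum.cong) (auto simp: C.\<mu>_def)
          then show ?thesis using C.mu_sum by simp
        qed
        have ge: "1 - e \<le> ?f x" if x: "x \<in> {1..n}" for x
        proof -
          have "1 - sqrt (real (nat \<lfloor>K * ?L n\<rfloor>) ^ ?s * (Q / real n)) - \<epsilon> \<le> ?f x"
            by (rule tv_trans_pow_ge[OF deg inv[OF n G] pi_sum[OF n] mu1 S.mu_sq[OF n] x])
              (auto simp: \<epsilon>_def)
          moreover have "sqrt (real (nat \<lfloor>K * ?L n\<rfloor>) ^ ?s * (Q / real n)) \<le> sqrt (R n)"
            using R by simp
          moreover have "\<epsilon> \<le> e / 2" by (simp add: \<epsilon>_def)
          ultimately show ?thesis using elim by linarith
        qed
        have le: "?f 1 \<le> 1"
          using n pi_sum[OF n, of G]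
          by (intro tv_dist_le_1 trans_pow_row_le trans_pow_nonneg) auto
        have fin: "finite (?f ` {1..n})" "?f ` {1..n} \<noteq> {}" using n by auto
        have "Min (?f ` {1..n}) \<le> ?f 1" using n by (intro Min_le) auto
        moreover have "1 - e \<le> Min (?f ` {1..n})" using fin ge by (subst Min_ge_iff) auto
        ultimately show "\<bar>(MIN x\<in>{1..n}. ?f x) - 1\<bar> \<le> e" using le e by linarith
      qed
    qed
    moreover have "0 < \<epsilon>" using e by (simp add: \<epsilon>_def)
    ultimately show "\<exists>\<epsilon>>0. \<forall>\<^sub>F n in sequentially. \<forall>G. S.mixed \<beta> \<epsilon> n G \<longrightarrow>
       \<bar>(MIN x\<in>{1..n}. tv_dist n (trans_pow n G (nat \<lfloor>(1 - \<beta>) * t_ent n (wp n) (wm n)\<rfloor>) x) (pmf (\<pi> n G))) - 1\<bar> \<le> e"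
      by blast
  qed
  show ?thesis using lower upper by blast
qed

end
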